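(* Let $(M,J,g)$ be a Kähler manifold of complex dimension $4$, let $N\subset M$ be a Cayley submanifold, let $N_r$ be its totally real part, and let $\gamma$ be the $1$-form on $N_r$ given by $$\gamma(X)=\sqrt{-1}\,(\nabla_X\Omega_N)(\vec u)=\frac{(i_{\vec H}\,\omega)(X)}{\lambda^2-1}.$$ Then $$d\gamma=\rho|_N\qquad\text{on } N_r,$$ where $\rho$ is the Ricci form of $\omega$.
   Context: $\omega(X,Y)=g(JX,Y)$ is the Kähler form. For an oriented submanifold $N\subset M$ of real dimension $4$, $*_N$ is the Hodge operator of the induced metric and orientation; $N$ is a Cayley submanifold if $\omega|_N=*_N\,\omega|_N$. For such $N$, if $B_x=\pi_{T_xN}\circ J_x|_{T_xN}$ ($\pi_{T_xN}$ the orthogonal projection onto $T_xN$), then $B_x^2=-\lambda(x)^2\,\mathrm{Id}$ for a function $\lambda\ge 0$ on $N$ with values in $[0,1]$, and $\lambda^2$ is smooth. The totally real part is the open set $N_r=\{x\in N: T_xN\cap J(T_xN)=0\}=\{x\in N:\lambda(x)<1\}$. A $(4,0)$-form $\Omega$ is normalized if $\frac{\omega^4}{4!}=\left(\frac{\sqrt{-1}}{2}\right)^4\Omega\wedge\overline\Omega$. $\Omega_N$ is the section over $N_r$ of $K_M|_N=\Lambda^{4,0}(M)|_N$ such that at each point $x\in N_r$, $\Omega_N$ is the unique normalized $(4,0)$-form on $T_xM$ with $\Omega_N(T_xN)>0$ (evaluated, in particular real, on a positive orthonormal basis of $T_xN$). $\nabla$ is the Levi-Civita connection of $g$ and also the induced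 connection on $K_M|_N$. $\vec u=u_1\wedge u_2\wedge u_3\wedge u_4$, where $u_1,\dots,u_4$ is a unitary basis of $T_xM$ (i.e. $g(u_i,u_j)=\delta_{ij}$, $\omega(u_i,u_j)=0$) with $\Omega_N(\vec u)=1$; $\gamma$ does not depend on the choice of such a basis. $\vec H=\sum_{i=1}^4 h(e_i,e_i)$ is the mean curvature vector of $N$ ($h$ the second fundamental form, $\{e_i\}$ an orthonormal basis of $TN$; no factor $1/4$), and $(i_{\vec H}\,\omega)(X)=\omega(\vec H,X)$. Sign conventions: $d\gamma(X,Y)=X\gamma(Y)-Y\gamma(X)-\gamma([X,Y])$, and $\rho(X,Y)=\mathrm{Ric}(X,JY)$; equivalently, for every local $(4,0)$-form $\Omega$, $\mathrm{R}_{XY}\Omega=\sqrt{-1}\,\rho(X,Y)\,\Omega$ with $\mathrm{R}_{XY}=\nabla_{[X,Y]}-\nabla_X\nabla_Y+\nabla_Y\nabla_X$. *)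

theory Defs
  imports "HOL-Analysis.Analysis"
begin

section \<open>Smooth and holomorphic maps between open sets\<close>

primrec Ck_on :: "nat \<Rightarrow> 'a::euclidean_space set \<Rightarrow> ('a \<Rightarrow> 'b::real_normed_vector) \<Rightarrow> bool" where
  "Ck_on 0 S f \<longleftrightarrow> continuous_on S f"
| "Ck_on (Suc k) S f \<longleftrightarrow>
     (\<forall>x\<in>S. f differentiable (at x)) \<and> (\<forall>v. Ck_on k S (\<lambda>x. frechet_derivative f (at x) v))"

definition smooth_on :: "'a::euclidean_space set \<Rightarrow> ('a \<Rightarrow> 'b::real_normed_vector) \<Rightarrow> bool" where
  "smooth_on S f \<longleftrightarrow> (\<forall>k. Ck_on k S f)"

definition J :: "complex^4 \<Rightarrow> complex^4" where
  "J v = \<i> *s v"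

definition holomorphic_map_on :: "(complex^4) set \<Rightarrow> (complex^4 \<Rightarrow> complex^4) \<Rightarrow> bool" where
  "holomorphic_map_on S f \<longleftrightarrow>
     (\<forall>x\<in>S. f differentiable (at x) \<and>
        (\<forall>v. frechet_derivative f (at x) (J v) = J (frechet_derivative f (at x) v)))"


section \<open>Kaehler manifolds of complex dimension 4\<close>

text \<open>
  The manifold is the type \<open>'m\<close> with a holomorphic atlas of charts \<open>(U, \<phi>)\<close>. In a chart the real
  tangent spaces are \<open>complex^4\<close> (real dimension 8), and the complex structure is multiplication by
  \<open>\<i>\<close>. A tensor field is given by its components in every chart, subject to the transformation law:
  \<open>g c y v w\<close> is the value at the coordinate point \<open>y\<close> of chart \<open>c\<close>.
\<close>

type_synonym 'm chart = "'m set \<times> ('m \<Rightarrow> complex^4)"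

type_synonym metric_field = "complex^4 \<Rightarrow> complex^4 \<Rightarrow> complex^4 \<Rightarrow> real"

definition transition :: "'m chart \<Rightarrow> 'm chart \<Rightarrow> complex^4 \<Rightarrow> complex^4" where
  "transition c d = snd d \<circ> inv_into (fst c) (snd c)"

definition complex_atlas :: "'m::topological_space chart set \<Rightarrow> bool" where
  "complex_atlas A \<longleftrightarrow>
     (\<Union>c\<in>A. fst c) = UNIV \<and>
     (\<forall>(U, \<phi>)\<in>A. open U \<and> open (\<phi> ` U) \<and> homeomorphism U (\<phi> ` U) \<phi> (inv_into U \<phi>)) \<and>
     (\<forall>c\<in>A. \<forall>d\<in>A. holomorphic_map_on (snd c ` (fst c \<inter> fst d)) (transition c d))"

definition kform :: "(complex^4 \<Rightarrow> complex^4 \<Rightarrow> real) \<Rightarrow> complex^4 \<Rightarrow> complex^4 \<Rightarrow> real" where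
  "kform G v w = G (J v) w"

definition hermitian_inner :: "(complex^4 \<Rightarrow> complex^4 \<Rightarrow> real) \<Rightarrow> bool" where
  "hermitian_inner G \<longleftrightarrow>
     bilinear G \<and> (\<forall>v w. G v w = G w v) \<and> (\<forall>v. v \<noteq> 0 \<longrightarrow> G v v > 0) \<and>
     (\<forall>v w. G (J v) (J w) = G v w)"

definition hermitian_metric :: "'m chart set \<Rightarrow> ('m chart \<Rightarrow> metric_field) \<Rightarrow> bool" where
  "hermitian_metric A g \<longleftrightarrow>
     (\<forall>c\<in>A. (\<forall>y\<in>snd c ` fst c. hermitian_inner (g c y)) \<and>
            (\<forall>v w. smooth_on (snd c ` fst c) (\<lambda>y. g c y v w))) \<and>
     (\<forall>c\<in>A. \<forall>d\<in>A. \<forall>x\<in>fst c \<inter> fst d. \<forall>v w.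
        g c (snd c x) v w =
          g d (snd d x) (frechet_derivative (transition c d) (at (snd c x)) v)
                        (frechet_derivative (transition c d) (at (snd c x)) w))"

text \<open>Exterior derivative of the Kaehler form, evaluated on constant vector fields of the chart.\<close>

definition d_kform :: "metric_field \<Rightarrow> complex^4 \<Rightarrow> complex^4 \<Rightarrow> complex^4 \<Rightarrow> complex^4 \<Rightarrow> real" where
  "d_kform G y u v w =
     frechet_derivative (\<lambda>z. kform (G z) v w) (at y) u +
     frechet_derivative (\<lambda>z. kform (G z) w u) (at y) v +
     frechet_derivative (\<lambda>z. kform (G z) u v) (at y) w"

definition kaehler_manifold ::
  "'m::{t2_space,second_countable_topology} chart set \<Rightarrow> ('m chart \<Rightarrow> metric_field) \<Rightarrow> bool" where
  "kaehler_manifold A g \<longleftrightarrow>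
     complex_atlas A \<and> hermitian_metric A g \<and>
     (\<forall>c\<in>A. \<forall>y\<in>snd c ` fst c. \<forall>u v w. d_kform (g c) y u v w = 0)"


section \<open>Levi-Civita connection and Ricci form\<close>

text \<open>
  \<open>christoffel G y v w\<close> is the covariant derivative, in direction \<open>v\<close> at \<open>y\<close>, of the constant vector
  field \<open>w\<close> with respect to the unique torsion-free metric connection.
\<close>

definition christoffel :: "metric_field \<Rightarrow> complex^4 \<Rightarrow> complex^4 \<Rightarrow> complex^4 \<Rightarrow> complex^4" where
  "christoffel G y = (THE \<Gamma>. bilinear \<Gamma> \<and> (\<forall>v w. \<Gamma> v w = \<Gamma> w v) \<and>
     (\<forall>u v w. frechet_derivative (\<lambda>z. G z v w) (at y) u = G y (\<Gamma> u v) w + G y v (\<Gamma> u w)))"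

text \<open>
  Convention: \<open>curvature G y u v w\<close> is \<open>\<nabla>\<^sub>u \<nabla>\<^sub>v w - \<nabla>\<^sub>v \<nabla>\<^sub>u w - \<nabla>\<^bsub>[u,v]\<^esub> w\<close>, and the Ricci tensor is the
  trace of \<open>u \<mapsto> curvature G y u v w\<close>, so that round spheres have positive Ricci curvature.
  \<open>Basis\<close> is the standard real basis of the coordinate space; the trace does not depend on it.
\<close>

definition curvature ::
  "metric_field \<Rightarrow> complex^4 \<Rightarrow> complex^4 \<Rightarrow> complex^4 \<Rightarrow> complex^4 \<Rightarrow> complex^4" where
  "curvature G y u v w =
     frechet_derivative (\<lambda>z. christoffel G z v w) (at y) u -
     frechet_derivative (\<lambda>z. christoffel G z u w) (at y) v +
     christoffel G y u (christoffel G y v w) - christoffel G y v (christoffel G y u w)"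

definition ricci :: "metric_field \<Rightarrow> complex^4 \<Rightarrow> complex^4 \<Rightarrow> complex^4 \<Rightarrow> real" where
  "ricci G y v w = (\<Sum>b\<in>Basis. curvature G y b v w \<bullet> b)"

definition ricci_form :: "metric_field \<Rightarrow> complex^4 \<Rightarrow> complex^4 \<Rightarrow> complex^4 \<Rightarrow> real" where
  "ricci_form G y v w = ricci G y v (J w)"


section \<open>Oriented submanifolds of real dimension 4\<close>

text \<open>
  The oriented smooth structure of \<open>N\<close> is given by a set of local parametrizations \<open>(W, F)\<close> with
  \<open>W\<close> open in \<open>real^4\<close> and \<open>F\<close> injective on \<open>W\<close>. \<open>N\<close> is not required to carry the subspace
  topology, so injectively immersed submanifolds are included along with embedded ones.
\<close>

type_synonym 'm param = "(real^4) set \<times> (real^4 \<Rightarrow> 'm)"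

definition local_dom :: "'m chart \<Rightarrow> 'm param \<Rightarrow> (real^4) set" where
  "local_dom c S = {p \<in> fst S. snd S p \<in> fst c}"

definition local_map :: "'m chart \<Rightarrow> 'm param \<Rightarrow> real^4 \<Rightarrow> complex^4" where
  "local_map c S = snd c \<circ> snd S"

definition reparam :: "'m param \<Rightarrow> 'm param \<Rightarrow> real^4 \<Rightarrow> real^4" where
  "reparam S R = inv_into (fst R) (snd R) \<circ> snd S"

definition oriented_submanifold ::
  "'m::topological_space chart set \<Rightarrow> 'm set \<Rightarrow> 'm param set \<Rightarrow> bool" where
  "oriented_submanifold A N P \<longleftrightarrow>
     (\<Union>S\<in>P. snd S ` fst S) = N \<and>
     (\<exists>Q\<subseteq>P. countable Q \<and> (\<Union>S\<in>Q. snd S ` fst S) = N) \<and>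
     (\<forall>(W, F)\<in>P. open W \<and> inj_on F W \<and> continuous_on W F) \<and>
     (\<forall>c\<in>A. \<forall>S\<in>P. smooth_on (local_dom c S) (local_map c S) \<and>
        (\<forall>p\<in>local_dom c S. inj (frechet_derivative (local_map c S) (at p)))) \<and>
     (\<forall>S\<in>P. \<forall>R\<in>P.
        let D = {p \<in> fst S. snd S p \<in> snd R ` fst R}
        in open D \<and> smooth_on D (reparam S R) \<and>
           (\<forall>p\<in>D. det (matrix (frechet_derivative (reparam S R) (at p))) > 0))"


section \<open>Linear algebra of a tangent space of the submanifold\<close>

text \<open>
  Here \<open>G\<close> is the metric at a point and \<open>L :: real^4 \<Rightarrow> complex^4\<close> the differential of a local
  parametrization, so that \<open>range L\<close> is the tangent space of \<open>N\<close>, oriented by \<open>L\<close>.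
  \<open>(\<lambda>i. L (a i))\<close> for a \<open>pos_frame\<close> \<open>a\<close> is a positive orthonormal basis of it. Families of vectors
  are indexed by natural numbers, and only the indices below the relevant bound matter.
\<close>

definition pos_frame ::
  "(complex^4 \<Rightarrow> complex^4 \<Rightarrow> real) \<Rightarrow> (real^4 \<Rightarrow> complex^4) \<Rightarrow> (nat \<Rightarrow> real^4) \<Rightarrow> bool" where
  "pos_frame G L a \<longleftrightarrow>
     (\<forall>i<4. \<forall>j<4. G (L (a i)) (L (a j)) = (if i = j then 1 else 0)) \<and>
     det (vector [a 0, a 1, a 2, a 3] :: real^4^4) > 0"

definition proj ::
  "(complex^4 \<Rightarrow> complex^4 \<Rightarrow> real) \<Rightarrow> (complex^4) set \<Rightarrow> complex^4 \<Rightarrow> complex^4" where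
  "proj G T w = (THE t. t \<in> T \<and> (\<forall>s\<in>T. G (w - t) s = 0))"

text \<open>The volume form with respect to a positive orthonormal basis \<open>e\<close>: \<open>det (G (e i) (v j))\<close>.\<close>

definition volume_form ::
  "(complex^4 \<Rightarrow> complex^4 \<Rightarrow> real) \<Rightarrow> (nat \<Rightarrow> complex^4) \<Rightarrow> (nat \<Rightarrow> complex^4) \<Rightarrow> real" where
  "volume_form G e v =
     (\<Sum>\<sigma> | \<sigma> permutes {..<4}. of_int (sign \<sigma>) * (\<Prod>i<4. G (e i) (v (\<sigma> i))))"

definition hodge2 ::
  "(complex^4 \<Rightarrow> complex^4 \<Rightarrow> real) \<Rightarrow> (real^4 \<Rightarrow> complex^4) \<Rightarrow>
   (complex^4 \<Rightarrow> complex^4 \<Rightarrow> real) \<Rightarrow> complex^4 \<Rightarrow> complex^4 \<Rightarrow> real" where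
  "hodge2 G L \<alpha> v w =
     (let e = L \<circ> (SOME a. pos_frame G L a)
      in \<Sum>j<4. \<Sum>i<j. \<alpha> (e i) (e j) * volume_form G e ((!) [e i, e j, v, w]))"

definition cayley_at ::
  "(complex^4 \<Rightarrow> complex^4 \<Rightarrow> real) \<Rightarrow> (real^4 \<Rightarrow> complex^4) \<Rightarrow> bool" where
  "cayley_at G L \<longleftrightarrow>
     (\<forall>v\<in>range L. \<forall>w\<in>range L. kform G v w = hodge2 G L (kform G) v w)"

definition cayley_lambda ::
  "(complex^4 \<Rightarrow> complex^4 \<Rightarrow> real) \<Rightarrow> (real^4 \<Rightarrow> complex^4) \<Rightarrow> real" where
  "cayley_lambda G L =
     (let B = (\<lambda>v. proj G (range L) (J v))
      in THE l. l \<ge> 0 \<and> (\<forall>v\<in>range L. B (B v) = - (l\<^sup>2 *\<^sub>R v)))"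


section \<open>Normalized (4,0)-forms\<close>

text \<open>
  A complex-valued \<open>k\<close>-form is a function of a family of vectors that depends only on the first \<open>k\<close>
  of them. The wedge product follows the convention under which
  \<open>(\<alpha> \<and> \<beta>)(v, w) = \<alpha>(v) \<beta>(w) - \<alpha>(w) \<beta>(v)\<close> for 1-forms.
\<close>

type_synonym cform = "(nat \<Rightarrow> complex^4) \<Rightarrow> complex"

definition wedge :: "nat \<Rightarrow> nat \<Rightarrow> cform \<Rightarrow> cform \<Rightarrow> cform" where
  "wedge p q \<alpha> \<beta> v =
     (\<Sum>\<sigma> | \<sigma> permutes {..<p + q}.
        of_int (sign \<sigma>) * \<alpha> (\<lambda>i. v (\<sigma> i)) * \<beta> (\<lambda>i. v (\<sigma> (p + i)))) / (fact p * fact q)"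

primrec wedge_power :: "nat \<Rightarrow> cform \<Rightarrow> nat \<Rightarrow> cform" where
  "wedge_power k \<alpha> 0 = (\<lambda>_. 1)"
| "wedge_power k \<alpha> (Suc n) = wedge k (k * n) \<alpha> (wedge_power k \<alpha> n)"

definition form40 :: "cform \<Rightarrow> bool" where
  "form40 \<Omega> \<longleftrightarrow>
     (\<forall>v w. (\<forall>i<4. v i = w i) \<longrightarrow> \<Omega> v = \<Omega> w) \<and>
     (\<forall>v. \<forall>i<4. linear (\<lambda>x. \<Omega> (v(i := x)))) \<and>
     (\<forall>v. \<forall>i<4. \<forall>j<4. i \<noteq> j \<longrightarrow> v i = v j \<longrightarrow> \<Omega> v = 0) \<and>
     (\<forall>v. \<forall>i<4. \<forall>x. \<Omega> (v(i := J x)) = \<i> * \<Omega> (v(i := x)))"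

definition normalized :: "(complex^4 \<Rightarrow> complex^4 \<Rightarrow> real) \<Rightarrow> cform \<Rightarrow> bool" where
  "normalized G \<Omega> \<longleftrightarrow>
     (\<forall>v. wedge_power 2 (\<lambda>x. complex_of_real (kform G (x 0) (x 1))) 4 v / fact 4
        = (\<i> / 2) ^ 4 * wedge 4 4 \<Omega> (\<lambda>x. cnj (\<Omega> x)) v)"

definition unitary_frame ::
  "(complex^4 \<Rightarrow> complex^4 \<Rightarrow> real) \<Rightarrow> (nat \<Rightarrow> complex^4) \<Rightarrow> bool" where
  "unitary_frame G u \<longleftrightarrow>
     (\<forall>i<4. \<forall>j<4. G (u i) (u j) = (if i = j then 1 else 0) \<and> kform G (u i) (u j) = 0)"


section \<open>Geometry along a local parametrization\<close>

text \<open>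
  In this section \<open>G\<close> is the metric in a chart of the ambient manifold and \<open>f\<close> the coordinate
  expression of a parametrization of \<open>N\<close>. Tangent vectors of \<open>N\<close> at the parameter \<open>p\<close> are given by
  \<open>a :: real^4\<close>, the corresponding vector of the ambient manifold being
  \<open>frechet_derivative f (at p) a\<close>.
\<close>

definition totally_real_dom :: "'m chart \<Rightarrow> 'm param \<Rightarrow> (real^4) set" where
  "totally_real_dom c S = {p \<in> local_dom c S.
     let T = range (frechet_derivative (local_map c S) (at p)) in T \<inter> J ` T = {0}}"

definition second_ff ::
  "metric_field \<Rightarrow> (real^4 \<Rightarrow> complex^4) \<Rightarrow> real^4 \<Rightarrow> real^4 \<Rightarrow> real^4 \<Rightarrow> complex^4" where
  "second_ff G f p a b =
     (let L = frechet_derivative f (at p);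
          D = frechet_derivative (\<lambda>q. frechet_derivative f (at q) b) (at p) a
              + christoffel G (f p) (L a) (L b)
      in D - proj (G (f p)) (range L) D)"

definition mean_curvature ::
  "metric_field \<Rightarrow> (real^4 \<Rightarrow> complex^4) \<Rightarrow> real^4 \<Rightarrow> complex^4" where
  "mean_curvature G f p =
     (let a = (SOME a. pos_frame (G (f p)) (frechet_derivative f (at p)) a)
      in \<Sum>i<4. second_ff G f p (a i) (a i))"

definition Omega_N :: "metric_field \<Rightarrow> (real^4 \<Rightarrow> complex^4) \<Rightarrow> real^4 \<Rightarrow> cform" where
  "Omega_N G f p =
     (let L = frechet_derivative f (at p)
      in THE \<Omega>. form40 \<Omega> \<and> normalized (G (f p)) \<Omega> \<and>
           (\<forall>a. pos_frame (G (f p)) L a \<longrightarrow> (\<exists>r>0. \<Omega> (\<lambda>i. L (a i)) = complex_of_real r)))"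

text \<open>
  The connection induced on the restriction to \<open>N\<close> of the bundle of 4-forms, applied to a section
  \<open>\<Omega>\<close> along \<open>f\<close>.
\<close>

definition nabla_form ::
  "metric_field \<Rightarrow> (real^4 \<Rightarrow> complex^4) \<Rightarrow> (real^4 \<Rightarrow> cform) \<Rightarrow> real^4 \<Rightarrow> real^4 \<Rightarrow> cform" where
  "nabla_form G f \<Omega> p a v =
     frechet_derivative (\<lambda>q. \<Omega> q v) (at p) a -
     (\<Sum>i<4. \<Omega> p (v(i := christoffel G (f p) (frechet_derivative f (at p) a) (v i))))"

text \<open>Complex-valued by definition; that the values are real has to be proved.\<close>

definition gamma_form ::
  "metric_field \<Rightarrow> (real^4 \<Rightarrow> complex^4) \<Rightarrow> real^4 \<Rightarrow> real^4 \<Rightarrow> complex" where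
  "gamma_form G f p a =
     \<i> * nabla_form G f (Omega_N G f) p a
           (SOME u. unitary_frame (G (f p)) u \<and> Omega_N G f p u = 1)"

text \<open>Exterior derivative of a 1-form on an open subset of \<open>real^4\<close>, on constant vector fields.\<close>

definition ext_deriv1 :: "(real^4 \<Rightarrow> real^4 \<Rightarrow> complex) \<Rightarrow> real^4 \<Rightarrow> real^4 \<Rightarrow> real^4 \<Rightarrow> complex" where
  "ext_deriv1 \<gamma> p a b =
     frechet_derivative (\<lambda>q. \<gamma> q b) (at p) a - frechet_derivative (\<lambda>q. \<gamma> q a) (at p) b"

definition cayley_submanifold ::
  "'m::topological_space chart set \<Rightarrow> ('m chart \<Rightarrow> metric_field) \<Rightarrow> 'm set \<Rightarrow> 'm param set \<Rightarrow> bool"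
  where
  "cayley_submanifold A g N P \<longleftrightarrow>
     oriented_submanifold A N P \<and>
     (\<forall>c\<in>A. \<forall>S\<in>P. \<forall>p\<in>local_dom c S.
        cayley_at (g c (local_map c S p)) (frechet_derivative (local_map c S) (at p)))"

end

theory Submission
  imports Defs
begin

text \<open>
  In a chart, write \<open>\<Delta>\<close> for the complex determinant of the four coordinate tangent vectors of \<open>N\<close>; it
  vanishes exactly where \<open>N\<close> is not totally real. The form \<open>\<Omega>\<^sub>N\<close> is \<open>\<kappa> cnj \<Delta> / |\<Delta>|\<close> times the complex
  determinant, where \<open>\<kappa>\<close> depends only on the metric and \<open>d log \<kappa> = Re tr \<Gamma>\<close>. Hence
  \<open>\<gamma> = Im (d\<Delta> / \<Delta>) + Im tr \<Gamma>\<close>, the first summand is closed, and the exterior derivative of the second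
  one is the imaginary part of the complex trace of the curvature, which is the Ricci form.

  The sum \<open>d\<Delta> / \<Delta> + tr \<Gamma>\<close> is also the complex trace of \<open>b \<mapsto> \<nabla>\<^sub>X b\<close> on a frame of \<open>N\<close>. Its tangential
  part is real, so its imaginary part only involves the second fundamental form. The Kaehler form
  restricted to \<open>N\<close> is self-dual and closed, hence coclosed, and this turns the trace into the mean
  curvature.
\<close>

section \<open>Alternating maps and determinants\<close>

text \<open>Most of the objects are picked by \<open>THE\<close> or \<open>SOME\<close> separately
  at each point, so nothing is known in advance about how they vary. This shapes the proof: each
  choice that has to be differentiated is first replaced by determinants or Gram matrices. The
  factor \<kappa> is the modulus of the coefficient of a normalized form relative to the complex
  determinant. It is recovered from the metric by a Gram determinant, whose derivative at a unitary
  frame is a trace; this is the source of Re tr \<Gamma>. The unitary frame in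
  \<open>gamma_form\<close> is harmless, because it stays fixed while the form is differentiated.
  The Hodge operator, in contrast, uses an unspecified orthonormal frame at each point, so
  self-duality is rewritten in an arbitrary positive frame before it is differentiated. The
  denominator of the mean curvature formula has its origin in linear algebra: on a Cayley tangent
  space, taking the normal part of J v multiplies the metric by 1 - \<lambda>^2. Closedness of the
  restricted Kaehler form enters as the symmetry of the second fundamental form.\<close>

definition ndet :: "nat \<Rightarrow> (nat \<Rightarrow> nat \<Rightarrow> 'a::comm_ring_1) \<Rightarrow> 'a" where
  "ndet n a = (\<Sum>\<sigma> | \<sigma> permutes {..<n}. of_int (sign \<sigma>) * (\<Prod>i<n. a i (\<sigma> i)))"

text \<open>Families are total functions on \<open>nat\<close>; the first conjunct makes the entries
  from \<open>n\<close> on irrelevant, so that this is antisymmetry of a function of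
  \<open>n\<close> vectors.\<close>

definition skew :: "nat \<Rightarrow> ((nat \<Rightarrow> 'v) \<Rightarrow> 'a::field_char_0) \<Rightarrow> bool" where
  "skew n F \<longleftrightarrow> (\<forall>v w. (\<forall>i<n. v i = w i) \<longrightarrow> F v = F w) \<and>
     (\<forall>v. \<forall>i<n. \<forall>j<n. i \<noteq> j \<longrightarrow> F (v \<circ> Transposition.transpose i j) = - F v)"

lemma skew_cong: "skew n F \<Longrightarrow> (\<And>i. i < n \<Longrightarrow> v i = w i) \<Longrightarrow> F v = F w"
  unfolding skew_def by blast

lemma skew_transpose:
  "skew n F \<Longrightarrow> i < n \<Longrightarrow> j < n \<Longrightarrow> i \<noteq> j \<Longrightarrow> F (v \<circ> Transposition.transpose i j) = - F v"
  unfolding skew_def by blast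

lemma skew_eq_zero:
  assumes "skew n F" "i < n" "j < n" "i \<noteq> j" "v i = v j"
  shows "F v = 0"
proof -
  have "v \<circ> Transposition.transpose i j = v"
    using assms(5) by (auto simp: fun_eq_iff Transposition.transpose_def)
  then have "F v = - F v"
    using skew_transpose[OF assms(1-4), of v] by simp
  then show ?thesis by simp
qed

lemma skew_permutes:
  assumes F: "skew n F" and "\<sigma> permutes {..<n}"
  shows "F (v \<circ> \<sigma>) = of_int (sign \<sigma>) * F v"
proof -
  have "\<forall>v. F (v \<circ> \<sigma>) = of_int (sign \<sigma>) * F v"
    using finite_lessThan assms(2)
  proof (induction rule: permutes_rev_induct)
    case id
    then show ?case by simp
  next
    case (swap a b p)
    have p: "permutation p"
      using swap permutation_permutes by blast
    show ?case
    proof (cases "a = b")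
      case True then show ?thesis using swap by simp
    next
      case False
      have "sign (p \<circ> Transposition.transpose a b) = - sign p"
        using p False by (simp add: sign_compose permutation_swap_id sign_swap_id)
      moreover have "F (v \<circ> (p \<circ> Transposition.transpose a b)) = - F (v \<circ> p)" for v
        using skew_transpose[OF F, of a b "v \<circ> p"] swap(1,2) False by (metis o_assoc lessThan_iff)
      moreover have "F (v \<circ> p) = of_int (sign p) * F v" for v
        using swap by blast
      ultimately show ?thesis by (simp add: comp_def)
    qed
  qed
  then show ?thesis by blast
qed

text \<open>Multilinear expansion of the first \<open>m\<close> slots. The linear combination
  \<open>comb\<close> is left abstract so that the result applies both to vectors of
  \<open>complex^4\<close> and to matrix rows. Index maps are pinned to the identity from
  \<open>m\<close> on, which gives exactly one summand per choice of indices.\<close>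

lemma skew_expand_sum:
  fixes F :: "(nat \<Rightarrow> 'v) \<Rightarrow> 'a::field_char_0"
  assumes lin: "\<And>v i c. i < n \<Longrightarrow> F (v(i := comb c)) = (\<Sum>k<n. c k * F (v(i := E k)))"
    and "m \<le> n"
  shows "F (\<lambda>i. if i < m then comb (a i) else w i) =
    (\<Sum>f | (\<forall>i<m. f i < n) \<and> (\<forall>i\<ge>m. f i = i).
       (\<Prod>i<m. a i (f i)) * F (\<lambda>i. if i < m then E (f i) else w i))"
  using \<open>m \<le> n\<close>
proof (induction m arbitrary: w)
  case 0
  have "{f. \<forall>i. f i = i} = {\<lambda>i::nat. i}" by auto
  then show ?case by simp
next
  case (Suc m)
  let ?S = "\<lambda>m. {f. (\<forall>i<m. f i < n) \<and> (\<forall>i\<ge>m. f i = i)}"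
  have "F (\<lambda>i. if i < Suc m then comb (a i) else w i) =
        F (\<lambda>i. if i < m then comb (a i) else (w(m := comb (a m))) i)"
    by (rule arg_cong[of _ _ F]) (auto simp: less_Suc_eq)
  also have "\<dots> = (\<Sum>f\<in>?S m. (\<Prod>i<m. a i (f i)) *
      F (\<lambda>i. if i < m then E (f i) else (w(m := comb (a m))) i))"
    using Suc by simp
  also have "\<dots> = (\<Sum>f\<in>?S m. \<Sum>k<n. (\<Prod>i<m. a i (f i)) * (a m k *
      F (\<lambda>i. if i < m then E (f i) else (w(m := E k)) i)))"
  proof (rule sum.cong[OF refl])
    fix f assume "f \<in> ?S m"
    have *: "(\<lambda>i. if i < m then E (f i) else (w(m := x)) i) =
        (\<lambda>i. if i < m then E (f i) else w i)(m := x)" for x by auto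
    show "(\<Prod>i<m. a i (f i)) * F (\<lambda>i. if i < m then E (f i) else (w(m := comb (a m))) i) =
      (\<Sum>k<n. (\<Prod>i<m. a i (f i)) * (a m k *
      F (\<lambda>i. if i < m then E (f i) else (w(m := E k)) i)))"
      unfolding * by (subst lin) (use Suc.prems in \<open>simp_all only: sum_distrib_left Suc_le_eq\<close>)
  qed
  also have "\<dots> = (\<Sum>(f, k)\<in>?S m \<times> {..<n}. (\<Prod>i<m. a i (f i)) * (a m k *
      F (\<lambda>i. if i < m then E (f i) else (w(m := E k)) i)))"
    by (simp add: sum.cartesian_product)
  also have "\<dots> = (\<Sum>f\<in>?S (Suc m). (\<Prod>i<Suc m. a i (f i)) *
      F (\<lambda>i. if i < Suc m then E (f i) else w i))"
  proof (rule sum.reindex_bij_witness[where i = "\<lambda>f. (f(m := m), f m)" and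
        j = "\<lambda>(f, k). f(m := k)"], goal_cases)
    case (5 x)
    obtain f k where x: "x = (f, k)" by fastforce
    have 1: "(\<Prod>i<Suc m. a i ((f(m := k)) i)) = (\<Prod>i<m. a i (f i)) * a m k" by simp
    have 2: "(\<lambda>i. if i < Suc m then E ((f(m := k)) i) else w i) =
       (\<lambda>i. if i < m then E (f i) else (w(m := E k)) i)"
      by (auto simp: less_Suc_eq)
    show ?case unfolding x prod.case 1 2 by (rule mult.assoc)
  qed (use Suc.prems in \<open>auto simp: less_Suc_eq split: if_splits\<close>)
  finally show ?case .
qed

text \<open>An index map that is not a permutation repeats an index, so its summand vanishes by
  antisymmetry; the permutations that remain form the Leibniz sum.\<close>

lemma skew_expand:
  assumes F: "skew n F"
    and lin: "\<And>v i c. i < n \<Longrightarrow> F (v(i := comb c)) = (\<Sum>k<n. c k * F (v(i := E k)))"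
    and v: "\<And>i. i < n \<Longrightarrow> v i = comb (a i)"
  shows "F v = ndet n a * F E"
proof -
  let ?S = "{f. (\<forall>i<n. f i < n) \<and> (\<forall>i\<ge>n. f i = i)}"
  let ?P = "{\<sigma>. \<sigma> permutes {..<n}}"
  have sub: "?P \<subseteq> ?S"
    using permutes_in_image permutes_not_in by fastforce
  have fin: "finite ?S"
    proof (rule finite_subset)
    \<comment> \<open>The known finiteness result is for functions with a constant value outside a
      finite set; here the value outside is the identity, hence the translation.\<close>
    show "?S \<subseteq> (\<lambda>f i. if i < n then f i else i) `
      {f. \<forall>x. (x \<in> {..<n} \<longrightarrow> f x \<in> {..<n}) \<and> (x \<notin> {..<n} \<longrightarrow> f x = 0)}"
    proof
      fix f assume "f \<in> ?S"
      then show "f \<in> (\<lambda>f i. if i < n then f i else i) `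
        {f. \<forall>x. (x \<in> {..<n} \<longrightarrow> f x \<in> {..<n}) \<and> (x \<notin> {..<n} \<longrightarrow> f x = 0)}"
        by (intro image_eqI[of _ _ "\<lambda>i. if i < n then f i else 0"]) auto
    qed
    show "finite ((\<lambda>f i. if i < n then f i else i) `
      {f. \<forall>x. (x \<in> {..<n} \<longrightarrow> f x \<in> {..<n}) \<and> (x \<notin> {..<n} \<longrightarrow> f x = 0)})"
      by (intro finite_imageI finite_set_of_finite_funs) auto
  qed
  have "F v = F (\<lambda>i. if i < n then comb (a i) else E i)"
    by (rule skew_cong[OF F]) (simp add: v)
  also have "\<dots> = (\<Sum>f\<in>?S. (\<Prod>i<n. a i (f i)) * F (\<lambda>i. if i < n then E (f i) else E i))"
    by (rule skew_expand_sum[OF lin]) auto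
  also have "\<dots> = (\<Sum>f\<in>?P. (\<Prod>i<n. a i (f i)) * F (\<lambda>i. if i < n then E (f i) else E i))"
  proof (rule sum.mono_neutral_right[OF fin sub], rule ballI)
    fix f assume f: "f \<in> ?S - ?P"
    have "\<not> inj_on f {..<n}"
    proof
      assume "inj_on f {..<n}"
      then have "bij_betw f {..<n} {..<n}"
        using f unfolding bij_betw_def
        by (intro conjI card_subset_eq) (auto simp: card_image)
      then have "f permutes {..<n}"
        using f by (intro bij_imp_permutes) auto
      then show False using f by simp
    qed
    then obtain i j where "i < n" "j < n" "i \<noteq> j" "f i = f j"
      by (auto simp: inj_on_def)
    then have "F (\<lambda>i. if i < n then E (f i) else E i) = 0"
      using skew_eq_zero[OF F, of i j] by simp
    then show "(\<Prod>i<n. a i (f i)) * F (\<lambda>i. if i < n then E (f i) else E i) = 0" by simp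
  qed
  also have "\<dots> = (\<Sum>f\<in>?P. (\<Prod>i<n. a i (f i)) * (of_int (sign f) * F E))"
  proof (rule sum.cong[OF refl])
    fix f assume "f \<in> ?P"
    then have "F (E \<circ> f) = of_int (sign f) * F E"
      using skew_permutes[OF F, of f E] by simp
    moreover have "F (\<lambda>i. if i < n then E (f i) else E i) = F (E \<circ> f)"
      by (rule skew_cong[OF F]) simp
    ultimately show "(\<Prod>i<n. a i (f i)) * F (\<lambda>i. if i < n then E (f i) else E i) =
      (\<Prod>i<n. a i (f i)) * (of_int (sign f) * F E)" by simp
  qed
  also have "\<dots> = ndet n a * F E"
    unfolding ndet_def sum_distrib_right by (simp add: mult_ac)
  finally show ?thesis .
qed

section \<open>Determinants by the Leibniz formula\<close>

lemma ndet_cong: "(\<And>i j. i < n \<Longrightarrow> j < n \<Longrightarrow> a i j = b i j) \<Longrightarrow> ndet n a = ndet n b"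
  unfolding ndet_def by (intro sum.cong refl arg_cong2[of _ _ _ _ "(*)"] prod.cong)
    (use permutes_in_image in fastforce)+

lemma ndet_row:
  assumes "i < n"
  shows "ndet n (a(i := r)) = (\<Sum>\<sigma> | \<sigma> permutes {..<n}.
    of_int (sign \<sigma>) * (r (\<sigma> i) * (\<Prod>j\<in>{..<n}-{i}. a j (\<sigma> j))))"
  unfolding ndet_def
proof (intro sum.cong refl arg_cong2[of _ _ _ _ "(*)"])
  fix \<sigma>
  have "(\<Prod>j<n. (a(i := r)) j (\<sigma> j)) =
    (a(i := r)) i (\<sigma> i) * (\<Prod>j\<in>{..<n}-{i}. (a(i := r)) j (\<sigma> j))"
    using assms by (intro prod.remove) auto
  also have "(\<Prod>j\<in>{..<n}-{i}. (a(i := r)) j (\<sigma> j)) = (\<Prod>j\<in>{..<n}-{i}. a j (\<sigma> j))"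
    by (intro prod.cong) auto
  finally show "(\<Prod>j<n. (a(i := r)) j (\<sigma> j)) = r (\<sigma> i) * (\<Prod>j\<in>{..<n}-{i}. a j (\<sigma> j))"
    by simp
qed

lemma ndet_row_sum:
  assumes "i < n"
  shows "ndet n (a(i := (\<lambda>j. \<Sum>k\<in>K. c k * r k j))) = (\<Sum>k\<in>K. c k * ndet n (a(i := r k)))"
proof -
  have "ndet n (a(i := (\<lambda>j. \<Sum>k\<in>K. c k * r k j))) =
    (\<Sum>\<sigma> | \<sigma> permutes {..<n}. \<Sum>k\<in>K. of_int (sign \<sigma>) *
      (c k * r k (\<sigma> i) * (\<Prod>j\<in>{..<n}-{i}. a j (\<sigma> j))))"
    unfolding ndet_row[OF assms] by (simp add: sum_distrib_left sum_distrib_right mult.assoc)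
  also have "\<dots> = (\<Sum>k\<in>K. \<Sum>\<sigma> | \<sigma> permutes {..<n}. of_int (sign \<sigma>) *
      (c k * r k (\<sigma> i) * (\<Prod>j\<in>{..<n}-{i}. a j (\<sigma> j))))"
    by (rule sum.swap)
  also have "\<dots> = (\<Sum>k\<in>K. c k * ndet n (a(i := r k)))"
    unfolding ndet_row[OF assms] by (simp add: sum_distrib_left mult_ac)
  finally show ?thesis .
qed

lemma skew_ndet: "skew n (ndet n :: (nat \<Rightarrow> nat \<Rightarrow> 'a::field_char_0) \<Rightarrow> 'a)"
  unfolding skew_def
proof (intro conjI allI impI)
  fix v w :: "nat \<Rightarrow> nat \<Rightarrow> 'a" assume "\<forall>i<n. v i = w i"
  then show "ndet n v = ndet n w" by (intro ndet_cong) auto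
next
  fix v :: "nat \<Rightarrow> nat \<Rightarrow> 'a" and i j assume ij: "i < n" "j < n" "i \<noteq> j"
  let ?t = "Transposition.transpose i j"
  have t: "?t permutes {..<n}" using ij by (intro permutes_swap_id) auto
  have "ndet n (v \<circ> ?t) =
    (\<Sum>\<sigma> | \<sigma> permutes {..<n}. of_int (sign (\<sigma> \<circ> ?t)) * (\<Prod>k<n. v (?t k) ((\<sigma> \<circ> ?t) k)))"
    unfolding ndet_def by (subst sum_permutations_compose_right[OF t]) simp
  also have "\<dots> = (\<Sum>\<sigma> | \<sigma> permutes {..<n}. - (of_int (sign \<sigma>) * (\<Prod>k<n. v k (\<sigma> k))))"
  proof (rule sum.cong[OF refl])
    fix \<sigma> assume "\<sigma> \<in> {\<sigma>. \<sigma> permutes {..<n}}"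
    then have "permutation \<sigma>" using permutation_permutes by blast
    then have "sign (\<sigma> \<circ> ?t) = - sign \<sigma>"
      using ij by (simp add: sign_compose permutation_swap_id sign_swap_id)
    moreover have "(\<Prod>k<n. v (?t k) ((\<sigma> \<circ> ?t) k)) = (\<Prod>k<n. v k (\<sigma> k))"
      using prod.permute[OF t, of "\<lambda>k. v k (\<sigma> k)"] by (simp add: comp_def)
    ultimately show "of_int (sign (\<sigma> \<circ> ?t)) * (\<Prod>k<n. v (?t k) ((\<sigma> \<circ> ?t) k)) =
      - (of_int (sign \<sigma>) * (\<Prod>k<n. v k (\<sigma> k)))" by simp
  qed
  also have "\<dots> = - ndet n v" by (simp add: ndet_def sum_negf)
  finally show "ndet n (v \<circ> ?t) = - ndet n v" .
qed

text \<open>The rows of a product are combinations of the rows of \<open>b\<close>, so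
  multiplicativity is the expansion of the antisymmetric function \<open>ndet n\<close>
  itself.\<close>

lemma ndet_mult:
  fixes a b :: "nat \<Rightarrow> nat \<Rightarrow> 'a::field_char_0"
  shows "ndet n (\<lambda>i j. \<Sum>k<n. a i k * b k j) = ndet n a * ndet n b"
  by (rule skew_expand[OF skew_ndet, where comb = "\<lambda>c j. \<Sum>k<n. c k * b k j"])
    (auto intro: ndet_row_sum)

lemma ndet_transpose:
  fixes a :: "nat \<Rightarrow> nat \<Rightarrow> 'a::comm_ring_1"
  shows "ndet n (\<lambda>i j. a j i) = ndet n a"
proof -
  have "ndet n (\<lambda>i j. a j i) =
    (\<Sum>\<sigma> | \<sigma> permutes {..<n}. of_int (sign (inv \<sigma>)) * (\<Prod>i<n. a (inv \<sigma> i) i))"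
    unfolding ndet_def by (rule sum_permutations_inverse)
  also have "\<dots> = ndet n a"
    unfolding ndet_def
  proof (rule sum.cong[OF refl])
    fix \<sigma> assume "\<sigma> \<in> {\<sigma>. \<sigma> permutes {..<n}}"
    then have \<sigma>: "\<sigma> permutes {..<n}" by simp
    then have "sign (inv \<sigma>) = sign \<sigma>"
      using permutation_permutes sign_inverse by blast
    moreover have "(\<Prod>i<n. a (inv \<sigma> i) i) = (\<Prod>i<n. a i (\<sigma> i))"
      using prod.permute[OF \<sigma>, of "\<lambda>i. a (inv \<sigma> i) i"] permutes_inverses[OF \<sigma>]
      by (simp add: comp_def)
    ultimately show "of_int (sign (inv \<sigma>)) * (\<Prod>i<n. a (inv \<sigma> i) i) =
      of_int (sign \<sigma>) * (\<Prod>i<n. a i (\<sigma> i))" by simp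
  qed
  finally show ?thesis .
qed

lemma ndet_diag: "ndet n (\<lambda>i j. if i = j then d i else 0) = (\<Prod>i<n. d i :: 'a::comm_ring_1)"
proof -
  have "ndet n (\<lambda>i j. if i = j then d i else 0) =
    (\<Sum>\<sigma>\<in>{id}. of_int (sign \<sigma>) * (\<Prod>i<n. if i = \<sigma> i then d i else 0))"
    unfolding ndet_def
  proof (rule sum.mono_neutral_right)
    show "\<forall>\<sigma>\<in>{\<sigma>. \<sigma> permutes {..<n}} - {id}.
      of_int (sign \<sigma>) * (\<Prod>i<n. if i = \<sigma> i then d i else 0) = 0"
    proof
      fix \<sigma> assume \<sigma>: "\<sigma> \<in> {\<sigma>. \<sigma> permutes {..<n}} - {id}"
      then obtain i where "\<sigma> i \<noteq> i" by (auto simp: fun_eq_iff)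
      moreover have i: "i < n"
        using \<sigma> \<open>\<sigma> i \<noteq> i\<close> permutes_not_in by fastforce
      ultimately have "(\<Prod>i<n. if i = \<sigma> i then d i else 0) = 0"
        by (intro prod_zero bexI[of _ i]) auto
      then show "of_int (sign \<sigma>) * (\<Prod>i<n. if i = \<sigma> i then d i else 0) = 0" by simp
    qed
  qed (auto simp: finite_permutations permutes_id)
  then show ?thesis by simp
qed

lemma ndet_one: "ndet n (\<lambda>i j. if i = j then 1 else 0) = (1 :: 'a::comm_ring_1)"
  by (simp add: ndet_diag)

lemma ndet_cnj: "ndet n (\<lambda>i j. cnj (a i j)) = cnj (ndet n a)"
  by (simp add: ndet_def)

lemma ndet_of_real: "ndet n (\<lambda>i j. complex_of_real (a i j)) = complex_of_real (ndet n a)"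
  by (simp add: ndet_def)

section \<open>Forms of type (4,0)\<close>

text \<open>Translates families numbered from 0 into the index type \<open>4\<close>, in the order
  in which \<open>vector\<close> places its entries, starting at index 1.\<close>

definition xi :: "nat \<Rightarrow> 4" where "xi i = (if i = 0 then 1 else if i = 1 then 2 else if i = 2 then 3 else 4)"

lemma xi_simps [simp]: "xi 0 = 1" "xi (Suc 0) = 2" "xi 2 = 3" "xi 3 = 4"
  by (auto simp: xi_def)

lemma lessThan_4: "{..<4::nat} = {0, 1, 2, 3}"
  by auto

lemma sum_lessThan_4: "(\<Sum>i<4. f i) = f 0 + f 1 + f 2 + f (3::nat)"
  by (simp add: lessThan_4 add.assoc)

lemma sum_xi: "(\<Sum>i<4. f (xi i)) = (\<Sum>k\<in>UNIV. f k)"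
  by (simp add: sum_lessThan_4 sum_4)

lemma xi_eq_iff: "i < 4 \<Longrightarrow> j < 4 \<Longrightarrow> xi i = xi j \<longleftrightarrow> i = j"
proof -
  have "i < 4 \<Longrightarrow> i \<in> {0,1,2,3}" "j < 4 \<Longrightarrow> j \<in> {0,1,2,3}" by auto
  then show "i < 4 \<Longrightarrow> j < 4 \<Longrightarrow> xi i = xi j \<longleftrightarrow> i = j" by auto
qed

definition std :: "nat \<Rightarrow> complex^4" where "std i = axis (xi i) 1"

lemma std_expand: "x = (\<Sum>k<4. (x $ xi k) *s std k)"
  unfolding std_def sum_xi[of "\<lambda>k. (x $ k) *s axis k 1"]
  by (simp add: basis_expansion)

lemma std_nth: "i < 4 \<Longrightarrow> k < 4 \<Longrightarrow> std k $ xi i = (if i = k then 1 else 0)"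
  by (auto simp: std_def axis_def xi_eq_iff)

lemma J_add: "J (v + w) = J v + J w"
  by (simp add: J_def vec_eq_iff algebra_simps)

lemma J_scaleR: "J (r *\<^sub>R v) = r *\<^sub>R J v"
  by (simp add: J_def vec_eq_iff)

lemma J_J [simp]: "J (J v) = - v"
  by (simp add: J_def vec_eq_iff)

lemma linear_J: "linear J"
  by (rule linearI) (simp_all add: J_add J_scaleR)

lemmas J_diff = linear_diff[OF linear_J]
  and J_0 [simp] = linear_0[OF linear_J]
  and J_sum = linear_sum[OF linear_J]

lemma vec_cmul_eq: "c *s x = Re c *\<^sub>R x + Im c *\<^sub>R J x" for x :: "complex^4"
proof (rule vec_eq_iff[THEN iffD2], rule allI)
  fix i
  have "c * x $ i = (of_real (Re c) + \<i> * of_real (Im c)) * x $ i"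
    by (simp only: complex_eq[symmetric])
  then show "(c *s x) $ i = (Re c *\<^sub>R x + Im c *\<^sub>R J x) $ i"
    by (simp add: J_def scaleR_conv_of_real[where 'a = complex] algebra_simps)
qed

lemma complex_linear_cmul:
  assumes "linear T" "\<And>x. T (J x) = J (T x)"
  shows "T (c *s x) = c *s T x"
  unfolding vec_cmul_eq linear_add[OF assms(1)] linear_scale[OF assms(1)] assms(2) ..

lemma form40_cong:
  assumes "form40 \<Omega>" "\<And>i. i < 4 \<Longrightarrow> v i = w i"
  shows "\<Omega> v = \<Omega> w"
proof -
  have "\<forall>v w. (\<forall>i<4. v i = w i) \<longrightarrow> \<Omega> v = \<Omega> w"
    using assms(1) unfolding form40_def by (rule conjunct1)
  then show ?thesis using assms(2) by simp
qed

lemma form40_linear: "form40 \<Omega> \<Longrightarrow> i < 4 \<Longrightarrow> linear (\<lambda>x. \<Omega> (v(i := x)))"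
  unfolding form40_def by blast

lemma form40_alt:
  "form40 \<Omega> \<Longrightarrow> i < 4 \<Longrightarrow> j < 4 \<Longrightarrow> i \<noteq> j \<Longrightarrow> v i = v j \<Longrightarrow> \<Omega> v = 0"
  unfolding form40_def by blast

lemma form40_J: "form40 \<Omega> \<Longrightarrow> i < 4 \<Longrightarrow> \<Omega> (v(i := J x)) = \<i> * \<Omega> (v(i := x))"
  unfolding form40_def by blast

lemma form40_cmul:
  assumes "form40 \<Omega>" "i < 4"
  shows "\<Omega> (v(i := c *s x)) = c * \<Omega> (v(i := x))"
proof -
  interpret linear "\<lambda>x. \<Omega> (v(i := x))" by (rule form40_linear[OF assms])
  show ?thesis
    unfolding vec_cmul_eq add scale form40_J[OF assms] scaleR_conv_of_real[where 'a = complex]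
    by (subst (3) complex_eq[of c]) (simp add: algebra_simps)
qed

lemma form40_sum:
  assumes "form40 \<Omega>" "i < 4"
  shows "\<Omega> (v(i := (\<Sum>k\<in>K. c k *s E k))) = (\<Sum>k\<in>K. c k * \<Omega> (v(i := E k)))"
proof -
  interpret linear "\<lambda>x. \<Omega> (v(i := x))" by (rule form40_linear[OF assms])
  show ?thesis unfolding sum form40_cmul[OF assms] ..
qed

lemma form40_add:
  assumes "form40 \<Omega>" "i < 4"
  shows "\<Omega> (v(i := x + y)) = \<Omega> (v(i := x)) + \<Omega> (v(i := y))"
  using linear_add[OF form40_linear[OF assms]] .

text \<open>Polarization: put \<open>x + y\<close> into both slots and expand.\<close>

lemma form40_swap2:
  assumes "form40 \<Omega>" "i < 4" "j < 4" "i \<noteq> j"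
  shows "\<Omega> (v(i := x, j := y)) = - \<Omega> (v(i := y, j := x))"
proof -
  have *: "v(i := a, j := b) = v(j := b, i := a)" for a b
    using assms(4) by (simp add: fun_upd_twist)
  have "\<Omega> (v(i := x + y, j := x + y)) = 0"
    by (rule form40_alt[OF assms]) (use assms in simp)
  moreover have "\<Omega> (v(i := x + y, j := x + y)) = \<Omega> (v(i := x, j := x)) + \<Omega> (v(i := y, j := x))
     + (\<Omega> (v(i := x, j := y)) + \<Omega> (v(i := y, j := y)))"
    unfolding form40_add[OF assms(1,3)]
    unfolding * form40_add[OF assms(1,2)] ..
  moreover have "\<Omega> (v(i := a, j := a)) = 0" for a
    by (rule form40_alt[OF assms]) (use assms in simp)
  ultimately show ?thesis by (simp add: add_eq_0_iff)
qed

lemma skew_form40: "form40 \<Omega> \<Longrightarrow> skew 4 \<Omega>"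
  unfolding skew_def
proof (intro conjI allI impI)
  fix v :: "nat \<Rightarrow> complex^4" and i j :: nat
  assume *: "form40 \<Omega>" "i < 4" "j < 4" "i \<noteq> j"
  have "v \<circ> Transposition.transpose i j = v(i := v j, j := v i)"
    using * by (auto simp: fun_eq_iff Transposition.transpose_def)
  then show "\<Omega> (v \<circ> Transposition.transpose i j) = - \<Omega> v"
    using form40_swap2[OF *, of v "v j" "v i"] by simp
qed (use form40_cong in blast)

lemma form40_expand:
  assumes "form40 \<Omega>" "\<And>i. i < 4 \<Longrightarrow> v i = (\<Sum>k<4. a i k *s E k)"
  shows "\<Omega> v = ndet 4 a * \<Omega> E"
  by (rule skew_expand[OF skew_form40[OF assms(1)], where comb = "\<lambda>c. \<Sum>k<4. c k *s E k"])
    (use assms form40_sum in auto)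

section \<open>The complex determinant and Cramer's rule\<close>

definition cdet :: cform where "cdet v = ndet 4 (\<lambda>i j. v i $ xi j)"

lemma cdet_std: "cdet std = 1"
proof -
  have "cdet std = ndet 4 (\<lambda>i j. if i = j then 1 else 0)"
    unfolding cdet_def by (rule ndet_cong) (auto simp: std_nth)
  then show ?thesis by (simp add: ndet_one)
qed

lemma cdet_row:
  assumes "i < 4"
  shows "cdet (v(i := x)) = (\<Sum>\<sigma> | \<sigma> permutes {..<4}.
    of_int (sign \<sigma>) * (x $ xi (\<sigma> i) * (\<Prod>j\<in>{..<4}-{i}. v j $ xi (\<sigma> j))))"
proof -
  have "cdet (v(i := x)) = ndet 4 ((\<lambda>i j. v i $ xi j)(i := (\<lambda>j. x $ xi j)))"
    unfolding cdet_def by (rule ndet_cong) auto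
  then show ?thesis by (simp add: ndet_row[OF assms])
qed

lemma form40_cdet: "form40 cdet"
  unfolding form40_def
proof (intro conjI allI impI)
  fix v w :: "nat \<Rightarrow> complex^4" assume "\<forall>i<4. v i = w i"
  then show "cdet v = cdet w" unfolding cdet_def by (intro ndet_cong) auto
next
  fix v :: "nat \<Rightarrow> complex^4" and i :: nat assume i: "i < 4"
  show "linear (\<lambda>x. cdet (v(i := x)))"
    unfolding cdet_row[OF i]
    by (rule linearI) (simp_all add: algebra_simps sum.distrib scaleR_sum_right)
  fix x
  show "cdet (v(i := J x)) = \<i> * cdet (v(i := x))"
    unfolding cdet_row[OF i] by (simp add: J_def sum_distrib_left mult_ac)
next
  fix v :: "nat \<Rightarrow> complex^4" and i j :: nat assume "i < 4" "j < 4" "i \<noteq> j" "v i = v j"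
  then show "cdet v = 0" unfolding cdet_def by (intro skew_eq_zero[OF skew_ndet, of i _ j]) auto
qed

text \<open>Complex multilinearity and the standard basis: the (4,0)-forms are a complex line
  spanned by \<open>cdet\<close>. Every later statement about such forms becomes one about a single
  coefficient.\<close>

lemma form40_eq_cdet:
  assumes "form40 \<Omega>"
  shows "\<Omega> v = \<Omega> std * cdet v"
proof -
  have "\<Omega> v = ndet 4 (\<lambda>i k. v i $ xi k) * \<Omega> std"
    by (rule form40_expand[OF assms]) (rule std_expand)
  then show ?thesis by (simp add: cdet_def)
qed

lemma cdet_expand:
  assumes "\<And>i. i < 4 \<Longrightarrow> v i = (\<Sum>k<4. a i k *s E k)"
  shows "cdet v = ndet 4 a * cdet E"
  by (rule form40_expand[OF form40_cdet assms])

lemma form40_mult_cdet: "form40 (\<lambda>v. c * cdet v)"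
  unfolding form40_def
proof (intro conjI allI impI)
  fix v :: "nat \<Rightarrow> complex^4" and i :: nat assume i: "i < 4"
  interpret linear "\<lambda>x. cdet (v(i := x))" by (rule form40_linear[OF form40_cdet i])
  show "linear (\<lambda>x. c * cdet (v(i := x)))"
    by (rule linearI) (simp_all add: add scale algebra_simps)
  show "c * cdet (v(i := J x)) = \<i> * (c * cdet (v(i := x)))" for x
    by (simp add: form40_J[OF form40_cdet i])
next
  fix v :: "nat \<Rightarrow> complex^4" and i j :: nat assume "i < 4" "j < 4" "i \<noteq> j" "v i = v j"
  then show "c * cdet v = 0" using form40_alt[OF form40_cdet] by simp
next
  fix v w :: "nat \<Rightarrow> complex^4" assume "\<forall>i<4. v i = w i"
  then show "c * cdet v = c * cdet w" using form40_cong[OF form40_cdet, of v w] by simp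
qed

lemma linear_combination:
  "linear (\<lambda>x::complex^4. \<Sum>k<4. (x $ xi k) *s E k :: complex^4)"
proof (rule linearI)
  fix x y :: "complex^4" and r :: real
  show "(\<Sum>k<4. (x + y) $ xi k *s E k) = (\<Sum>k<4. x $ xi k *s E k) + (\<Sum>k<4. y $ xi k *s E k)"
    by (simp add: vec_eq_iff algebra_simps sum.distrib)
  show "(\<Sum>k<4. (r *\<^sub>R x) $ xi k *s E k) = r *\<^sub>R (\<Sum>k<4. x $ xi k *s E k)"
    by (simp add: vec_eq_iff scaleR_sum_right)
qed

lemma cdet_replace:
  assumes "k < 4" "x = (\<Sum>j<4. z j *s E j)"
  shows "cdet (E(k := x)) = z k * cdet E"
proof -
  have "cdet (E(k := x)) = (\<Sum>j<4. z j * cdet (E(k := E j)))"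
    unfolding assms(2) by (rule form40_sum[OF form40_cdet assms(1)])
  also have "\<dots> = (\<Sum>j<4. if j = k then z k * cdet E else 0)"
  proof (rule sum.cong[OF refl])
    fix j assume "j \<in> {..<4::nat}"
    then have "j \<noteq> k \<Longrightarrow> cdet (E(k := E j)) = 0"
      using assms(1) by (intro form40_alt[OF form40_cdet, of j k]) auto
    then show "z j * cdet (E(k := E j)) = (if j = k then z k * cdet E else 0)" by auto
  qed
  finally show ?thesis using assms(1) by simp
qed

text \<open>Replacing one vector by a combination isolates its coefficient. This makes the
  combination map injective, hence surjective in finite dimension, and then identifies the
  coefficients.\<close>

lemma cramer:
  assumes "cdet E \<noteq> 0"
  shows "x = (\<Sum>k<4. (cdet (E(k := x)) / cdet E) *s E k)"
proof -
  let ?f = "\<lambda>x::complex^4. \<Sum>k<4. (x $ xi k) *s E k :: complex^4"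
  have nth: "z $ xi k = 0" if "?f z = 0" "k < 4" for z k
  proof -
    have "cdet (E(k := 0)) = (z $ xi k) * cdet E"
      by (rule cdet_replace[OF that(2)]) (use that in simp)
    moreover have "cdet (E(k := 0)) = 0"
      using linear_0[OF form40_linear[OF form40_cdet that(2)]] .
    ultimately show ?thesis using assms by simp
  qed
  have "z = 0" if "?f z = 0" for z
    using std_expand[of z] nth[OF that] by simp
  then have "inj ?f"
    by (simp add: linear_injective_0[OF linear_combination])
  then have "surj ?f"
    by (rule linear_injective_imp_surjective[OF linear_combination _ refl])
  then obtain z where z: "x = ?f z" by (rule surjE)
  then have "cdet (E(k := x)) / cdet E = z $ xi k" if "k < 4" for k
    using cdet_replace[OF that z] assms by simp
  then show ?thesis using z by simp
qed

text \<open>Vectors without such a relation would span, and then \<open>cdet std = 1\<close> would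
  be a multiple of \<open>cdet E = 0\<close>.\<close>

lemma cdet_eq_zeroD:
  assumes "cdet E = 0"
  obtains z where "(\<Sum>k<4. z k *s E k) = 0" "\<exists>k<4. z k \<noteq> 0"
proof -
  let ?f = "\<lambda>x::complex^4. \<Sum>k<4. (x $ xi k) *s E k :: complex^4"
  have "\<not> inj ?f"
  proof
    assume "inj ?f"
    then have "surj ?f"
      by (rule linear_injective_imp_surjective[OF linear_combination _ refl])
    then have ex: "\<exists>z. std i = ?f z" for i by (rule surjD)
    define z where "z i = (SOME z. std i = ?f z)" for i
    have z: "std i = ?f (z i)" for i
      unfolding z_def by (rule someI_ex[OF ex])
    have "cdet std = ndet 4 (\<lambda>i k. z i $ xi k) * cdet E"
      by (rule cdet_expand) (rule z)
    then show False using assms cdet_std by simp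
  qed
  then obtain z where z: "?f z = 0" "z \<noteq> 0"
    by (auto simp: linear_injective_0[OF linear_combination])
  have "\<exists>k<4. z $ xi k \<noteq> 0"
  proof (rule ccontr)
    assume "\<not> (\<exists>k<4. z $ xi k \<noteq> 0)"
    then have "z = 0" using std_expand[of z] by simp
    then show False using z by simp
  qed
  then show ?thesis by (rule that[OF z(1)])
qed

subsection \<open>Traces of complex linear maps\<close>

definition ctrace :: "(complex^4 \<Rightarrow> complex^4) \<Rightarrow> complex" where
  "ctrace T = (\<Sum>i<4. T (std i) $ xi i)"

text \<open>The derivation that \<open>T\<close> induces on \<open>cdet\<close> is again a
  (4,0)-form, hence a multiple of \<open>cdet\<close>; evaluation at the standard basis identifies
  the factor as the trace.\<close>

lemma ctrace_cdet:
  assumes T: "linear T" "\<And>x. T (J x) = J (T x)"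
  shows "(\<Sum>i<4. cdet (v(i := T (v i)))) = ctrace T * cdet v"
proof -
  let ?F = "\<lambda>v. \<Sum>i<4. cdet (v(i := T (v i)))"
  have upd: "?F (v(i := x)) = cdet (v(i := T x)) + (\<Sum>k\<in>{..<4}-{i}. cdet (v(k := T (v k), i := x)))"
    if "i < 4" for v i x
  proof -
    have "?F (v(i := x)) = cdet (v(i := T x)) +
      (\<Sum>k\<in>{..<4}-{i}. cdet (v(i := x, k := T ((v(i := x)) k))))"
      using that by (subst sum.remove[of _ i]) auto
    also have "(\<Sum>k\<in>{..<4}-{i}. cdet (v(i := x, k := T ((v(i := x)) k)))) =
       (\<Sum>k\<in>{..<4}-{i}. cdet (v(k := T (v k), i := x)))"
      by (rule sum.cong) (auto simp: fun_upd_twist)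
    finally show ?thesis .
  qed
  have "form40 ?F"
    unfolding form40_def
  proof (intro conjI allI impI)
    fix v w :: "nat \<Rightarrow> complex^4" assume "\<forall>i<4. v i = w i"
    then show "?F v = ?F w" by (intro sum.cong refl form40_cong[OF form40_cdet]) auto
  next
    fix v :: "nat \<Rightarrow> complex^4" and i :: nat assume i: "i < 4"
    have lin: "linear (\<lambda>x. cdet (w(i := x)))" for w
      by (rule form40_linear[OF form40_cdet i])
    show "linear (\<lambda>x. ?F (v(i := x)))"
      unfolding upd[OF i]
      by (intro linear_compose_add linear_compose_sum ballI lin
          linear_compose[OF T(1) lin, unfolded comp_def])
    fix x
    show "?F (v(i := J x)) = \<i> * ?F (v(i := x))"
      unfolding upd[OF i] T(2) form40_J[OF form40_cdet i] by (simp add: algebra_simps sum_distrib_left)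
  next
    fix v :: "nat \<Rightarrow> complex^4" and i j :: nat
    assume ij: "i < 4" "j < 4" "i \<noteq> j" "v i = v j"
    \<comment> \<open>With two equal arguments, the summands that alter neither of them vanish, and
      the two others cancel by antisymmetry.\<close>
    have "?F v = cdet (v(i := T (v i))) + cdet (v(j := T (v j))) +
      (\<Sum>k\<in>{..<4}-{i}-{j}. cdet (v(k := T (v k))))"
      using ij by (subst sum.remove[of _ i], simp, simp, subst sum.remove[of _ j]) auto
    also have "(\<Sum>k\<in>{..<4}-{i}-{j}. cdet (v(k := T (v k)))) = 0"
      using ij by (intro sum.neutral ballI form40_alt[OF form40_cdet, of i j]) auto
    also have "cdet (v(i := T (v i))) = cdet (v(i := T (v i), j := v i))"
      using ij by (metis fun_upd_idem_iff fun_upd_twist)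
    also have "\<dots> = - cdet (v(i := v i, j := T (v i)))"
      by (rule form40_swap2[OF form40_cdet ij(1-3)])
    also have "v(i := v i, j := T (v i)) = v(j := T (v j))"
      using ij(4) by (metis fun_upd_triv)
    finally show "?F v = 0" by (simp only: add.left_inverse add_0_right)
  qed
  then have "?F v = ?F std * cdet v" by (rule form40_eq_cdet)
  also have "?F std = ctrace T"
  proof -
    have "cdet (std(i := T (std i))) = T (std i) $ xi i" if "i < 4" for i
      using cdet_replace[OF that, of "T (std i)" "\<lambda>k. T (std i) $ xi k" std] std_expand[of "T (std i)"]
      by (simp add: cdet_std)
    then show ?thesis by (simp add: ctrace_def)
  qed
  finally show ?thesis .
qed

text \<open>Each replaced determinant picks out a diagonal coefficient, so the trace can be read off
  in any complex basis.\<close>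

lemma ctrace_replace:
  assumes T: "linear T" "\<And>x. T (J x) = J (T x)" and "cdet v \<noteq> 0"
    and "\<And>i. i < 4 \<Longrightarrow> T (v i) = (\<Sum>k<4. t i k *s v k)"
  shows "ctrace T = (\<Sum>i<4. t i i)"
proof -
  have "ctrace T * cdet v = (\<Sum>i<4. t i i * cdet v)"
    unfolding ctrace_cdet[OF T, symmetric]
    by (intro sum.cong refl cdet_replace) (use assms in auto)
  then show ?thesis using assms(3) by (simp add: sum_distrib_right[symmetric])
qed

section \<open>Hermitian inner products and unitary frames\<close>

locale hermitian =
  fixes G :: "complex^4 \<Rightarrow> complex^4 \<Rightarrow> real"
  assumes herm: "hermitian_inner G"
begin

lemma bilin: "bilinear G" and commute: "G v w = G w v" and pos: "v \<noteq> 0 \<Longrightarrow> G v v > 0"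
  and J_inv: "G (J v) (J w) = G v w"
  using herm unfolding hermitian_inner_def by blast+

lemma lin_left: "linear (\<lambda>v. G v w)" and lin_right: "linear (G v)"
  using bilin unfolding bilinear_def by auto

lemmas add_left = linear_add[OF lin_left] and add_right = linear_add[OF lin_right]
  and diff_left = linear_diff[OF lin_left] and diff_right = linear_diff[OF lin_right]
  and minus_left = linear_neg[OF lin_left] and minus_right = linear_neg[OF lin_right]
  and scale_left = linear_scale[OF lin_left] and scale_right = linear_scale[OF lin_right]
  and sum_left = linear_sum[OF lin_left] and sum_right = linear_sum[OF lin_right]
  and zero_left = linear_0[OF lin_left] and zero_right = linear_0[OF lin_right]

lemmas lin_simps = add_left add_right diff_left diff_right minus_left minus_right
  scale_left scale_right zero_left zero_right

lemma J_left: "G (J v) w = - G v (J w)"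
  using J_inv[of v "J w"] by (simp add: minus_right)

lemma J_right: "G v (J w) = - G (J v) w"
  by (simp add: J_left)

lemma J_self: "G (J v) v = 0"
  using J_left[of v v] commute[of "J v" v] by simp

lemma eq_zeroI: "(\<And>w. G v w = 0) \<Longrightarrow> v = 0"
  using pos[of v] by force

lemma eqI: "(\<And>w. G v w = G v' w) \<Longrightarrow> v = v'"
  using eq_zeroI[of "v - v'"] by (simp add: diff_left)

text \<open>The hermitian product belonging to \<open>G\<close>, complex linear in \<open>v\<close>
  and conjugate linear in \<open>u\<close>.\<close>

definition coord :: "complex^4 \<Rightarrow> complex^4 \<Rightarrow> complex" where
  "coord u v = Complex (G u v) (G (J u) v)"

lemma coord_add: "coord u (v + w) = coord u v + coord u w"
  and coord_scaleR: "coord u (r *\<^sub>R v) = r *\<^sub>R coord u v"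
  and coord_0: "coord u 0 = 0"
  by (simp_all add: coord_def lin_simps complex_eq_iff)

lemma coord_J: "coord u (J v) = \<i> * coord u v"
  by (simp add: coord_def complex_eq_iff J_right minus_left)

lemma coord_cmul: "coord u (c *s v) = c * coord u v"
  unfolding vec_cmul_eq coord_add coord_scaleR coord_J
  by (simp add: complex_eq_iff)

lemma coord_sum: "coord u (\<Sum>k\<in>K. c k *s v k) = (\<Sum>k\<in>K. c k * coord u (v k))"
  by (induction K rule: infinite_finite_induct) (simp_all add: coord_0 coord_add coord_cmul)

lemma linear_coords: "linear (\<lambda>v. \<Sum>k<m. coord (u k) v *s (std k))"
proof (rule linearI)
  fix x y :: "complex^4" and r :: real
  show "(\<Sum>k<m. coord (u k) (x + y) *s std k) =
      (\<Sum>k<m. coord (u k) x *s std k) + (\<Sum>k<m. coord (u k) y *s std k)"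
    by (simp add: coord_add vec_eq_iff algebra_simps sum.distrib)
  show "(\<Sum>k<m. coord (u k) (r *\<^sub>R x) *s std k) = r *\<^sub>R (\<Sum>k<m. coord (u k) x *s std k)"
    by (simp add: coord_scaleR vec_eq_iff scaleR_sum_right)
qed

lemma sum_std_nth: "i < 4 \<Longrightarrow> m \<le> 4 \<Longrightarrow> (\<Sum>k<m. c k *s std k) $ xi i = (if i < m then c i else 0)"
proof -
  assume i: "i < 4" "m \<le> 4"
  have "(\<Sum>k<m. c k *s std k) $ xi i = (\<Sum>k<m. c k * std k $ xi i)"
    by (simp add: sum_component)
  also have "\<dots> = (\<Sum>k<m. if k = i then c k else 0)"
    by (rule sum.cong) (use i in \<open>auto simp: std_nth\<close>)
  finally show ?thesis by simp
qed

lemma coord_unitary: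
  assumes "unitary_frame G u" "i < 4" "j < 4"
  shows "coord (u i) (u j) = (if i = j then 1 else 0)"
  using assms unfolding unitary_frame_def coord_def kform_def
  by (simp add: complex_eq_iff)

text \<open>Taking coordinates inverts the combination map on one side; in finite dimension it then
  does so on the other side as well.\<close>

lemma unitary_expand:
  assumes u: "unitary_frame G u"
  shows "v = (\<Sum>k<4. coord (u k) v *s u k)"
proof -
  let ?f = "\<lambda>v. \<Sum>k<4. coord (u k) v *s std k"
  let ?g = "\<lambda>z::complex^4. \<Sum>k<4. (z $ xi k) *s u k"
  have "coord (u k) (?g z) = z $ xi k" if k: "k < 4" for k z
  proof -
    have "coord (u k) (?g z) = (\<Sum>j<4. if k = j then z $ xi j else 0)"
      unfolding coord_sum using k by (intro sum.cong) (auto simp: coord_unitary[OF u])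
    then show ?thesis using k by simp
  qed
  then have "?f \<circ> ?g = id"
    using std_expand by (auto simp: fun_eq_iff)
  then have "?g \<circ> ?f = id"
    using linear_inverse_left[OF linear_coords linear_combination] by blast
  then have "?g (?f v) = v" by (simp add: fun_eq_iff)
  moreover have "?f v $ xi k = coord (u k) v" if "k < 4" for k
    using sum_std_nth[OF that, of 4] that by simp
  ultimately show ?thesis by simp
qed

text \<open>The coordinate map of \<open>m < 4\<close> vectors misses \<open>std m\<close>, so it is
  not injective; a normalized vector of its kernel extends the family.\<close>

lemma unitary_extend:
  fixes m :: nat
  assumes "m < 4"
    and u: "\<And>i j. i < m \<Longrightarrow> j < m \<Longrightarrow> coord (u i) (u j) = (if i = j then 1 else 0)"
  shows "\<exists>w. \<forall>i\<le>m. \<forall>j\<le>m. coord ((u(m := w)) i) ((u(m := w)) j) = (if i = j then 1 else 0)"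
proof -
  let ?f = "\<lambda>v. \<Sum>k<m. coord (u k) v *s std k"
  have "\<not> surj ?f"
  proof
    assume "surj ?f"
    then obtain v where "std m = ?f v" by (rule surjE)
    then have "?f v $ xi m = 1" using assms(1) std_nth[of m m] by simp
    then show False using assms(1) sum_std_nth[of m m "\<lambda>k. coord (u k) v"] by simp
  qed
  then have "\<not> inj ?f"
    using linear_injective_imp_surjective[OF linear_coords _ refl] by blast
  then obtain w where w: "?f w = 0" "w \<noteq> 0"
    by (auto simp: linear_injective_0[OF linear_coords])
  have z: "coord (u k) w = 0" if "k < m" for k
    using sum_std_nth[of k m "\<lambda>k. coord (u k) w"] assms(1) that w(1) by simp
  have z': "coord w (u k) = 0" if "k < m" for k
    using z[OF that] by (simp add: coord_def complex_eq_iff J_left commute[of w] )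
  define w' where "w' = (1 / sqrt (G w w)) *\<^sub>R w"
  have "coord w' w' = 1"
    using pos[OF w(2)] by (simp add: w'_def coord_def complex_eq_iff lin_simps J_scaleR J_self)
  moreover have "coord (u k) w' = 0" "coord w' (u k) = 0" if "k < m" for k
    using z[OF that] z'[OF that]
    by (auto simp: w'_def coord_def complex_eq_iff lin_simps J_scaleR)
  ultimately show ?thesis
    using u by (intro exI[of _ w']) (auto simp: le_less)
qed

lemma unitary_exists: obtains u where "unitary_frame G u"
proof -
  have "\<exists>u. \<forall>i<m. \<forall>j<m. coord (u i) (u j) = (if i = j then 1 else 0)" if "m \<le> 4" for m :: nat
    using that
  proof (induction m)
    case (Suc m)
    then obtain u where "\<forall>i<m. \<forall>j<m. coord (u i) (u j) = (if i = j then 1 else 0)" by auto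
    then obtain w where
      "\<forall>i\<le>m. \<forall>j\<le>m. coord ((u(m := w)) i) ((u(m := w)) j) = (if i = j then 1 else 0)"
      using unitary_extend[of m u] Suc.prems by auto
    then show ?case by (intro exI[of _ "u(m := w)"]) (simp only: less_Suc_eq_le)
  qed simp
  from this[of 4] obtain u :: "nat \<Rightarrow> complex^4"
    where u: "\<forall>i<4. \<forall>j<4. coord (u i) (u j) = (if i = j then 1 else 0)" by auto
  then have "unitary_frame G u"
    unfolding unitary_frame_def coord_def kform_def by (auto simp: complex_eq_iff split: if_splits)
  then show ?thesis by (rule that)
qed

lemma unitary_cdet: "unitary_frame G u \<Longrightarrow> cdet u \<noteq> 0"
  using cdet_expand[of std "\<lambda>i k. coord (u k) (std i)" u] unitary_expand cdet_std by auto

end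

section \<open>The wedge product as an antisymmetrization\<close>

text \<open>Antisymmetrization without division by a factorial; \<open>wedge\<close> divides it by
  \<open>fact p * fact q\<close>.\<close>

definition skew_sum :: "nat \<Rightarrow> ((nat \<Rightarrow> 'v) \<Rightarrow> complex) \<Rightarrow> (nat \<Rightarrow> 'v) \<Rightarrow> complex" where
  "skew_sum n F v = (\<Sum>\<sigma> | \<sigma> permutes {..<n}. of_int (sign \<sigma>) * F (\<lambda>i. v (\<sigma> i)))"

lemma sign_sq: "of_int (sign \<sigma>) * of_int (sign \<sigma>) = (1::complex)"
  by (simp add: sign_def)

lemma skew_sum_permute:
  assumes \<tau>: "\<tau> permutes {..<n}"
  shows "skew_sum n (\<lambda>w. F (\<lambda>i. w (\<tau> i))) v = of_int (sign \<tau>) * skew_sum n F v"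
proof -
  have "of_int (sign \<tau>) * skew_sum n F v = (\<Sum>\<sigma> | \<sigma> permutes {..<n}.
      of_int (sign \<tau>) * (of_int (sign (\<sigma> \<circ> \<tau>)) * F (\<lambda>i. v ((\<sigma> \<circ> \<tau>) i))))"
    unfolding skew_sum_def by (subst sum_permutations_compose_right[OF \<tau>]) (simp add: sum_distrib_left)
  also have "\<dots> = (\<Sum>\<sigma> | \<sigma> permutes {..<n}. of_int (sign \<sigma>) * F (\<lambda>i. v (\<sigma> (\<tau> i))))"
  proof (rule sum.cong[OF refl])
    fix \<sigma> assume "\<sigma> \<in> {\<sigma>. \<sigma> permutes {..<n}}"
    then have "permutation \<sigma>" "permutation \<tau>" using \<tau> permutation_permutes by blast+
    then have "of_int (sign \<tau>) * of_int (sign (\<sigma> \<circ> \<tau>)) = (of_int (sign \<sigma>) :: complex)"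
      by (simp add: sign_compose sign_sq)
    then show "of_int (sign \<tau>) * (of_int (sign (\<sigma> \<circ> \<tau>)) * F (\<lambda>i. v ((\<sigma> \<circ> \<tau>) i))) =
        of_int (sign \<sigma>) * F (\<lambda>i. v (\<sigma> (\<tau> i)))"
      by (simp only: mult.assoc[symmetric] o_apply)
  qed
  finally show ?thesis unfolding skew_sum_def by simp
qed

lemma skew_sum_sum: "skew_sum n (\<lambda>w. \<Sum>k\<in>K. c k * F k w) v = (\<Sum>k\<in>K. c k * skew_sum n (F k) v)"
proof -
  have "skew_sum n (\<lambda>w. \<Sum>k\<in>K. c k * F k w) v =
    (\<Sum>\<sigma> | \<sigma> permutes {..<n}. \<Sum>k\<in>K. of_int (sign \<sigma>) * (c k * F k (\<lambda>i. v (\<sigma> i))))"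
    unfolding skew_sum_def by (simp add: sum_distrib_left)
  also have "\<dots> = (\<Sum>k\<in>K. c k * skew_sum n (F k) v)"
    unfolding skew_sum_def by (subst sum.swap) (simp add: sum_distrib_left mult_ac)
  finally show ?thesis .
qed

lemma skew_sum_cmult: "skew_sum n (\<lambda>w. c * F w) v = c * skew_sum n F v"
  unfolding skew_sum_def by (simp add: sum_distrib_left mult_ac)

text \<open>Lets a permutation act on the last \<open>q\<close> slots with its sign unchanged, so
  that an inner antisymmetrization can be moved into an outer one.\<close>

lemma permutes_shift:
  fixes p q :: nat
  assumes "\<tau> permutes {..<q}"
  shows "\<exists>\<tau>'. \<tau>' permutes {..<p + q} \<and> sign \<tau>' = sign \<tau> \<and> (\<forall>i<p. \<tau>' i = i) \<and>
    (\<forall>i. \<tau>' (p + i) = p + \<tau> i)"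
  using finite_lessThan[of q] assms
proof (induction rule: permutes_rev_induct)
  case id
  show ?case by (intro exI[of _ id] conjI permutes_id) auto
next
  case (swap a b \<tau>)
  then obtain \<tau>' where \<tau>': "\<tau>' permutes {..<p + q}" "sign \<tau>' = sign \<tau>" "\<forall>i<p. \<tau>' i = i"
    "\<forall>i. \<tau>' (p + i) = p + \<tau> i" by blast
  let ?t = "Transposition.transpose (p + a) (p + b)"
  have t: "?t permutes {..<p + q}" using swap by (intro permutes_swap_id) auto
  have perm: "permutation \<tau>'" "permutation \<tau>" using \<tau>' swap permutation_permutes by blast+
  have "sign (\<tau>' \<circ> ?t) = sign (\<tau> \<circ> Transposition.transpose a b)"
    using perm \<tau>'(2) by (simp add: sign_compose permutation_swap_id sign_swap_id)
  moreover have "\<tau>' \<circ> ?t permutes {..<p + q}" using t \<tau>'(1) by (rule permutes_compose)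
  moreover have "(\<tau>' \<circ> ?t) i = i" if "i < p" for i
    using that \<tau>'(3) by (simp add: Transposition.transpose_def)
  moreover have "(\<tau>' \<circ> ?t) (p + i) = p + (\<tau> \<circ> Transposition.transpose a b) i" for i
    using \<tau>'(4) by (simp add: Transposition.transpose_def)
  ultimately show ?case by blast
qed

lemma card_permutes: "card {\<sigma>. \<sigma> permutes {..<n::nat}} = fact n"
  using card_permutations[of "{..<n}" n] by simp

text \<open>Each inner permutation extends to a permutation of all slots, and the outer
  antisymmetrization absorbs it together with its sign. The resulting factorial cancels one in the
  denominator of \<open>wedge\<close>.\<close>

lemma skew_sum_absorb_right:
  assumes a: "\<And>v w. (\<forall>i<p. v i = w i) \<Longrightarrow> a v = a w"
  shows "skew_sum (p + q) (\<lambda>w. a w * skew_sum q b (\<lambda>i. w (p + i))) v =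
    fact q * skew_sum (p + q) (\<lambda>w. a w * b (\<lambda>i. w (p + i))) v"
proof -
  let ?F = "\<lambda>w. a w * b (\<lambda>i. w (p + i))"
  have "skew_sum (p + q) (\<lambda>w. a w * skew_sum q b (\<lambda>i. w (p + i))) v =
    skew_sum (p + q) (\<lambda>w. \<Sum>\<tau> | \<tau> permutes {..<q}. of_int (sign \<tau>) *
      (a w * b (\<lambda>i. w (p + \<tau> i)))) v"
    unfolding skew_sum_def[of q] by (simp add: sum_distrib_left mult_ac)
  also have "\<dots> = (\<Sum>\<tau> | \<tau> permutes {..<q}. of_int (sign \<tau>) *
      skew_sum (p + q) (\<lambda>w. a w * b (\<lambda>i. w (p + \<tau> i))) v)"
    by (rule skew_sum_sum)
  also have "\<dots> = (\<Sum>\<tau> | \<tau> permutes {..<q}. skew_sum (p + q) ?F v)"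
  proof (rule sum.cong[OF refl])
    fix \<tau> assume "\<tau> \<in> {\<tau>. \<tau> permutes {..<q}}"
    then obtain \<tau>' where \<tau>': "\<tau>' permutes {..<p + q}" "sign \<tau>' = sign \<tau>" "\<forall>i<p. \<tau>' i = i"
      "\<forall>i. \<tau>' (p + i) = p + \<tau> i" using permutes_shift by blast
    have "(\<lambda>w. a w * b (\<lambda>i. w (p + \<tau> i))) = (\<lambda>w. ?F (\<lambda>i. w (\<tau>' i)))"
    proof
      fix w
      have "a w = a (\<lambda>i. w (\<tau>' i))" by (rule a) (use \<tau>'(3) in simp)
      then show "a w * b (\<lambda>i. w (p + \<tau> i)) = ?F (\<lambda>i. w (\<tau>' i))" using \<tau>'(4) by simp
    qed
    then show "of_int (sign \<tau>) * skew_sum (p + q) (\<lambda>w. a w * b (\<lambda>i. w (p + \<tau> i))) v =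
        skew_sum (p + q) ?F v"
      using skew_sum_permute[OF \<tau>'(1), of ?F v] \<tau>'(2) sign_sq[of \<tau>]
      by (simp add: mult.assoc[symmetric])
  qed
  finally show ?thesis by (simp add: card_permutes)
qed

lemma skew_sum_absorb_left:
  "skew_sum (p + q) (\<lambda>w. skew_sum p a w * b (\<lambda>i. w (p + i))) v =
    fact p * skew_sum (p + q) (\<lambda>w. a w * b (\<lambda>i. w (p + i))) v"
proof -
  let ?F = "\<lambda>w. a w * b (\<lambda>i. w (p + i))"
  have "skew_sum (p + q) (\<lambda>w. skew_sum p a w * b (\<lambda>i. w (p + i))) v =
    skew_sum (p + q) (\<lambda>w. \<Sum>\<tau> | \<tau> permutes {..<p}. of_int (sign \<tau>) *
      (a (\<lambda>i. w (\<tau> i)) * b (\<lambda>i. w (p + i)))) v"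
    unfolding skew_sum_def[of p] sum_distrib_right by (simp only: mult.assoc)
  also have "\<dots> = (\<Sum>\<tau> | \<tau> permutes {..<p}. of_int (sign \<tau>) *
      skew_sum (p + q) (\<lambda>w. a (\<lambda>i. w (\<tau> i)) * b (\<lambda>i. w (p + i))) v)"
    by (rule skew_sum_sum)
  also have "\<dots> = (\<Sum>\<tau> | \<tau> permutes {..<p}. skew_sum (p + q) ?F v)"
  proof (rule sum.cong[OF refl])
    fix \<tau> assume "\<tau> \<in> {\<tau>. \<tau> permutes {..<p}}"
    then have \<tau>: "\<tau> permutes {..<p}" by simp
    then have \<tau>': "\<tau> permutes {..<p + q}" by (rule permutes_subset) auto
    have "\<tau> (p + i) = p + i" for i using permutes_not_in[OF \<tau>] by simp
    then show "of_int (sign \<tau>) * skew_sum (p + q) (\<lambda>w. a (\<lambda>i. w (\<tau> i)) * b (\<lambda>i. w (p + i))) v =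
        skew_sum (p + q) ?F v"
      using skew_sum_permute[OF \<tau>', of ?F v] sign_sq[of \<tau>]
      by (simp add: mult.assoc[symmetric])
  qed
  finally show ?thesis by (simp add: card_permutes)
qed

lemma wedge_skew_sum: "wedge p q \<alpha> \<beta> v =
    skew_sum (p + q) (\<lambda>w. \<alpha> w * \<beta> (\<lambda>i. w (p + i))) v / (fact p * fact q)"
  unfolding wedge_def skew_sum_def by (simp add: mult.assoc)

lemma skew_sum_2: "skew_sum 2 (\<lambda>w. B (w 0) (w 1)) v = B (v 0) (v 1) - B (v 1) (v 0)"
proof -
  have *: "{..<2::nat} = {0, 1}" by auto
  have "(\<Sum>\<sigma> | \<sigma> permutes {0, 1::nat}. f \<sigma>) = f id + f (Transposition.transpose 0 1)" for f :: "_ \<Rightarrow> complex"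
    by (simp add: sum_over_permutations_insert permutes_sing)
  then show ?thesis unfolding skew_sum_def * by (simp add: sign_swap_id)
qed

text \<open>A two-form is the antisymmetrization of any \<open>B\<close> with this property, and the
  factorials created by absorbing the inner antisymmetrizations cancel those of
  \<open>wedge\<close>. All denominators disappear.\<close>

lemma wedge_power_2:
  assumes \<omega>: "\<And>x. \<omega> x = B (x 0) (x 1) - B (x 1) (x 0)"
  shows "wedge_power 2 \<omega> n = skew_sum (2 * n) (\<lambda>w. \<Prod>k<n. B (w (2 * k)) (w (2 * k + 1)))"
proof (induction n)
  case 0
  show ?case by (rule ext) (simp add: skew_sum_def)
next
  case (Suc n)
  let ?P = "\<lambda>w::nat \<Rightarrow> complex^4. \<Prod>k<n. B (w (2 * k)) (w (2 * k + 1))"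
  have \<omega>': "\<omega> = skew_sum 2 (\<lambda>w. B (w 0) (w 1))"
    unfolding skew_sum_2 by (rule ext) (rule \<omega>)
  show ?case
  proof
    fix v
    have "wedge_power 2 \<omega> (Suc n) v = skew_sum (2 + 2 * n) (\<lambda>w. \<omega> w * skew_sum (2 * n) ?P (\<lambda>i. w (2 + i))) v
        / (fact 2 * fact (2 * n))"
      by (simp add: wedge_skew_sum Suc)
    also have "\<dots> = skew_sum (2 + 2 * n) (\<lambda>w. \<omega> w * ?P (\<lambda>i. w (2 + i))) v / fact 2"
      by (subst skew_sum_absorb_right) (auto simp: \<omega>)
    also have "\<dots> = skew_sum (2 + 2 * n) (\<lambda>w. B (w 0) (w 1) * ?P (\<lambda>i. w (2 + i))) v"
      unfolding \<omega>' skew_sum_absorb_left[of 2 "2 * n" "\<lambda>w. B (w 0) (w 1)" ?P v] by simp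
    also have "(\<lambda>w. B (w 0) (w 1) * ?P (\<lambda>i. w (2 + i))) =
        (\<lambda>w. \<Prod>k<Suc n. B (w (2 * k)) (w (2 * k + 1)))"
      by (simp add: prod.lessThan_Suc_shift del: prod.lessThan_Suc)
    finally show "wedge_power 2 \<omega> (Suc n) v =
        skew_sum (2 * Suc n) (\<lambda>w. \<Prod>k<Suc n. B (w (2 * k)) (w (2 * k + 1))) v"
      by simp
  qed
qed

lemma skew_sum_prod: "skew_sum n (\<lambda>w. \<Prod>i<n. r i (w i)) v = ndet n (\<lambda>i j. r i (v j))"
  by (simp add: skew_sum_def ndet_def)

section \<open>Rearranging determinants with explicitly listed rows\<close>

lemma ndet_list_swap:
  fixes xs :: "(nat \<Rightarrow> complex) list"
  assumes "length xs = n" "i < n" "j < n" "i \<noteq> j"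
  shows "ndet n ((!) (xs[i := xs ! j, j := xs ! i])) = - ndet n ((!) xs)"
proof -
  have "ndet n ((!) (xs[i := xs ! j, j := xs ! i])) =
      ndet n ((!) xs \<circ> Transposition.transpose i j)"
    by (rule skew_cong[OF skew_ndet])
      (use assms in \<open>auto simp: nth_list_update Transposition.transpose_def\<close>)
  then show ?thesis using skew_transpose[OF skew_ndet assms(2-4)] by simp
qed

lemma ndet_row_add:
  assumes "i < n"
  shows "ndet n (a(i := (\<lambda>k. X k + c * Y k))) = ndet n (a(i := X)) + c * ndet n (a(i := Y))"
  unfolding ndet_row[OF assms]
  by (simp add: algebra_simps sum.distrib sum_distrib_left)

text \<open>The rule dz \<and> d(cnj z) = - 2 i dx \<and> dy for two rows of a determinant: terms
  with a repeated row vanish, and the two mixed terms add up.\<close>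

lemma ndet_pair:
  fixes a :: "nat \<Rightarrow> nat \<Rightarrow> complex"
  assumes ij: "i < n" "j < n" "i \<noteq> j"
  shows "ndet n (a(i := (\<lambda>k. X k + \<i> * Y k), j := (\<lambda>k. X k + (- \<i>) * Y k))) =
    - 2 * \<i> * ndet n (a(i := X, j := Y))"
proof -
  have tw: "a(i := x, j := y) = a(j := y, i := x)" for x y
    using ij by (simp add: fun_upd_twist)
  have z: "ndet n (a(i := x, j := x)) = 0" for x
    by (rule skew_eq_zero[OF skew_ndet ij]) (use ij in simp)
  have "a(i := Y, j := X) = a(i := X, j := Y) \<circ> Transposition.transpose i j"
    using ij by (auto simp: fun_eq_iff Transposition.transpose_def)
  then have sw: "ndet n (a(i := Y, j := X)) = - ndet n (a(i := X, j := Y))"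
    using skew_transpose[OF skew_ndet ij] by simp
  have "ndet n (a(i := (\<lambda>k. X k + \<i> * Y k), j := (\<lambda>k. X k + (- \<i>) * Y k))) =
    ndet n (a(i := X, j := X)) + \<i> * ndet n (a(i := Y, j := X)) +
      (- \<i>) * (ndet n (a(i := X, j := Y)) + \<i> * ndet n (a(i := Y, j := Y)))"
    unfolding ndet_row_add[OF ij(2)]
    unfolding tw ndet_row_add[OF ij(1)] ..
  then show ?thesis by (simp add: z sw)
qed

lemma ndet_pair_list:
  fixes xs :: "(nat \<Rightarrow> complex) list"
  assumes "length xs = n" "i < n" "j < n" "i \<noteq> j"
  shows "ndet n ((!) (xs[i := (\<lambda>k. X k + \<i> * Y k), j := (\<lambda>k. X k + (- \<i>) * Y k)])) =
    - 2 * \<i> * ndet n ((!) (xs[i := X, j := Y]))"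
proof -
  have "ndet n ((!) (xs[i := x, j := y])) = ndet n (((!) xs)(i := x, j := y))" for x y
    by (rule skew_cong[OF skew_ndet]) (use assms in \<open>auto simp: nth_list_update\<close>)
  then show ?thesis using ndet_pair[OF assms(2-4)] by simp
qed

text \<open>The product of four factors dx \<and> dy with indices \<open>a\<close>,
  \<open>b\<close>, \<open>c\<close>, \<open>d\<close>, evaluated on eight vectors; \<open>X\<close>
  and \<open>Y\<close> hold the values of the real coordinate forms.\<close>

definition interleaved :: "(nat \<Rightarrow> nat \<Rightarrow> complex) \<Rightarrow> (nat \<Rightarrow> nat \<Rightarrow> complex) \<Rightarrow> nat \<Rightarrow> nat \<Rightarrow> nat \<Rightarrow> nat \<Rightarrow> complex"
  where "interleaved X Y a b c d = ndet 8 ((!) [X a, Y a, X b, Y b, X c, Y c, X d, Y d])"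

lemma interleaved_zero:
  "interleaved X Y a a c d = 0" "interleaved X Y a b a d = 0" "interleaved X Y a b c a = 0"
  "interleaved X Y a b b d = 0" "interleaved X Y a b c b = 0" "interleaved X Y a b c c = 0"
  unfolding interleaved_def
  by (rule skew_eq_zero[OF skew_ndet, of 0 _ 2] skew_eq_zero[OF skew_ndet, of 0 _ 4]
      skew_eq_zero[OF skew_ndet, of 0 _ 6] skew_eq_zero[OF skew_ndet, of 2 _ 4]
      skew_eq_zero[OF skew_ndet, of 2 _ 6] skew_eq_zero[OF skew_ndet, of 4 _ 6]; simp)+

text \<open>Two-forms commute: exchanging neighbouring pairs takes two row exchanges, so no sign
  appears.\<close>

lemma interleaved_swap:
  "interleaved X Y b a c d = interleaved X Y a b c d"
  "interleaved X Y a c b d = interleaved X Y a b c d"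
  "interleaved X Y a b d c = interleaved X Y a b c d"
proof -
  let ?l = "[X a, Y a, X b, Y b, X c, Y c, X d, Y d]"
  show "interleaved X Y b a c d = interleaved X Y a b c d"
    using ndet_list_swap[of ?l 8 0 2] ndet_list_swap[of "?l[0 := ?l ! 2, 2 := ?l ! 0]" 8 1 3]
    by (simp add: interleaved_def)
  show "interleaved X Y a c b d = interleaved X Y a b c d"
    using ndet_list_swap[of ?l 8 2 4] ndet_list_swap[of "?l[2 := ?l ! 4, 4 := ?l ! 2]" 8 3 5]
    by (simp add: interleaved_def)
  show "interleaved X Y a b d c = interleaved X Y a b c d"
    using ndet_list_swap[of ?l 8 4 6] ndet_list_swap[of "?l[4 := ?l ! 6, 6 := ?l ! 4]" 8 5 7]
    by (simp add: interleaved_def)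
qed

text \<open>Only the 4! = 24 orderings of distinct indices survive, and they all contribute the
  same.\<close>

lemma interleaved_sum:
  "(\<Sum>a<4. \<Sum>b<4. \<Sum>c<4. \<Sum>d<4. interleaved X Y a b c d) = 24 * interleaved X Y 0 1 2 3"
  by (simp add: sum_lessThan_4 interleaved_zero interleaved_swap)

text \<open>Four row exchanges sort the rows, an even number.\<close>

lemma interleaved_blocks:
  "interleaved X Y 0 1 2 3 = ndet 8 ((!) [X 0, X 1, X 2, X 3, Y 0, Y 1, Y 2, Y 3])"
  using ndet_list_swap[of "[X 0, Y 0, X 1, Y 1, X 2, Y 2, X 3, Y 3]" 8 1 2]
    ndet_list_swap[of "[X 0, X 1, Y 0, Y 1, X 2, Y 2, X 3, Y 3]" 8 2 4]
    ndet_list_swap[of "[X 0, X 1, X 2, Y 1, Y 0, Y 2, X 3, Y 3]" 8 3 6]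
    ndet_list_swap[of "[X 0, X 1, X 2, X 3, Y 0, Y 2, Y 1, Y 3]" 8 5 6]
  by (simp add: interleaved_def)

text \<open>Four conjugate pairs contribute (- 2 i)^4 = 16.\<close>

lemma complex_blocks:
  fixes X Y :: "nat \<Rightarrow> nat \<Rightarrow> complex"
  defines "Z \<equiv> \<lambda>s k. X s k + \<i> * Y s k" and "W \<equiv> \<lambda>s k. X s k + (- \<i>) * Y s k"
  shows "ndet 8 ((!) [Z 0, Z 1, Z 2, Z 3, W 0, W 1, W 2, W 3]) =
    16 * ndet 8 ((!) [X 0, X 1, X 2, X 3, Y 0, Y 1, Y 2, Y 3])"
  using ndet_pair_list[of "[Z 0, Z 1, Z 2, Z 3, W 0, W 1, W 2, W 3]" 8 0 4 "X 0" "Y 0"]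
    ndet_pair_list[of "[X 0, Z 1, Z 2, Z 3, Y 0, W 1, W 2, W 3]" 8 1 5 "X 1" "Y 1"]
    ndet_pair_list[of "[X 0, X 1, Z 2, Z 3, Y 0, Y 1, W 2, W 3]" 8 2 6 "X 2" "Y 2"]
    ndet_pair_list[of "[X 0, X 1, X 2, Z 3, Y 0, Y 1, Y 2, W 3]" 8 3 7 "X 3" "Y 3"]
  by (simp add: Z_def W_def)

lemma lessThan_8: "{..<8::nat} = {0, 1, 2, 3, 4, 5, 6, 7}"
  by auto

lemma less_8_cases: "i < 8 \<Longrightarrow> i \<in> {0, 1, 2, 3, 4, 5, 6, 7::nat}"
  by auto

section \<open>The normalization condition in a unitary frame\<close>

context hermitian
begin

text \<open>The real volume form in the coordinates of the frame; both sides of the normalization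
  condition turn out to be multiples of it.\<close>

definition blocks :: "(nat \<Rightarrow> complex^4) \<Rightarrow> (nat \<Rightarrow> complex^4) \<Rightarrow> complex" where
  "blocks u v = (let X = \<lambda>s j. complex_of_real (G (u s) (v j));
                   Y = \<lambda>s j. complex_of_real (G (J (u s)) (v j))
      in ndet 8 ((!) [X 0, X 1, X 2, X 3, Y 0, Y 1, Y 2, Y 3]))"

text \<open>The standard form of the Kaehler form, a sum of four terms dx \<and> dy, found by
  expanding the first argument in the frame.\<close>

lemma kform_expand:
  assumes u: "unitary_frame G u"
  shows "kform G v w =
    (\<Sum>s<4. G (u s) v * G (J (u s)) w) - (\<Sum>s<4. G (J (u s)) v * G (u s) w)"
proof -
  have "kform G v w = - G v (J w)" by (simp add: kform_def J_left)
  also have "\<dots> = - G (\<Sum>k<4. coord (u k) v *s u k) (J w)"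
    using unitary_expand[OF u, of v] by simp
  also have "\<dots> = - (\<Sum>s<4. G (u s) v * G (u s) (J w) + G (J (u s)) v * G (J (u s)) (J w))"
    by (simp add: sum_left vec_cmul_eq lin_simps coord_def)
  also have "\<dots> = - (\<Sum>s<4. G (J (u s)) v * G (u s) w - G (u s) v * G (J (u s)) w)"
    by (simp add: J_right minus_left)
  finally show ?thesis by (simp add: sum_subtractf)
qed

text \<open>Multiplying out four copies of the sum of dx \<and> dy gives interleaved determinants
  over all index quadruples; the 24 counts the orderings.\<close>

lemma wedge_power_kform:
  assumes u: "unitary_frame G u"
  shows "wedge_power 2 (\<lambda>x. complex_of_real (kform G (x 0) (x 1))) 4 v = 24 * blocks u v"
proof -
  define X where "X = (\<lambda>s x. complex_of_real (G (u s) x))"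
  define Y where "Y = (\<lambda>s x. complex_of_real (G (J (u s)) x))"
  define B where "B = (\<lambda>x y. \<Sum>s<4. X s x * Y s y)"
  define XX where "XX = (\<lambda>s j. X s (v j))"
  define YY where "YY = (\<lambda>s j. Y s (v j))"
  let ?s = "\<lambda>w. \<Sum>a<4. \<Sum>b<4. \<Sum>c<4. \<Sum>d<4.
      (\<Prod>i<8. ([X a, Y a, X b, Y b, X c, Y c, X d, Y d] ! i) (w i))"
  have W: "wedge_power 2 (\<lambda>x. complex_of_real (kform G (x 0) (x 1))) 4 =
      skew_sum (2 * 4) (\<lambda>w. \<Prod>k<4. B (w (2 * k)) (w (2 * k + 1)))"
    by (rule wedge_power_2) (simp add: kform_expand[OF u] B_def X_def Y_def mult.commute)
  have A: "(\<lambda>w. \<Prod>k<4. B (w (2 * k)) (w (2 * k + 1))) =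
    ?s"
  proof
    fix w :: "nat \<Rightarrow> complex^4"
    have "(\<Prod>k<4. B (w (2 * k)) (w (2 * k + 1))) =
      B (w 0) (w 1) * (B (w 2) (w 3) * (B (w 4) (w 5) * B (w 6) (w 7)))"
      by (simp add: lessThan_4)
    also have "\<dots> = (\<Sum>a<4. X a (w 0) * Y a (w 1) * (\<Sum>b<4. X b (w 2) * Y b (w 3) *
      (\<Sum>c<4. X c (w 4) * Y c (w 5) * (\<Sum>d<4. X d (w 6) * Y d (w 7)))))"
      unfolding B_def sum_distrib_right ..
    also have "\<dots> = (\<Sum>a<4. \<Sum>b<4. \<Sum>c<4. \<Sum>d<4. X a (w 0) * Y a (w 1) * (X b (w 2) * Y b (w 3) *
      (X c (w 4) * Y c (w 5) * (X d (w 6) * Y d (w 7)))))"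
      unfolding sum_distrib_left ..
    also have "\<dots> = (?s w)"
      by (intro sum.cong refl) (simp add: lessThan_8)
    finally show "(\<Prod>k<4. B (w (2 * k)) (w (2 * k + 1))) = (?s w)" .
  qed
  have S: "skew_sum (2 * 4) ?s v =
      (\<Sum>a<4. \<Sum>b<4. \<Sum>c<4. \<Sum>d<4. interleaved XX YY a b c d)"
  proof -
    have one: "skew_sum 8 (\<lambda>w. \<Sum>k\<in>K. F k w) v = (\<Sum>k\<in>K. skew_sum 8 (F k) v)" for F and K :: "nat set"
      using skew_sum_sum[of 8 "\<lambda>_. 1" F K v] by simp
    have "skew_sum 8 (\<lambda>w. \<Prod>i<8. ([X a, Y a, X b, Y b, X c, Y c, X d, Y d] ! i) (w i)) v =
        interleaved XX YY a b c d" for a b c d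
      unfolding skew_sum_prod[of 8 "(!) [X a, Y a, X b, Y b, X c, Y c, X d, Y d]" v] interleaved_def
      by (rule ndet_cong) (drule less_8_cases, auto simp: XX_def YY_def)
    moreover have "2 * 4 = (8::nat)" by simp
    ultimately show ?thesis by (simp only: one)
  qed
  show ?thesis unfolding W A S interleaved_sum interleaved_blocks
    by (simp add: blocks_def XX_def YY_def X_def Y_def)
qed

text \<open>In unitary coordinates the form is \<open>\<Omega> u\<close> times dz0 \<and> dz1 \<and>
  dz2 \<and> dz3. The two factors \<open>fact 4\<close> from absorbing both antisymmetrizations
  cancel the denominator, and 16 is the passage from dz, d(cnj z) to dx, dy.\<close>

lemma wedge_form40:
  assumes u: "unitary_frame G u" and \<Omega>: "form40 \<Omega>"
  shows "wedge 4 4 \<Omega> (\<lambda>x. cnj (\<Omega> x)) v = 16 * (\<Omega> u * cnj (\<Omega> u)) * blocks u v"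
proof -
  define X where "X = (\<lambda>s j. complex_of_real (G (u s) (v j)))"
  define Y where "Y = (\<lambda>s j. complex_of_real (G (J (u s)) (v j)))"
  define c where "c = \<Omega> u"
  define a where "a = skew_sum 4 (\<lambda>w. \<Prod>i<4. coord (u i) (w i))"
  define b where "b = skew_sum 4 (\<lambda>w. \<Prod>i<4. cnj (coord (u i) (w i)))"
  have \<Omega>_eq: "\<Omega> w = a w * c" for w
  proof -
    have "\<Omega> w = ndet 4 (\<lambda>i k. coord (u k) (w i)) * \<Omega> u"
      by (rule form40_expand[OF \<Omega>]) (rule unitary_expand[OF u])
    also have "ndet 4 (\<lambda>i k. coord (u k) (w i)) = ndet 4 (\<lambda>i k. coord (u i) (w k))"
      by (rule ndet_transpose)
    finally show ?thesis unfolding c_def a_def skew_sum_prod[of 4 "\<lambda>i. coord (u i)" w] .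
  qed
  have b: "cnj (a w) = b w" for w
    unfolding a_def b_def skew_sum_prod[of 4 "\<lambda>i. coord (u i)" w]
      skew_sum_prod[of 4 "\<lambda>i x. cnj (coord (u i) x)" w] ndet_cnj ..
  have "wedge 4 4 \<Omega> (\<lambda>x. cnj (\<Omega> x)) v =
    skew_sum (4 + 4) (\<lambda>w. (c * cnj c) * (a w * b (\<lambda>i. w (4 + i)))) v / (fact 4 * fact 4)"
    unfolding wedge_skew_sum \<Omega>_eq by (simp add: b mult_ac)
  also have "\<dots> = (c * cnj c) * skew_sum (4 + 4) (\<lambda>w. a w * b (\<lambda>i. w (4 + i))) v / (fact 4 * fact 4)"
    by (simp only: skew_sum_cmult)
  also have "skew_sum (4 + 4) (\<lambda>w. a w * b (\<lambda>i. w (4 + i))) v =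
     fact 4 * skew_sum (4 + 4) (\<lambda>w. (\<Prod>i<4. coord (u i) (w i)) * b (\<lambda>i. w (4 + i))) v"
    unfolding a_def by (rule skew_sum_absorb_left)
  also have "skew_sum (4 + 4) (\<lambda>w. (\<Prod>i<4. coord (u i) (w i)) * b (\<lambda>i. w (4 + i))) v =
     fact 4 * skew_sum (4 + 4) (\<lambda>w. (\<Prod>i<4. coord (u i) (w i)) * (\<Prod>i<4. cnj (coord (u i) (w (4 + i))))) v"
    unfolding b_def
    by (rule skew_sum_absorb_right[of 4 "\<lambda>w. \<Prod>i<4. coord (u i) (w i)"]) auto
  also have "skew_sum (4 + 4) (\<lambda>w. (\<Prod>i<4. coord (u i) (w i)) * (\<Prod>i<4. cnj (coord (u i) (w (4 + i))))) v =
    skew_sum 8 (\<lambda>w. \<Prod>i<8. (if i < 4 then coord (u i) (w i) else cnj (coord (u (i - 4)) (w i)))) v"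
    by (rule arg_cong2[of _ _ _ _ "\<lambda>n f. skew_sum n f v"]) (auto simp: lessThan_4 lessThan_8 fun_eq_iff)
  also have "\<dots> = ndet 8 (\<lambda>i j. if i < 4 then coord (u i) (v j) else cnj (coord (u (i - 4)) (v j)))"
    using skew_sum_prod[of 8 "\<lambda>i x. if i < 4 then coord (u i) x else cnj (coord (u (i - 4)) x)" v] .
  also have "\<dots> = ndet 8 ((!) [\<lambda>k. X 0 k + \<i> * Y 0 k, \<lambda>k. X 1 k + \<i> * Y 1 k, \<lambda>k. X 2 k + \<i> * Y 2 k,
      \<lambda>k. X 3 k + \<i> * Y 3 k, \<lambda>k. X 0 k + (- \<i>) * Y 0 k, \<lambda>k. X 1 k + (- \<i>) * Y 1 k,
      \<lambda>k. X 2 k + (- \<i>) * Y 2 k, \<lambda>k. X 3 k + (- \<i>) * Y 3 k])"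
    by (rule ndet_cong) (drule less_8_cases, auto simp: X_def Y_def coord_def complex_eq_iff)
  also have "\<dots> = 16 * blocks u v"
    unfolding complex_blocks by (simp add: blocks_def X_def Y_def)
  finally show ?thesis by (simp add: mult_ac c_def)
qed

lemma blocks_self:
  assumes u: "unitary_frame G u"
  shows "blocks u (\<lambda>j. if j < 4 then u j else J (u (j - 4))) = 1"
proof -
  have *: "G (u i) (u j) = (if i = j then 1 else 0)" "G (J (u i)) (u j) = 0"
    "G (u i) (J (u j)) = 0" "G (J (u i)) (J (u j)) = (if i = j then 1 else 0)"
    if "i < 4" "j < 4" for i j
    using u that unfolding unitary_frame_def kform_def by (auto simp: J_right minus_left)
  have "blocks u (\<lambda>j. if j < 4 then u j else J (u (j - 4))) =
    ndet 8 (\<lambda>i j. if i = j then 1 else 0)"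
    unfolding blocks_def Let_def
    by (rule ndet_cong) (drule less_8_cases, drule less_8_cases, auto simp: *)
  then show ?thesis by (simp add: ndet_one)
qed

text \<open>The constants match because (i / 2)^4 * 16 = 1 and 24 = 4!. What remains compares two
  multiples of \<open>blocks u\<close>, which has the value 1 on the frame itself.\<close>

lemma normalized_iff:
  assumes u: "unitary_frame G u" and \<Omega>: "form40 \<Omega>"
  shows "normalized G \<Omega> \<longleftrightarrow> cmod (\<Omega> u) = 1"
proof -
  have 1: "(\<i> / 2) ^ 4 * (16 * c * d) = c * d" for c d :: complex
    by (simp add: power4_eq_xxxx)
  have "normalized G \<Omega> \<longleftrightarrow> (\<forall>v. blocks u v = (\<Omega> u * cnj (\<Omega> u)) * blocks u v)"
    unfolding normalized_def wedge_power_kform[OF u] wedge_form40[OF assms] 1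
    by (simp add: fact_numeral)
  also have "\<dots> \<longleftrightarrow> \<Omega> u * cnj (\<Omega> u) = 1"
  proof
    assume *: "\<forall>v. blocks u v = (\<Omega> u * cnj (\<Omega> u)) * blocks u v"
    show "\<Omega> u * cnj (\<Omega> u) = 1"
      using *[rule_format, of "\<lambda>j. if j < 4 then u j else J (u (j - 4))"]
      unfolding blocks_self[OF u] by simp
  qed simp
  also have "\<dots> \<longleftrightarrow> (cmod (\<Omega> u))\<^sup>2 = 1"
    unfolding complex_norm_square[symmetric] by (rule of_real_eq_1_iff)
  also have "\<dots> \<longleftrightarrow> cmod (\<Omega> u) = 1"
    using norm_ge_zero[of "\<Omega> u"] unfolding power2_eq_1_iff by linarith
  finally show ?thesis .
qed

end

section \<open>Calculus\<close>

lemma frechet_derivative_eq: "(f has_derivative f') (at x) \<Longrightarrow> frechet_derivative f (at x) = f'"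
  using frechet_derivative_at by metis

lemma smooth_on_has_derivative:
  assumes "smooth_on S f" "x \<in> S"
  shows "(f has_derivative frechet_derivative f (at x)) (at x)"
proof -
  have "Ck_on (Suc 0) S f" using assms(1) unfolding smooth_on_def by blast
  then have "f differentiable (at x)" using assms(2) by simp
  then show ?thesis by (simp add: frechet_derivative_works)
qed

lemma smooth_on_derivative:
  assumes "smooth_on S f"
  shows "smooth_on S (\<lambda>x. frechet_derivative f (at x) v)"
  unfolding smooth_on_def
proof
  fix k
  have "Ck_on (Suc k) S f" using assms(1) unfolding smooth_on_def by blast
  then show "Ck_on k S (\<lambda>x. frechet_derivative f (at x) v)" by simp
qed

lemma derivative_of_linear_family:
  assumes U: "open U" "p \<in> U" and lin: "\<And>x. x \<in> U \<Longrightarrow> linear (B x)"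
    and der: "\<And>b. ((\<lambda>x. B x b) has_derivative (\<lambda>h. B' h b)) (at p)"
  shows "linear (B' h)"
proof (rule linearI)
  fix b c :: 'b and r :: real
  have "((\<lambda>x. B x b + B x c) has_derivative (\<lambda>h. B' h b + B' h c)) (at p)"
    by (intro derivative_intros der)
  then have "((\<lambda>x. B x (b + c)) has_derivative (\<lambda>h. B' h b + B' h c)) (at p)"
    by (rule has_derivative_transform_within_open[OF _ U]) (simp add: linear_add[OF lin])
  from has_derivative_unique[OF this der]
  show "B' h (b + c) = B' h b + B' h c" by metis
  have "((\<lambda>x. r *\<^sub>R B x b) has_derivative (\<lambda>h. r *\<^sub>R B' h b)) (at p)"
    by (intro derivative_intros der)
  then have "((\<lambda>x. B x (r *\<^sub>R b)) has_derivative (\<lambda>h. r *\<^sub>R B' h b)) (at p)"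
    by (rule has_derivative_transform_within_open[OF _ U]) (simp add: linear_scale[OF lin])
  from has_derivative_unique[OF this der]
  show "B' h (r *\<^sub>R b) = r *\<^sub>R B' h b" by metis
qed

text \<open>The product rule for applying a moving linear map to a moving vector. Expanding the
  vector in \<open>Basis\<close> reduces it to derivatives at fixed arguments, the form in which
  metrics and Christoffel symbols are given here.\<close>

lemma has_derivative_linear_family:
  fixes B :: "'a::real_normed_vector \<Rightarrow> 'b::euclidean_space \<Rightarrow> 'c::real_normed_vector"
  assumes U: "open U" "p \<in> U" and lin: "\<And>x. x \<in> U \<Longrightarrow> linear (B x)"
    and der: "\<And>b. ((\<lambda>x. B x b) has_derivative (\<lambda>h. B' h b)) (at p)"
    and v: "(v has_derivative v') (at p)"
  shows "((\<lambda>x. B x (v x)) has_derivative (\<lambda>h. B' h (v p) + B p (v' h))) (at p)"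
proof -
  have ex: "T w = (\<Sum>b\<in>Basis. (w \<bullet> b) *\<^sub>R T b)" if "linear T" for T :: "'b \<Rightarrow> 'c" and w
    using linear_sum[OF that, of "\<lambda>b. (w \<bullet> b) *\<^sub>R b" Basis]
    by (simp add: euclidean_representation linear_scale[OF that])
  have "((\<lambda>x. \<Sum>b\<in>Basis. (v x \<bullet> b) *\<^sub>R B x b) has_derivative
     (\<lambda>h. \<Sum>b\<in>Basis. (v p \<bullet> b) *\<^sub>R B' h b + (v' h \<bullet> b) *\<^sub>R B p b)) (at p)"
    by (intro has_derivative_sum has_derivative_scaleR has_derivative_inner_left v der)
  then have "((\<lambda>x. B x (v x)) has_derivative
     (\<lambda>h. \<Sum>b\<in>Basis. (v p \<bullet> b) *\<^sub>R B' h b + (v' h \<bullet> b) *\<^sub>R B p b)) (at p)"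
    by (rule has_derivative_transform_within_open[OF _ U]) (rule ex[OF lin, symmetric])
  moreover have "(\<lambda>h. \<Sum>b\<in>Basis. (v p \<bullet> b) *\<^sub>R B' h b + (v' h \<bullet> b) *\<^sub>R B p b) =
     (\<lambda>h. B' h (v p) + B p (v' h))"
  proof
    fix h
    have "linear (B' h)" by (rule derivative_of_linear_family[OF U lin der])
    from ex[OF this, of "v p"] ex[OF lin[OF U(2)], of "v' h"]
    show "(\<Sum>b\<in>Basis. (v p \<bullet> b) *\<^sub>R B' h b + (v' h \<bullet> b) *\<^sub>R B p b) = B' h (v p) + B p (v' h)"
      by (simp add: sum.distrib)
  qed
  ultimately show ?thesis by simp
qed

text \<open>The mean value theorem in direction \<open>b\<close>, applied to the difference of two
  parallel segments, followed by the first-order expansion of the directional derivative at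
  \<open>p\<close>.\<close>

lemma second_difference:
  fixes f :: "'a::real_normed_vector \<Rightarrow> real"
  assumes U: "open U" "p \<in> U" and f: "\<And>x. x \<in> U \<Longrightarrow> (f has_derivative f' x) (at x)"
    and Db: "((\<lambda>x. f' x b) has_derivative Db) (at p)" and e: "e > 0"
  shows "\<exists>d>0. \<forall>t. 0 < t \<and> t < d \<longrightarrow>
    \<bar>f (p + t *\<^sub>R a + t *\<^sub>R b) - f (p + t *\<^sub>R a) - f (p + t *\<^sub>R b) + f p - t\<^sup>2 * Db a\<bar> \<le> e * t\<^sup>2"
proof -
  \<comment> \<open>A bound for the displacements in the parallelogram of side \<open>t\<close>,
    divided by \<open>t\<close>; the summand 1 keeps it positive.\<close>
  define C where "C = norm a + norm b + 1"
  have C: "C > 0" unfolding C_def by (simp add: add_nonneg_pos)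
  \<comment> \<open>Two expansion errors, each at most \<open>e' * (t * C)\<close>, are to add up to
    \<open>e * t\<close>.\<close>
  define e' where "e' = e / (2 * C)"
  have e': "e' > 0" using e C by (simp add: e'_def)
  interpret Db: bounded_linear Db using Db by (rule has_derivative_bounded_linear)
  obtain d1 where d1: "d1 > 0" "\<And>y. norm (y - p) < d1 \<Longrightarrow>
      norm (f' y b - f' p b - Db (y - p)) \<le> e' * norm (y - p)"
    using Db e' unfolding has_derivative_at_alt by blast
  obtain d2 where d2: "d2 > 0" "ball p d2 \<subseteq> U" using U openE by blast
  define d where "d = min d1 d2 / C"
  have d: "d > 0" using d1 d2 C by (simp add: d_def)
  have bd: "norm (x *\<^sub>R a + s *\<^sub>R b) \<le> t * C" if "0 \<le> x" "x \<le> t" "0 \<le> s" "s \<le> t" for x s t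
  proof -
    have "norm (x *\<^sub>R a + s *\<^sub>R b) \<le> x * norm a + s * norm b"
      using norm_triangle_ineq[of "x *\<^sub>R a" "s *\<^sub>R b"] that by simp
    also have "\<dots> \<le> t * norm a + t * norm b"
      using that by (intro add_mono mult_right_mono) auto
    also have "\<dots> \<le> t * C" using that by (simp add: C_def algebra_simps)
    finally show ?thesis .
  qed
  show ?thesis
  proof (intro exI conjI allI impI)
    fix t assume t: "0 < t \<and> t < d"
    then have tC: "t * C < d1" "t * C < d2" using C unfolding d_def by (simp_all add: field_simps)
    have inU: "p + x *\<^sub>R a + s *\<^sub>R b \<in> U" if "0 \<le> x" "x \<le> t" "0 \<le> s" "s \<le> t" for x s
    proof -
      have dist_p: "dist p (p + z) = norm z" for z by (simp add: dist_norm)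
      have "dist p (p + (x *\<^sub>R a + s *\<^sub>R b)) < d2"
        using le_less_trans[OF bd[OF that] tC(2)] by (simp only: dist_p)
      then show ?thesis using d2(2) by (auto simp: add.assoc)
    qed
    define \<phi> where "\<phi> s = f (p + t *\<^sub>R a + s *\<^sub>R b) - f (p + s *\<^sub>R b)" for s
    have der: "((\<lambda>s. f (p + x *\<^sub>R a + s *\<^sub>R b)) has_real_derivative f' (p + x *\<^sub>R a + s *\<^sub>R b) b) (at s)"
      if "0 \<le> x" "x \<le> t" "0 \<le> s" "s \<le> t" for x s
    proof -
      have "((\<lambda>s. p + x *\<^sub>R a + s *\<^sub>R b) has_derivative (\<lambda>h. h *\<^sub>R b)) (at s)"
        by (auto intro!: derivative_eq_intros)
      from has_derivative_compose[OF this f[OF inU[OF that]]]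
      show ?thesis unfolding has_field_derivative_def
        by (rule has_derivative_eq_rhs)
          (simp add: fun_eq_iff linear_scale[OF has_derivative_linear[OF f[OF inU[OF that]]]])
    qed
    have "(\<phi> has_real_derivative f' (p + t *\<^sub>R a + s *\<^sub>R b) b - f' (p + s *\<^sub>R b) b) (at s)"
      if "0 \<le> s" "s \<le> t" for s
      unfolding \<phi>_def
      using DERIV_diff[OF der[of t s] der[of 0 s]] that t by simp
    then obtain s where s: "0 < s" "s < t"
      "\<phi> t - \<phi> 0 = (t - 0) * (f' (p + t *\<^sub>R a + s *\<^sub>R b) b - f' (p + s *\<^sub>R b) b)"
      using MVT2[of 0 t \<phi> "\<lambda>s. f' (p + t *\<^sub>R a + s *\<^sub>R b) b - f' (p + s *\<^sub>R b) b"] t by blast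
    have n1: "norm (t *\<^sub>R a + s *\<^sub>R b) \<le> t * C" "norm (0 *\<^sub>R a + s *\<^sub>R b) \<le> t * C"
      using s(1,2) t by (intro bd; simp)+
    have "\<bar>f' (p + t *\<^sub>R a + s *\<^sub>R b) b - f' p b - Db (t *\<^sub>R a + s *\<^sub>R b)\<bar> \<le> e' * norm (t *\<^sub>R a + s *\<^sub>R b)"
      using d1(2)[of "p + t *\<^sub>R a + s *\<^sub>R b"] n1 tC by (simp add: add.assoc)
    also have "\<dots> \<le> e' * (t * C)" using n1 e' by (intro mult_left_mono) auto
    finally have b1: "\<bar>f' (p + t *\<^sub>R a + s *\<^sub>R b) b - f' p b - Db (t *\<^sub>R a + s *\<^sub>R b)\<bar> \<le> e' * (t * C)" .
    have "\<bar>f' (p + s *\<^sub>R b) b - f' p b - Db (s *\<^sub>R b)\<bar> \<le> e' * norm (s *\<^sub>R b)"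
      using d1(2)[of "p + s *\<^sub>R b"] n1 tC by simp
    also have "\<dots> \<le> e' * (t * C)" using n1 e' by (intro mult_left_mono) auto
    finally have b2: "\<bar>f' (p + s *\<^sub>R b) b - f' p b - Db (s *\<^sub>R b)\<bar> \<le> e' * (t * C)" .
    have "Db (t *\<^sub>R a + s *\<^sub>R b) = t * Db a + Db (s *\<^sub>R b)"
      by (simp add: Db.add Db.scaleR)
    then have "\<bar>f' (p + t *\<^sub>R a + s *\<^sub>R b) b - f' (p + s *\<^sub>R b) b - t * Db a\<bar> \<le> 2 * (e' * (t * C))"
      using b1 b2 by linarith
    also have "\<dots> = e * t" using C by (simp add: e'_def)
    finally have "t * \<bar>f' (p + t *\<^sub>R a + s *\<^sub>R b) b - f' (p + s *\<^sub>R b) b - t * Db a\<bar> \<le> t * (e * t)"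
      using t by (intro mult_left_mono) auto
    moreover have "f (p + t *\<^sub>R a + t *\<^sub>R b) - f (p + t *\<^sub>R a) - f (p + t *\<^sub>R b) + f p - t\<^sup>2 * Db a =
      t * (f' (p + t *\<^sub>R a + s *\<^sub>R b) b - f' (p + s *\<^sub>R b) b - t * Db a)"
      using s(3) unfolding \<phi>_def by (simp add: algebra_simps power2_eq_square)
    ultimately show "\<bar>f (p + t *\<^sub>R a + t *\<^sub>R b) - f (p + t *\<^sub>R a) - f (p + t *\<^sub>R b) + f p - t\<^sup>2 * Db a\<bar> \<le> e * t\<^sup>2"
      using t by (simp add: abs_mult power2_eq_square mult_ac)
  qed (rule d)
qed

text \<open>The second difference is unchanged when \<open>a\<close> and \<open>b\<close> are
  exchanged, so both derivatives are its limit after division by the square of the side.\<close>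

lemma symmetric_derivative_real:
  fixes f :: "'a::real_normed_vector \<Rightarrow> real"
  assumes U: "open U" "p \<in> U" and f: "\<And>x. x \<in> U \<Longrightarrow> (f has_derivative f' x) (at x)"
    and Da: "((\<lambda>x. f' x a) has_derivative Da) (at p)"
    and Db: "((\<lambda>x. f' x b) has_derivative Db) (at p)"
  shows "Da b = Db a"
proof (rule ccontr)
  assume ne: "Da b \<noteq> Db a"
  \<comment> \<open>A third of the supposed gap, so that the two errors together stay below
    it.\<close>
  define e where "e = \<bar>Da b - Db a\<bar> / 3"
  have e: "e > 0" using ne by (simp add: e_def)
  obtain d1 where d1: "d1 > 0" "\<And>t. 0 < t \<and> t < d1 \<Longrightarrow>
    \<bar>f (p + t *\<^sub>R a + t *\<^sub>R b) - f (p + t *\<^sub>R a) - f (p + t *\<^sub>R b) + f p - t\<^sup>2 * Db a\<bar> \<le> e * t\<^sup>2"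
    using second_difference[OF U f Db e] by blast
  obtain d2 where d2: "d2 > 0" "\<And>t. 0 < t \<and> t < d2 \<Longrightarrow>
    \<bar>f (p + t *\<^sub>R b + t *\<^sub>R a) - f (p + t *\<^sub>R b) - f (p + t *\<^sub>R a) + f p - t\<^sup>2 * Da b\<bar> \<le> e * t\<^sup>2"
    using second_difference[OF U f Da e] by blast
  define t where "t = min d1 d2 / 2"
  have t: "0 < t" "t < d1" "t < d2" using d1 d2 by (auto simp: t_def)
  have sw: "p + t *\<^sub>R b + t *\<^sub>R a = p + t *\<^sub>R a + t *\<^sub>R b" by (simp add: add_ac)
  have "\<bar>t\<^sup>2 * Da b - t\<^sup>2 * Db a\<bar> \<le> 2 * (e * t\<^sup>2)"
    using d1(2)[of t] d2(2)[of t] t unfolding sw by linarith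
  moreover have "\<bar>t\<^sup>2 * Da b - t\<^sup>2 * Db a\<bar> = t\<^sup>2 * \<bar>Da b - Db a\<bar>"
    by (simp add: abs_mult flip: right_diff_distrib)
  ultimately have "t\<^sup>2 * \<bar>Da b - Db a\<bar> \<le> t\<^sup>2 * (2 * e)" by (simp add: mult_ac)
  then have "\<bar>Da b - Db a\<bar> \<le> 2 * e" using t by simp
  then show False using e unfolding e_def by simp
qed

lemma symmetric_derivative:
  fixes f :: "'a::real_normed_vector \<Rightarrow> 'b::euclidean_space"
  assumes U: "open U" "p \<in> U" and f: "\<And>x. x \<in> U \<Longrightarrow> (f has_derivative f' x) (at x)"
    and Da: "((\<lambda>x. f' x a) has_derivative Da) (at p)"
    and Db: "((\<lambda>x. f' x b) has_derivative Db) (at p)"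
  shows "Da b = Db a"
proof (rule euclidean_eqI)
  fix i :: 'b
  show "Da b \<bullet> i = Db a \<bullet> i"
    by (rule symmetric_derivative_real[OF U, of "\<lambda>x. f x \<bullet> i" "\<lambda>x h. f' x h \<bullet> i" a "\<lambda>h. Da h \<bullet> i" b "\<lambda>h. Db h \<bullet> i"])
      (auto intro!: has_derivative_inner_left f Da Db)
qed

lemma smooth_on_symmetric:
  fixes f :: "'a::euclidean_space \<Rightarrow> 'b::euclidean_space"
  assumes "open S" "smooth_on S f" "p \<in> S"
  shows "frechet_derivative (\<lambda>x. frechet_derivative f (at x) b) (at p) a =
    frechet_derivative (\<lambda>x. frechet_derivative f (at x) a) (at p) b"
  by (rule symmetric_derivative[OF assms(1,3), of f "\<lambda>x. frechet_derivative f (at x)"])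
    (use assms in \<open>auto intro!: smooth_on_has_derivative smooth_on_derivative\<close>)

lemma has_derivative_cdet:
  assumes V: "\<And>i. i < 4 \<Longrightarrow> ((\<lambda>x. V x i) has_derivative V' i) (at p)"
  shows "((\<lambda>x. cdet (V x)) has_derivative (\<lambda>h. \<Sum>i<4. cdet ((V p)(i := V' i h)))) (at p)"
proof -
  have nth: "((\<lambda>x. V x i $ k) has_derivative (\<lambda>h. V' i h $ k)) (at p)" if "i < 4" for i k
    by (rule bounded_linear.has_derivative[OF bounded_linear_vec_nth V[OF that]])
  have "((\<lambda>x. cdet (V x)) has_derivative (\<lambda>h. \<Sum>\<sigma> | \<sigma> permutes {..<4}. of_int (sign \<sigma>) *
      (\<Sum>i<4. V' i h $ xi (\<sigma> i) * (\<Prod>j\<in>{..<4}-{i}. V p j $ xi (\<sigma> j))))) (at p)"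
    unfolding cdet_def ndet_def
    by (intro has_derivative_sum has_derivative_mult_right has_derivative_prod nth) auto
  also have "(\<lambda>h. \<Sum>\<sigma> | \<sigma> permutes {..<4}. of_int (sign \<sigma>) *
      (\<Sum>i<4. V' i h $ xi (\<sigma> i) * (\<Prod>j\<in>{..<4}-{i}. V p j $ xi (\<sigma> j)))) =
    (\<lambda>h. \<Sum>i<4. cdet ((V p)(i := V' i h)))"
    unfolding sum_distrib_left by (subst sum.swap) (simp add: cdet_row)
  finally show ?thesis .
qed

lemma differentiable_cdet:
  assumes "\<And>i. i < 4 \<Longrightarrow> (\<lambda>x. V x i) differentiable (at p)"
  shows "(\<lambda>x. cdet (V x)) differentiable (at p)"
proof -
  have "((\<lambda>x. V x i) has_derivative (frechet_derivative (\<lambda>x. V x i) (at p))) (at p)" if "i < 4" for i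
    using assms[OF that] frechet_derivative_works by blast
  from has_derivative_cdet[of V, OF this] show ?thesis unfolding differentiable_def by blast
qed

lemma frechet_derivative_cong:
  assumes "open U" "x \<in> U" "\<And>y. y \<in> U \<Longrightarrow> f y = g y"
  shows "frechet_derivative f (at x) = frechet_derivative g (at x)"
proof -
  have "(f has_derivative D) (at x) \<longleftrightarrow> (g has_derivative D) (at x)" for D
    using has_derivative_transform_within_open[of f D x UNIV U g]
      has_derivative_transform_within_open[of g D x UNIV U f] assms by auto
  then show ?thesis unfolding frechet_derivative_def by simp
qed

section \<open>The Levi-Civita connection of a Kaehler metric\<close>

text \<open>For a unitary frame, the vectors \<open>u k\<close> and \<open>J (u k)\<close> form a
  real orthonormal basis, and the values of \<open>l\<close> on it are the coordinates of the
  representing vector.\<close>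

lemma (in hermitian) riesz:
  assumes "linear l"
  shows "\<exists>x. \<forall>w. G x w = (l w :: real)"
proof -
  obtain u where u: "unitary_frame G u" by (rule unitary_exists)
  have "G (\<Sum>k<4. l (u k) *\<^sub>R u k + l (J (u k)) *\<^sub>R J (u k)) w = l w" for w
  proof -
    have "l w = l (\<Sum>k<4. coord (u k) w *s u k)" using unitary_expand[OF u, of w] by simp
    also have "\<dots> = (\<Sum>k<4. G (u k) w * l (u k) + G (J (u k)) w * l (J (u k)))"
      by (simp add: linear_sum[OF assms] vec_cmul_eq linear_add[OF assms] linear_scale[OF assms] coord_def)
    also have "\<dots> = G (\<Sum>k<4. l (u k) *\<^sub>R u k + l (J (u k)) *\<^sub>R J (u k)) w"
      by (simp add: sum_left lin_simps mult.commute)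
    finally show ?thesis by simp
  qed
  then show ?thesis by blast
qed

locale kaehler_chart =
  fixes V :: "(complex^4) set" and G :: metric_field
  assumes open_V: "open V" and herm_V: "y \<in> V \<Longrightarrow> hermitian_inner (G y)"
    and smooth_V: "smooth_on V (\<lambda>y. G y v w)"
    and closed_V: "y \<in> V \<Longrightarrow> d_kform G y u v w = 0"
begin

lemma H: "y \<in> V \<Longrightarrow> hermitian (G y)"
  by (simp add: hermitian_def herm_V)

definition M :: "complex^4 \<Rightarrow> complex^4 \<Rightarrow> complex^4 \<Rightarrow> complex^4 \<Rightarrow> real" where
  "M y u v w = frechet_derivative (\<lambda>z. G z v w) (at y) u"

lemma G_der: "y \<in> V \<Longrightarrow> ((\<lambda>z. G z v w) has_derivative (\<lambda>h. M y h v w)) (at y)"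
  unfolding M_def by (rule smooth_on_has_derivative[OF smooth_V, THEN has_derivative_eq_rhs]) auto

lemma M_linear:
  assumes y: "y \<in> V"
  shows "linear (\<lambda>u. M y u v w)" "linear (\<lambda>v. M y u v w)" "linear (\<lambda>w. M y u v w)"
proof -
  show "linear (\<lambda>u. M y u v w)" by (rule has_derivative_linear[OF G_der[OF y]])
  show "linear (\<lambda>v. M y u v w)"
    by (rule derivative_of_linear_family[OF open_V y, of "\<lambda>z v. G z v w" "\<lambda>h v. M y h v w"])
      (use hermitian.lin_left[OF H] G_der[OF y] in auto)
  show "linear (\<lambda>w. M y u v w)"
    by (rule derivative_of_linear_family[OF open_V y, of "\<lambda>z w. G z v w" "\<lambda>h w. M y h v w"])
      (use hermitian.lin_right[OF H] G_der[OF y] in auto)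
qed

lemma M_sym: "y \<in> V \<Longrightarrow> M y u v w = M y u w v"
  unfolding M_def using frechet_derivative_cong[OF open_V, of y "\<lambda>z. G z v w" "\<lambda>z. G z w v"]
    hermitian.commute[OF H] by auto

lemma M_JJ: "y \<in> V \<Longrightarrow> M y u (J v) (J w) = M y u v w"
  unfolding M_def using frechet_derivative_cong[OF open_V, of y "\<lambda>z. G z (J v) (J w)" "\<lambda>z. G z v w"]
    hermitian.J_inv[OF H] by auto

lemma M_minus:
  assumes "y \<in> V"
  shows "M y u (- v) w = - M y u v w" "M y u v (- w) = - M y u v w" "M y (- u) v w = - M y u v w"
  using linear_neg[OF M_linear(1)[OF assms]] linear_neg[OF M_linear(2)[OF assms]]
    linear_neg[OF M_linear(3)[OF assms]] by auto

lemma M_J: "y \<in> V \<Longrightarrow> M y u v (J w) = - M y u (J v) w"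
  using M_JJ[of y u v "J w"] M_JJ[of y u "J v" w] by (simp add: M_minus)

lemma M_closed:
  assumes "y \<in> V"
  shows "M y u (J v) w + M y v (J w) u + M y w (J u) v = 0"
  using closed_V[OF assms, of u v w] unfolding d_kform_def kform_def M_def .

abbreviation "\<Gamma> \<equiv> christoffel G"

text \<open>Justifies the definite description: the Koszul formula prescribes all inner products of
  the connection, which yields existence through \<open>riesz\<close> and uniqueness at
  once.\<close>

lemma christoffel_props:
  assumes y: "y \<in> V"
  shows "bilinear (\<Gamma> y) \<and> (\<forall>v w. \<Gamma> y v w = \<Gamma> y w v) \<and>
     (\<forall>u v w. M y u v w = G y (\<Gamma> y u v) w + G y v (\<Gamma> y u w))" (is "?P (\<Gamma> y)")
proof -
  interpret hermitian "G y" by (rule H[OF y])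
  \<comment> \<open>Half of the right-hand side of the Koszul formula.\<close>
  define l where "l u v w = (M y u v w + M y v u w - M y w u v) / 2" for u v w
  note [simp] = linear_add[OF M_linear(1)[OF y]] linear_add[OF M_linear(2)[OF y]]
    linear_add[OF M_linear(3)[OF y]] linear_scale[OF M_linear(1)[OF y]]
    linear_scale[OF M_linear(2)[OF y]] linear_scale[OF M_linear(3)[OF y]]
  have "linear (l u v)" for u v
    by (rule linearI) (simp_all add: l_def field_simps)
  from riesz[OF this] have "\<exists>x. \<forall>w. G y x w = l u v w" for u v .
  then obtain X where X: "\<And>u v w. G y (X u v) w = l u v w" by metis
  have "?P X"
  proof (intro conjI allI)
    show "bilinear X"
      unfolding bilinear_def
      by (intro conjI allI linearI; rule eqI; simp add: lin_simps X; simp add: l_def field_simps)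
    show "X v w = X w v" for v w
      by (rule eqI) (simp add: X l_def M_sym[OF y, of _ v w])
    show "M y u v w = G y (X u v) w + G y v (X u w)" for u v w
      unfolding commute[of v "X u w"] X l_def
      using M_sym[OF y, of u v w] M_sym[OF y, of v u w] M_sym[OF y, of w u v] by (simp add: field_simps)
  qed
  moreover have "Y = X" if "?P Y" for Y
  proof (intro ext eqI)
    fix u v w
    have sym: "Y a b = Y b a" and c: "M y a b d = G y (Y a b) d + G y b (Y a d)" for a b d
      using that by blast+
    have "2 * G y (Y u v) w = M y u v w + M y v u w - M y w u v"
      unfolding c sym[of v u] sym[of w u] sym[of w v] by (simp add: commute)
    then show "G y (Y u v) w = G y (X u v) w" by (simp add: X l_def)
  qed
  ultimately have "(THE \<Gamma>. ?P \<Gamma>) = X"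
    by (intro the_equality) auto
  then have "\<Gamma> y = X" unfolding christoffel_def M_def .
  then show ?thesis using \<open>?P X\<close> by simp
qed

lemma \<Gamma>_sym: "y \<in> V \<Longrightarrow> \<Gamma> y v w = \<Gamma> y w v"
  and compat: "y \<in> V \<Longrightarrow> M y u v w = G y (\<Gamma> y u v) w + G y v (\<Gamma> y u w)"
  using christoffel_props by blast+

lemma \<Gamma>_linear: "y \<in> V \<Longrightarrow> linear (\<Gamma> y v)" "y \<in> V \<Longrightarrow> linear (\<lambda>v. \<Gamma> y v w)"
  using christoffel_props unfolding bilinear_def by blast+

lemma koszul:
  assumes y: "y \<in> V"
  shows "2 * G y (\<Gamma> y u v) w = M y u v w + M y v u w - M y w u v"
  unfolding compat[OF y] \<Gamma>_sym[OF y, of v u] \<Gamma>_sym[OF y, of w u] \<Gamma>_sym[OF y, of w v]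
  by (simp add: hermitian.commute[OF H[OF y]])

text \<open>Closedness of the Kaehler form, applied to \<open>(u, v, w)\<close> and \<open>(u, J v, J w)\<close>, makes \<open>J\<close> parallel.\<close>

lemma \<Gamma>_J:
  assumes y: "y \<in> V"
  shows "\<Gamma> y u (J v) = J (\<Gamma> y u v)"
proof -
  interpret hermitian "G y" by (rule H[OF y])
  show ?thesis
  proof (rule eqI)
    fix w
    have "2 * G y (\<Gamma> y u (J v)) w = M y u (J v) w + M y (J v) u w - M y w u (J v)"
      by (rule koszul[OF y])
    moreover have "2 * G y (\<Gamma> y u v) (J w) = M y u v (J w) + M y v u (J w) - M y (J w) u v"
      by (rule koszul[OF y])
    moreover have "G y (J (\<Gamma> y u v)) w = - G y (\<Gamma> y u v) (J w)" by (rule J_left)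
    moreover have "M y u (J v) w + M y v (J w) u + M y w (J u) v = 0"
      by (rule M_closed[OF y])
    moreover have "- M y u v (J w) - M y (J v) w u + M y (J w) u v = 0"
      using M_closed[OF y, of u "J v" "J w"] by (simp add: M_minus[OF y] M_JJ[OF y])
    moreover have "M y (J v) w u = M y (J v) u w" "M y v (J w) u = M y v u (J w)"
      by (rule M_sym[OF y])+
    moreover have "M y w u (J v) = - M y w (J u) v" "M y u v (J w) = - M y u (J v) w"
      by (rule M_J[OF y])+
    ultimately show "G y (\<Gamma> y u (J v)) w = G y (J (\<Gamma> y u v)) w" by linarith
  qed
qed

text \<open>Regularity of a vector field from that of its inner products with constant vectors.
  Inverting the Gram matrix by Cramer's rule writes the components as quotients of determinants with
  differentiable entries.\<close>

lemma musical_differentiable: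
  assumes p: "p \<in> V" and X: "\<And>w. (\<lambda>y. G y w (X y)) differentiable (at p)"
  shows "X differentiable (at p)"
proof -
  define c where "c y a x = Complex (G y a x) (G y (J a) x)" for y a x
  have c: "c y = hermitian.coord (G y)" if "y \<in> V" for y
    by (intro ext) (simp add: c_def hermitian.coord_def[OF H[OF that]])
  \<comment> \<open>\<open>m y\<close> holds the columns of the hermitian Gram matrix of the
    standard basis, and \<open>K y\<close> below is that matrix applied to
    \<open>X y\<close>.\<close>
  define m where "m y j = (\<Sum>k<4. c y (std k) (std j) *s std k)" for y and j :: nat
  define K where "K y = (\<Sum>k<4. c y (std k) (X y) *s std k)" for y
  \<comment> \<open>A kernel vector would be orthogonal to the standard basis, hence to
    itself.\<close>
  have det: "cdet (m y) \<noteq> 0" if y: "y \<in> V" for y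
  proof
    interpret hermitian "G y" by (rule H[OF y])
    assume "cdet (m y) = 0"
    then obtain z where z: "(\<Sum>j<4. z j *s m y j) = 0" "\<exists>k<4. z k \<noteq> 0"
      by (rule cdet_eq_zeroD)
    define x where "x = (\<Sum>j<4. z j *s std j)"
    have cx: "c y (std k) x = 0" if k: "k < 4" for k
    proof -
      have "(\<Sum>j<4. z j *s m y j) = (\<Sum>k<4. c y (std k) x *s std k)"
        unfolding m_def x_def c[OF y] coord_sum
        by (simp add: vec_eq_iff sum_component sum_distrib_left sum_distrib_right mult_ac)
          (intro allI sum.swap)
      then have "(\<Sum>k<4. c y (std k) x *s std k) $ xi k = 0" using z by simp
      then show ?thesis using sum_std_nth[OF k, of 4] k by simp
    qed
    have "G y (\<Sum>k<4. x $ xi k *s std k) x = 0"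
      using cx by (simp add: sum_left vec_cmul_eq lin_simps c_def complex_eq_iff)
    then have "x = 0" using pos[of x] std_expand[of x] by force
    then have "z k = 0" if "k < 4" for k
      using sum_std_nth[OF that, of 4 z] that unfolding x_def by simp
    then show False using z(2) by blast
  qed
  have eq: "X y = (\<Sum>j<4. (cdet ((m y)(j := K y)) / cdet (m y)) *s std j)" if y: "y \<in> V" for y
  proof -
    interpret hermitian "G y" by (rule H[OF y])
    have "K y = (\<Sum>k<4. c y (std k) (\<Sum>j<4. X y $ xi j *s std j) *s std k)"
      unfolding K_def using std_expand[of "X y"] by simp
    also have "\<dots> = (\<Sum>j<4. X y $ xi j *s m y j)"
      unfolding m_def c[OF y] coord_sum
      by (simp add: vec_eq_iff sum_component sum_distrib_left sum_distrib_right mult_ac)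
        (intro allI sum.swap)
    finally have "cdet ((m y)(j := K y)) = X y $ xi j * cdet (m y)" if "j < 4" for j
      by (rule cdet_replace[OF that])
    then have "(\<Sum>j<4. (cdet ((m y)(j := K y)) / cdet (m y)) *s std j) = (\<Sum>j<4. X y $ xi j *s std j)"
      using det[OF y] by (intro sum.cong) auto
    then show ?thesis using std_expand[of "X y"] by simp
  qed
  have bl: "bounded_linear (\<lambda>c::complex. c *s std j)" for j
    unfolding linear_conv_bounded_linear[symmetric]
    by (rule linearI) (simp_all add: vec_eq_iff algebra_simps)
  have vsum: "(\<lambda>y. \<Sum>j<4. a y j *s std j) differentiable (at p)"
    if "\<And>j. j < 4 \<Longrightarrow> (\<lambda>y. a y j) differentiable (at p)" for a :: "complex^4 \<Rightarrow> nat \<Rightarrow> complex"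
    using that by (intro differentiable_sum ballI)
      (auto intro: differentiable_compose[OF bounded_linear_imp_differentiable[OF bl]])
  have Cd: "(\<lambda>y. Complex (a y) (b y)) differentiable (at p)"
    if "a differentiable (at p)" "b differentiable (at p)" for a b :: "complex^4 \<Rightarrow> real"
    unfolding Complex_eq using that
    by (intro derivative_intros differentiable_compose[OF bounded_linear_imp_differentiable[OF bounded_linear_of_real]])
  have Gd: "(\<lambda>y. G y v w) differentiable (at p)" for v w
    using G_der[OF p] unfolding differentiable_def by blast
  have md: "(\<lambda>y. m y j) differentiable (at p)" for j
    unfolding m_def c_def by (intro vsum Cd Gd)
  have Kd: "K differentiable (at p)"
    unfolding K_def c_def by (intro vsum Cd X)
  have "(\<lambda>y. \<Sum>j<4. (cdet ((m y)(j := K y)) / cdet (m y)) *s std j) differentiable (at p)"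
  proof (rule vsum)
    fix j :: nat
    have "(\<lambda>y. ((m y)(j := K y)) i) differentiable (at p)" for i
      by (cases "i = j") (auto intro: md Kd)
    then show "(\<lambda>y. cdet ((m y)(j := K y)) / cdet (m y)) differentiable (at p)"
      using det[OF p] by (intro differentiable_divide differentiable_cdet md) auto
  qed
  then show ?thesis
    unfolding differentiable_def
    by (elim exE, intro exI) (rule has_derivative_transform_within_open[OF _ open_V p], assumption, simp add: eq)
qed

definition d\<Gamma> :: "complex^4 \<Rightarrow> complex^4 \<Rightarrow> complex^4 \<Rightarrow> complex^4 \<Rightarrow> complex^4" where
  "d\<Gamma> y a u v = frechet_derivative (\<lambda>z. \<Gamma> z u v) (at y) a"

text \<open>The Christoffel symbols are given by a definite description; the Koszul formula
  expresses their inner products by first derivatives of the metric, and these are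
  differentiable.\<close>

lemma \<Gamma>_der:
  assumes y: "y \<in> V"
  shows "((\<lambda>z. \<Gamma> z u v) has_derivative (\<lambda>h. d\<Gamma> y h u v)) (at y)"
proof -
  have M: "(\<lambda>z. M z a b c) differentiable (at y)" for a b c
    using smooth_on_has_derivative[OF smooth_on_derivative[OF smooth_V] y]
    unfolding M_def differentiable_def by blast
  have "(\<lambda>z. \<Gamma> z u v) differentiable (at y)"
  proof (rule musical_differentiable[OF y])
    fix w
    have "(\<lambda>z. (M z u v w + M z v u w - M z w u v) / 2) differentiable (at y)"
      by (intro derivative_intros M) auto
    then obtain D where D: "((\<lambda>z. (M z u v w + M z v u w - M z w u v) / 2) has_derivative D) (at y)"
      unfolding differentiable_def by blast
    have "((\<lambda>z. G z w (\<Gamma> z u v)) has_derivative D) (at y)"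
    proof (rule has_derivative_transform_within_open[OF D open_V y])
      fix z assume "z \<in> V"
      from koszul[OF this, of u v w] hermitian.commute[OF H[OF this], of w "\<Gamma> z u v"]
      show "(M z u v w + M z v u w - M z w u v) / 2 = G z w (\<Gamma> z u v)" by simp
    qed
    then show "(\<lambda>z. G z w (\<Gamma> z u v)) differentiable (at y)"
      unfolding differentiable_def by blast
  qed
  then show ?thesis unfolding d\<Gamma>_def by (simp add: frechet_derivative_works)
qed

lemma d\<Gamma>_linear:
  assumes y: "y \<in> V"
  shows "linear (\<lambda>a. d\<Gamma> y a u v)" "linear (\<lambda>u. d\<Gamma> y a u v)" "linear (\<lambda>v. d\<Gamma> y a u v)"
proof -
  show "linear (\<lambda>a. d\<Gamma> y a u v)" by (rule has_derivative_linear[OF \<Gamma>_der[OF y]])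
  show "linear (\<lambda>u. d\<Gamma> y a u v)"
    by (rule derivative_of_linear_family[OF open_V y, of "\<lambda>z u. \<Gamma> z u v" "\<lambda>h u. d\<Gamma> y h u v"])
      (use \<Gamma>_linear \<Gamma>_der[OF y] in auto)
  show "linear (\<lambda>v. d\<Gamma> y a u v)"
    by (rule derivative_of_linear_family[OF open_V y, of "\<lambda>z v. \<Gamma> z u v" "\<lambda>h v. d\<Gamma> y h u v"])
      (use \<Gamma>_linear \<Gamma>_der[OF y] in auto)
qed

lemma d\<Gamma>_sym: "y \<in> V \<Longrightarrow> d\<Gamma> y a u v = d\<Gamma> y a v u"
  unfolding d\<Gamma>_def using frechet_derivative_cong[OF open_V, of y "\<lambda>z. \<Gamma> z u v" "\<lambda>z. \<Gamma> z v u"]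
    \<Gamma>_sym by auto

lemma d\<Gamma>_J:
  assumes y: "y \<in> V"
  shows "d\<Gamma> y a u (J v) = J (d\<Gamma> y a u v)"
proof -
  have "((\<lambda>z. J (\<Gamma> z u v)) has_derivative (\<lambda>h. J (d\<Gamma> y h u v))) (at y)"
    using bounded_linear.has_derivative[OF _ \<Gamma>_der[OF y]] linear_J linear_conv_bounded_linear by blast
  then have "((\<lambda>z. \<Gamma> z u (J v)) has_derivative (\<lambda>h. J (d\<Gamma> y h u v))) (at y)"
    by (rule has_derivative_transform_within_open[OF _ open_V y]) (simp add: \<Gamma>_J)
  from has_derivative_unique[OF this \<Gamma>_der[OF y]] show ?thesis by metis
qed

section \<open>The Ricci form as a trace of the curvature\<close>

abbreviation "R \<equiv> curvature G"

lemma R_eq: "R y u v w = d\<Gamma> y u v w - d\<Gamma> y v u w + \<Gamma> y u (\<Gamma> y v w) - \<Gamma> y v (\<Gamma> y u w)"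
  unfolding curvature_def d\<Gamma>_def ..

lemma R_anti: "R y u v w = - R y v u w"
  by (simp add: R_eq)

lemma R_J: "y \<in> V \<Longrightarrow> R y u v (J w) = J (R y u v w)"
  by (simp add: R_eq d\<Gamma>_J \<Gamma>_J J_add J_diff)

lemma bianchi:
  assumes "y \<in> V"
  shows "R y u v w + R y v w u + R y w u v = 0"
  unfolding R_eq using d\<Gamma>_sym[OF assms, of u v w] d\<Gamma>_sym[OF assms, of v w u] d\<Gamma>_sym[OF assms, of w u v]
    \<Gamma>_sym[OF assms, of v w] \<Gamma>_sym[OF assms, of u w] \<Gamma>_sym[OF assms, of u v] by simp

lemma R_linear:
  assumes y: "y \<in> V"
  shows "linear (\<lambda>u. R y u v w)" "linear (\<lambda>w. R y u v w)"
proof -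
  note l = d\<Gamma>_linear[OF y] \<Gamma>_linear[OF y]
  show "linear (\<lambda>u. R y u v w)"
    unfolding R_eq
    by (intro linear_compose_add linear_compose_sub l linear_compose[OF l(5) l(4), unfolded comp_def])
  show "linear (\<lambda>w. R y u v w)"
    unfolding R_eq
    by (intro linear_compose_add linear_compose_sub l linear_compose[OF l(4) l(4), unfolded comp_def])
qed

lemma R_minus: "y \<in> V \<Longrightarrow> R y u (- v) w = - R y u v w"
  using linear_neg[OF R_linear(1), of y v u w] R_anti[of y u v w] R_anti[of y u "- v" w] by simp

text \<open>Differentiate the metric compatibility once more and use that second derivatives of the
  metric commute.\<close>

lemma R_skew:
  assumes y: "y \<in> V"
  shows "G y (R y u v w) x = - G y w (R y u v x)"
proof -
  interpret hermitian "G y" by (rule H[OF y])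
  have fam: "((\<lambda>z. G z (X z) a) has_derivative (\<lambda>h. M y h (X y) a + G y (X' h) a)) (at y)"
    if "(X has_derivative X') (at y)" for X X' a
    by (rule has_derivative_linear_family[OF open_V y, of "\<lambda>z b. G z b a" "\<lambda>h b. M y h b a"])
      (use hermitian.lin_left[OF H] G_der[OF y] that in auto)
  have "frechet_derivative (\<lambda>z. M z v w x) (at y) = (\<lambda>u. M y u (\<Gamma> y v w) x + G y (d\<Gamma> y u v w) x +
     (M y u (\<Gamma> y v x) w + G y (d\<Gamma> y u v x) w))" for v
  proof -
    have "frechet_derivative (\<lambda>z. M z v w x) (at y) =
        frechet_derivative (\<lambda>z. G z (\<Gamma> z v w) x + G z (\<Gamma> z v x) w) (at y)"
      by (rule frechet_derivative_cong[OF open_V y])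
        (simp add: compat hermitian.commute[OF H, of _ w])
    also have "\<dots> = (\<lambda>u. M y u (\<Gamma> y v w) x + G y (d\<Gamma> y u v w) x +
     (M y u (\<Gamma> y v x) w + G y (d\<Gamma> y u v x) w))"
      by (intro frechet_derivative_eq has_derivative_add fam \<Gamma>_der[OF y])
    finally show ?thesis .
  qed
  moreover have "frechet_derivative (\<lambda>z. M z v w x) (at y) u = frechet_derivative (\<lambda>z. M z u w x) (at y) v"
    unfolding M_def by (rule smooth_on_symmetric[OF open_V smooth_V y])
  ultimately have "M y u (\<Gamma> y v w) x + G y (d\<Gamma> y u v w) x + (M y u (\<Gamma> y v x) w + G y (d\<Gamma> y u v x) w) =
    M y v (\<Gamma> y u w) x + G y (d\<Gamma> y v u w) x + (M y v (\<Gamma> y u x) w + G y (d\<Gamma> y v u x) w)"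
    by simp
  then show ?thesis
    unfolding compat[OF y] R_eq lin_simps commute[of w "d\<Gamma> y u v x"] commute[of w "d\<Gamma> y v u x"]
      commute[of w "\<Gamma> y u (\<Gamma> y v x)"] commute[of w "\<Gamma> y v (\<Gamma> y u x)"]
    using commute[of "\<Gamma> y u x" "\<Gamma> y v w"] commute[of "\<Gamma> y v x" "\<Gamma> y u w"]
    by linarith
qed

text \<open>The classical consequence of four Bianchi identities and the two antisymmetries, as a
  linear combination.\<close>

lemma R_pair:
  assumes y: "y \<in> V"
  shows "G y (R y u v w) x = G y (R y w x u) v"
proof -
  interpret hermitian "G y" by (rule H[OF y])
  define K where "K u v w x = G y (R y u v w) x" for u v w x
  have 1: "K a b c d = - K b a c d" for a b c d
    unfolding K_def by (subst R_anti) (simp add: minus_left)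
  have 2: "K a b c d = - K a b d c" for a b c d
    unfolding K_def using R_skew[OF y, of a b c d] commute by simp
  have 3: "K a b c d + K b c a d + K c a b d = 0" for a b c d
    unfolding K_def add_left[symmetric] bianchi[OF y] by (rule zero_left)
  have "K u v w x = K w x u v"
    using 3[of u v w x] 3[of v w x u] 3[of w x u v] 3[of x u v w]
      2[of v w x u] 2[of w x v u] 2[of x u w v] 1[of u w x v] 2[of w u x v] 2[of u v x w]
      1[of v x u w] 2[of x v u w]
    by linarith
  then show ?thesis by (simp add: K_def)
qed

text \<open>Pair symmetry moves both copies of \<open>J\<close> out of the two-form slots; there one
  commutes with the curvature and the metric absorbs the two together.\<close>

lemma R_JJ:
  assumes y: "y \<in> V"
  shows "R y (J u) (J v) w = R y u v w"
proof -
  interpret hermitian "G y" by (rule H[OF y])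
  show ?thesis
  proof (rule eqI)
    fix x
    have "G y (R y (J u) (J v) w) x = G y (J (R y w x u)) (J v)"
      by (simp add: R_pair[OF y, of "J u"] R_J[OF y])
    also have "\<dots> = G y (R y u v w) x"
      by (simp only: J_inv R_pair[OF y, of u])
    finally show "G y (R y (J u) (J v) w) x = G y (R y u v w) x" .
  qed
qed

end

section \<open>Real and complex traces\<close>

lemma sum_Basis_complex4:
  "(\<Sum>b\<in>Basis. f (b::complex^4)) = (\<Sum>k<4. f (std k) + f (J (std k)))"
proof -
  have J: "J (axis i 1) = axis i \<i>" for i
    by (simp add: J_def vec_eq_iff axis_def)
  have B: "(Basis :: (complex^4) set) = (\<lambda>(i, c). axis i c) ` (UNIV \<times> {1, \<i>})"
    by (auto simp: Basis_vec_def Basis_complex_def)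
  have inj: "inj_on (\<lambda>(i, c). axis i c :: complex^4) (UNIV \<times> {1, \<i>})"
    by (auto simp: inj_on_def axis_eq_axis)
  have "(\<Sum>b\<in>Basis. f b) = (\<Sum>(i, c)\<in>UNIV \<times> {1, \<i>}. f (axis i c))"
    unfolding B by (subst sum.reindex[OF inj]) (simp add: case_prod_unfold)
  also have "\<dots> = (\<Sum>i\<in>UNIV. f (axis i 1) + f (axis i \<i>))"
    by (subst sum.cartesian_product[symmetric]) simp
  also have "\<dots> = (\<Sum>k<4. f (std k) + f (J (std k)))"
    unfolding std_def J by (rule sum_xi[symmetric])
  finally show ?thesis .
qed

definition rtrace :: "(complex^4 \<Rightarrow> complex^4) \<Rightarrow> real" where
  "rtrace T = (\<Sum>b\<in>Basis. T b \<bullet> b)"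

lemma inner_J: "J x \<bullet> J y = x \<bullet> y"
  by (simp add: J_def inner_vec_def inner_complex_def add.commute)

lemma inner_J_left: "J x \<bullet> y = - (x \<bullet> J y)"
  using inner_J[of x "J y"] by simp

text \<open>Since the inverse of \<open>J\<close> is \<open>- J\<close>, this is minus a conjugate
  of \<open>T\<close>.\<close>

lemma rtrace_J_conj:
  assumes "linear T"
  shows "rtrace (\<lambda>x. J (T (J x))) = - rtrace T"
  unfolding rtrace_def sum_Basis_complex4 inner_J_left
  by (simp add: sum_negf linear_neg[OF assms] algebra_simps sum_subtractf flip: sum.distrib)

lemma rtrace_ctrace:
  assumes "\<And>x. T (J x) = J (T x)"
  shows "rtrace T = 2 * Re (ctrace T)"
  unfolding rtrace_def sum_Basis_complex4 ctrace_def assms inner_J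
  by (simp add: std_def inner_axis sum_distrib_left inner_complex_def)

lemma rtrace_add: "rtrace (\<lambda>x. S x + T x) = rtrace S + rtrace T"
  and rtrace_minus: "rtrace (\<lambda>x. - T x) = - rtrace T"
  unfolding rtrace_def by (simp_all add: inner_left_distrib sum.distrib sum_negf)

text \<open>In a unitary frame the diagonal entries of a skew map are purely imaginary, and the real
  trace is twice the real part of the complex one.\<close>

lemma (in hermitian) rtrace_skew:
  assumes T: "linear T" "\<And>x. T (J x) = J (T x)" and skew: "\<And>v w. G (T v) w = - G v (T w)"
  shows "rtrace T = 0"
proof -
  obtain u where u: "unitary_frame G u" by (rule unitary_exists)
  have "ctrace T = (\<Sum>i<4. coord (u i) (T (u i)))"
    by (rule ctrace_replace[OF T unitary_cdet[OF u]]) (rule unitary_expand[OF u])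
  moreover have "Re (coord (u i) (T (u i))) = 0" for i
    using skew[of "u i" "u i"] commute[of "T (u i)" "u i"] by (simp add: coord_def)
  ultimately show ?thesis using rtrace_ctrace[of T] T(2) by simp
qed

context kaehler_chart
begin

lemma ricci_rtrace: "ricci G y v w = rtrace (\<lambda>x. R y x v w)"
  by (simp add: ricci_def rtrace_def)

text \<open>By the Bianchi identity the two sides differ by the trace of \<open>R y w v\<close>, a
  skew endomorphism. This argument suits a trace taken in the chart basis, which need not be
  orthonormal for \<open>G y\<close>.\<close>

lemma ricci_sym:
  assumes y: "y \<in> V"
  shows "ricci G y v w = ricci G y w v"
proof -
  have "rtrace (R y w v) = 0"
    by (rule hermitian.rtrace_skew[OF H[OF y]]) (rule R_linear R_J R_skew y)+
  moreover have "(\<lambda>x. R y x v w) = (\<lambda>x. R y x w v + R y w v x)"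
  proof
    fix x
    have "R y x v w + R y v w x + R y w x v = 0" by (rule bianchi[OF y])
    then show "R y x v w = R y x w v + R y w v x"
      using R_anti[of y v w x] R_anti[of y w x v] by (simp add: algebra_simps add_eq_0_iff)
  qed
  ultimately show ?thesis by (simp add: ricci_rtrace rtrace_add)
qed

text \<open>Put \<open>J\<close> into the first two curvature slots by \<open>R_JJ\<close>, pull
  another pair out of the endomorphism slot, and recognize a conjugation by \<open>J\<close> under
  the trace.\<close>

lemma ricci_JJ:
  assumes y: "y \<in> V"
  shows "ricci G y (J v) (J w) = ricci G y v w"
proof -
  have "ricci G y v w = rtrace (\<lambda>x. R y (J x) (J v) w)"
    by (simp add: ricci_rtrace R_JJ[OF y])
  also have "\<dots> = rtrace (\<lambda>x. - J (R y (J x) (J v) (J w)))"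
    by (simp add: R_J[OF y])
  also have "\<dots> = ricci G y (J v) (J w)"
    unfolding rtrace_minus using rtrace_J_conj[OF R_linear(1)[OF y], of "J v" "J w"]
    by (simp add: ricci_rtrace)
  finally show ?thesis by simp
qed

text \<open>The Bianchi identity replaces the trace over the first curvature slot by the trace of
  the endomorphism \<open>J (R y v w x)\<close>. The two Ricci terms coincide by antisymmetry of the
  Ricci form, and their factor 2 cancels the one in \<open>rtrace_ctrace\<close>.\<close>

lemma ricci_form_ctrace:
  assumes y: "y \<in> V"
  shows "ricci_form G y v w = Im (ctrace (R y v w))"
proof -
  have 1: "ricci G y w (J v) = - ricci G y v (J w)"
    using ricci_JJ[OF y, of "J v" w] ricci_sym[OF y, of w "J v"]
    by (simp add: ricci_rtrace R_minus[OF y] rtrace_minus)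
  have "(\<lambda>x. R y x v (J w)) = (\<lambda>x. - J (R y v w x) + R y x w (J v))"
  proof
    fix x
    have "R y x v w = - R y v w x + R y x w v"
      using bianchi[OF y, of x v w] R_anti[of y w x v] by (simp add: algebra_simps add_eq_0_iff)
    then show "R y x v (J w) = - J (R y v w x) + R y x w (J v)"
      by (simp add: R_J[OF y] J_diff)
  qed
  then have "ricci G y v (J w) = - rtrace (\<lambda>x. J (R y v w x)) + ricci G y w (J v)"
    by (simp only: ricci_rtrace rtrace_add rtrace_minus)
  then have "2 * ricci G y v (J w) = - rtrace (\<lambda>x. J (R y v w x))" using 1 by simp
  also have "\<dots> = - 2 * Re (ctrace (\<lambda>x. J (R y v w x)))"
    by (subst rtrace_ctrace) (simp_all add: R_J[OF y])
  also have "ctrace (\<lambda>x. J (R y v w x)) = \<i> * ctrace (R y v w)"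
    by (simp add: ctrace_def J_def sum_distrib_left)
  finally show ?thesis by (simp add: ricci_form_def)
qed

end

section \<open>Frames of a tangent space\<close>

definition rstd :: "nat \<Rightarrow> real^4" where "rstd i = axis (xi i) 1"

lemma rstd_expand: "x = (\<Sum>k<4. (x $ xi k) *\<^sub>R rstd k)"
proof -
  have "x = (\<Sum>k<4. (x $ xi k) *s rstd k)"
    unfolding rstd_def sum_xi[of "\<lambda>k. (x $ k) *s axis k 1"] by (simp add: basis_expansion)
  then show ?thesis by (simp add: scalar_mult_eq_scaleR)
qed

lemma rstd_nth: "i < 4 \<Longrightarrow> k < 4 \<Longrightarrow> rstd k $ xi i = (if i = k then 1 else 0)"
  by (auto simp: rstd_def axis_def xi_eq_iff)

lemma sum_rstd_nth:
  assumes "i < 4" "m \<le> 4"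
  shows "(\<Sum>k<m. c k *\<^sub>R rstd k) $ xi i = (if i < m then c i else 0)"
proof -
  have "(\<Sum>k<m. c k *\<^sub>R rstd k) $ xi i = (\<Sum>k<m. c k * rstd k $ xi i)"
    by (simp add: sum_component)
  also have "\<dots> = (\<Sum>k<m. if k = i then c k else 0)"
    by (rule sum.cong) (use assms in \<open>auto simp: rstd_nth\<close>)
  finally show ?thesis by simp
qed

definition rdet :: "(nat \<Rightarrow> real^4) \<Rightarrow> real" where "rdet a = ndet 4 (\<lambda>i k. a i $ xi k)"

text \<open>\<open>det\<close> sums over permutations of the type \<open>4\<close>; they are
  transported to permutations of \<open>{..<4}\<close> along the bijection
  \<open>xi\<close>.\<close>

lemma det_vector: "det (vector [a 0, a 1, a 2, a 3] :: real^4^4) = rdet a"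
proof -
  have bij: "bij_betw xi {..<4} UNIV"
    unfolding bij_betw_def
  proof
    show "inj_on xi {..<4}" by (rule inj_onI) (simp add: xi_eq_iff)
    show "xi ` {..<4} = UNIV" by (simp add: lessThan_4 UNIV_4)
  qed
  then have inj: "inj_on xi {..<4}" by (rule bij_betw_imp_inj_on)
  define A where "A = (vector [a 0, a 1, a 2, a 3] :: real^4^4)"
  have row: "A $ xi i = a i" if "i < 4" for i
  proof -
    have "i \<in> {0, 1, 2, 3}" using that by auto
    then show ?thesis by (auto simp: A_def vector_def)
  qed
  let ?m = "map_permutation {..<4} xi"
  have m: "(\<lambda>\<pi> x. if x \<in> UNIV then xi (\<pi> (inv_into {..<4} xi x)) else x) = ?m"
    using bij by (auto simp: fun_eq_iff map_permutation_def restrict_id_def bij_betw_def)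
  have "bij_betw ?m {\<pi>. \<pi> permutes {..<4}} {\<pi>. \<pi> permutes UNIV}"
    using bij_betw_permutations[OF bij] unfolding m .
  then have "det A =
    (\<Sum>\<sigma> | \<sigma> permutes {..<4}. of_int (sign (?m \<sigma>)) *
      (\<Prod>i\<in>UNIV. A $ i $ ?m \<sigma> i))"
    unfolding det_def by (rule sum.reindex_bij_betw[symmetric])
  also have "\<dots> = rdet a"
    unfolding rdet_def ndet_def
  proof (rule sum.cong[OF refl])
    fix \<sigma> assume \<sigma>: "\<sigma> \<in> {\<sigma>. \<sigma> permutes {..<4::nat}}"
    have "sign (?m \<sigma>) = sign \<sigma>" using \<sigma> inj by (intro sign_map_permutation) auto
    moreover have "(\<Prod>i\<in>UNIV. A $ i $ ?m \<sigma> i) =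
      (\<Prod>i<4. A $ xi i $ ?m \<sigma> (xi i))"
      by (rule prod.reindex_bij_betw[OF bij, symmetric])
    moreover have "\<dots> = (\<Prod>i<4. a i $ xi (\<sigma> i))"
      by (rule prod.cong[OF refl]) (simp add: row map_permutation_apply[OF inj])
    ultimately show "of_int (sign (?m \<sigma>)) *
      (\<Prod>i\<in>UNIV. A $ i $ ?m \<sigma> i) =
      of_int (sign \<sigma>) * (\<Prod>i<4. a i $ xi (\<sigma> i))" by simp
  qed
  finally show ?thesis by (simp only: A_def)
qed

lemma rdet_rstd: "rdet rstd = 1"
proof -
  have "rdet rstd = ndet 4 (\<lambda>i j. if i = j then 1 else 0)"
    unfolding rdet_def by (rule ndet_cong) (auto simp: rstd_nth)
  then show ?thesis by (simp add: ndet_one)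
qed

lemma rdet_minus: "rdet (a(0 := - a 0)) = - rdet a"
proof -
  have "rdet (a(0 := - a 0)) = ndet 4 ((\<lambda>i k. a i $ xi k)(0 := (\<lambda>k. - (a 0 $ xi k))))"
    unfolding rdet_def by (rule ndet_cong) auto
  also have "\<dots> = - ndet 4 ((\<lambda>i k. a i $ xi k)(0 := (\<lambda>k. a 0 $ xi k)))"
    by (simp add: ndet_row sum_negf)
  also have "(\<lambda>i k. a i $ xi k)(0 := (\<lambda>k. a 0 $ xi k)) = (\<lambda>i k. a i $ xi k)"
    by auto
  finally show ?thesis by (simp add: rdet_def)
qed

lemma of_real_cmul: "complex_of_real r *s x = r *\<^sub>R x" for x :: "complex^4"
  by (simp add: vec_cmul_eq)

lemma pos_frame_iff: "pos_frame G L a \<longleftrightarrow>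
    (\<forall>i<4. \<forall>j<4. G (L (a i)) (L (a j)) = (if i = j then 1 else 0)) \<and> rdet a > 0"
  unfolding pos_frame_def det_vector ..

locale tangent = hermitian G for G +
  fixes L :: "real^4 \<Rightarrow> complex^4"
  assumes L_lin: "linear L" and L_inj: "inj L"
begin

lemmas L_simps = linear_add[OF L_lin] linear_diff[OF L_lin] linear_neg[OF L_lin]
  linear_scale[OF L_lin] linear_0[OF L_lin] linear_sum[OF L_lin]

definition m :: "real^4 \<Rightarrow> real^4 \<Rightarrow> real" where "m a b = G (L a) (L b)"

lemma m_linear: "linear (m a)"
  by (rule linearI) (simp_all add: m_def L_simps(1,4) lin_simps)

lemma m_pos: "a \<noteq> 0 \<Longrightarrow> m a a > 0"
proof -
  assume "a \<noteq> 0"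
  then have "L a \<noteq> 0" using L_inj linear_0[OF L_lin] by (metis injD)
  then show ?thesis unfolding m_def by (rule pos)
qed

lemma m_commute: "m a b = m b a"
  unfolding m_def by (rule commute)

lemma m_scale: "m (r *\<^sub>R a) (s *\<^sub>R b) = r * s * m a b"
  by (simp add: m_def L_simps(4) lin_simps)

definition orthonormal :: "nat \<Rightarrow> (nat \<Rightarrow> real^4) \<Rightarrow> bool" where
  "orthonormal n a \<longleftrightarrow> (\<forall>i<n. \<forall>j<n. m (a i) (a j) = (if i = j then 1 else 0))"

lemma linear_rcoords: "linear (\<lambda>v. \<Sum>k<n. m (a k) v *\<^sub>R rstd k)"
  by (intro linear_compose_sum ballI linear_compose[OF m_linear, of "\<lambda>x. x *\<^sub>R _", unfolded comp_def]
      linearI) (simp_all add: scaleR_left_distrib)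

lemma linear_rcombination: "linear (\<lambda>x::real^4. \<Sum>k<4. (x $ xi k) *\<^sub>R (a k :: real^4))"
  by (intro linear_compose_sum ballI linearI) (simp_all add: scaleR_left_distrib)

lemma orthonormal_expand:
  assumes a: "orthonormal 4 a"
  shows "v = (\<Sum>k<4. m (a k) v *\<^sub>R a k)"
proof -
  let ?f = "\<lambda>v. \<Sum>k<4. m (a k) v *\<^sub>R rstd k"
  let ?g = "\<lambda>z::real^4. \<Sum>k<4. (z $ xi k) *\<^sub>R a k"
  have "m (a k) (?g z) = z $ xi k" if k: "k < 4" for k z
  proof -
    have "m (a k) (?g z) = (\<Sum>j<4. if k = j then z $ xi j else 0)"
      unfolding linear_sum[OF m_linear] linear_scale[OF m_linear]
      using k a by (intro sum.cong) (auto simp: orthonormal_def)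
    then show ?thesis using k by simp
  qed
  then have "?f (?g z) = z" for z
    using rstd_expand[of z] by simp
  then have "?f \<circ> ?g = id" by (simp add: fun_eq_iff)
  then have "?g \<circ> ?f = id"
    using linear_inverse_left[OF linear_rcoords linear_rcombination] by blast
  then have "?g (?f v) = v" by (simp add: fun_eq_iff)
  moreover have "?f v $ xi k = m (a k) v" if "k < 4" for k
    using sum_rstd_nth[OF that, of 4] that by simp
  ultimately show ?thesis by simp
qed

lemma orthonormal_extend:
  assumes "n < 4" "orthonormal n a"
  shows "\<exists>w. orthonormal (Suc n) (a(n := w))"
proof -
  let ?f = "\<lambda>v. \<Sum>k<n. m (a k) v *\<^sub>R rstd k"
  have "\<not> surj ?f"
  proof
    assume "surj ?f"
    then obtain v where "rstd n = ?f v" by (rule surjE)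
    then have "?f v $ xi n = 1" using assms(1) rstd_nth[of n n] by simp
    then show False using assms(1) sum_rstd_nth[of n n "\<lambda>k. m (a k) v"] by simp
  qed
  then have "\<not> inj ?f"
    using linear_injective_imp_surjective[OF linear_rcoords _ refl] by blast
  then obtain w where w: "?f w = 0" "w \<noteq> 0"
    by (auto simp: linear_injective_0[OF linear_rcoords])
  have z: "m (a k) w = 0" if "k < n" for k
    using sum_rstd_nth[of k n "\<lambda>k. m (a k) w"] assms(1) that w(1) by simp
  define w' where "w' = (1 / sqrt (m w w)) *\<^sub>R w"
  have "m w' w' = 1"
    using m_pos[OF w(2)] by (simp add: w'_def m_scale)
  moreover have "m (a k) w' = 0" "m w' (a k) = 0" if "k < n" for k
    using z[OF that] m_scale[of 1 "a k" "1 / sqrt (m w w)" w] m_commute[of w' "a k"]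
    by (auto simp: w'_def)
  ultimately show ?thesis
    using assms(2) by (intro exI[of _ w']) (auto simp: orthonormal_def less_Suc_eq)
qed

lemma orthonormal_rdet:
  assumes a: "orthonormal 4 a"
  shows "rdet a \<noteq> 0"
proof -
  have "rstd i $ xi j = (\<Sum>k<4. m (a k) (rstd i) * a k $ xi j)" for i j
    using arg_cong[OF orthonormal_expand[OF a, of "rstd i"], of "\<lambda>v. v $ xi j"]
    by (simp only: sum_component vector_scaleR_component real_scaleR_def)
  then have "rdet rstd = ndet 4 (\<lambda>i k. m (a k) (rstd i)) * rdet a"
    unfolding rdet_def ndet_mult[symmetric] by simp
  then show ?thesis using rdet_rstd by auto
qed

lemma pos_frame_orthonormal: "pos_frame G L a \<longleftrightarrow> orthonormal 4 a \<and> rdet a > 0"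
  by (simp add: pos_frame_iff orthonormal_def m_def)

text \<open>An orthonormal frame is built vector by vector; if its orientation is wrong, reversing
  the first vector repairs it.\<close>

lemma pos_frame_exists: obtains a where "pos_frame G L a"
proof -
  have "\<exists>a. orthonormal n a" if "n \<le> 4" for n
    using that
  proof (induction n)
    case 0
    then show ?case by (simp add: orthonormal_def)
  next
    case (Suc n)
    then show ?case using orthonormal_extend[of n] by fastforce
  qed
  from this[of 4] obtain a where a: "orthonormal 4 a" by auto
  show ?thesis
  proof (cases "rdet a > 0")
    case True
    then show ?thesis using a that pos_frame_orthonormal by blast
  next
    case False
    then have "rdet (a(0 := - a 0)) > 0" using orthonormal_rdet[OF a] by (simp add: rdet_minus)
    moreover have "m (- x) y = - m x y" "m x (- y) = - m x y" for x y
      by (simp_all add: m_def L_simps(3) lin_simps)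
    then have "orthonormal 4 (a(0 := - a 0))" using a by (auto simp: orthonormal_def)
    ultimately show ?thesis using that pos_frame_orthonormal by blast
  qed
qed

text \<open>The very choice made inside \<open>hodge2\<close> and \<open>mean_curvature\<close>, so
  that both can be folded to it.\<close>

definition the_frame :: "nat \<Rightarrow> real^4" where "the_frame = (SOME a. pos_frame G L a)"

lemma the_frame: "pos_frame G L the_frame"
  unfolding the_frame_def using pos_frame_exists by (metis someI)

lemma range_expand:
  assumes a: "orthonormal 4 a"
  shows "L v = (\<Sum>k<4. G (L (a k)) (L v) *\<^sub>R L (a k))"
  using arg_cong[OF orthonormal_expand[OF a, of v], of L] by (simp add: L_simps(4,6) m_def)

text \<open>Justifies the definite description \<open>proj\<close>: two candidates differ by a
  tangent vector that is orthogonal to itself.\<close>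

lemma proj_eq:
  assumes a: "orthonormal 4 a"
  shows "proj G (range L) w = (\<Sum>k<4. G (L (a k)) w *\<^sub>R L (a k))"
  unfolding proj_def
proof (rule the_equality)
  let ?t = "\<Sum>k<4. G (L (a k)) w *\<^sub>R L (a k)"
  have orth: "G (w - ?t) s = 0" if "s \<in> range L" for s
  proof -
    obtain v where s: "s = L v" using \<open>s \<in> range L\<close> by blast
    have "G ?t s = (\<Sum>k<4. G (L (a k)) w * G (L (a k)) s)"
      by (simp add: sum_left lin_simps)
    also have "\<dots> = G w (\<Sum>k<4. G (L (a k)) (L v) *\<^sub>R L (a k))"
      by (simp add: sum_right lin_simps s commute[of w] mult.commute)
    also have "\<dots> = G w s" by (simp only: s range_expand[OF a, symmetric])
    finally show ?thesis by (simp add: lin_simps)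
  qed
  have "?t = L (\<Sum>k<4. G (L (a k)) w *\<^sub>R a k)" by (simp add: L_simps(4,6))
  then show t: "?t \<in> range L \<and> (\<forall>s\<in>range L. G (w - ?t) s = 0)" using orth by blast
  fix t assume t': "t \<in> range L \<and> (\<forall>s\<in>range L. G (w - t) s = 0)"
  then obtain x y where xy: "t = L x" "?t = L y" using t by blast
  have "t - ?t \<in> range L" unfolding xy by (metis linear_diff[OF L_lin] rangeI)
  then have "G (w - ?t) (t - ?t) = 0" "G (w - t) (t - ?t) = 0" using orth t' by blast+
  then have "G (w - ?t) (t - ?t) - G (w - t) (t - ?t) = 0" by simp
  then have "G (t - ?t) (t - ?t) = 0" by (simp add: lin_simps)
  then show "t = ?t" using pos[of "t - ?t"] by force
qed

text \<open>A real change of frame changes \<open>cdet\<close> by a real factor, so its phase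
  depends only on the oriented tangent space.\<close>

lemma cdet_L: "cdet (\<lambda>i. L (a i)) = complex_of_real (rdet a) * cdet (\<lambda>i. L (rstd i))"
proof -
  have "L (a i) = (\<Sum>k<4. complex_of_real (a i $ xi k) *s L (rstd k))" for i
    unfolding of_real_cmul using arg_cong[OF rstd_expand[of "a i"], of L] by (simp add: L_simps(4,6))
  then have "cdet (\<lambda>i. L (a i)) = ndet 4 (\<lambda>i k. complex_of_real (a i $ xi k)) * cdet (\<lambda>i. L (rstd i))"
    by (intro cdet_expand)
  then show ?thesis by (simp add: rdet_def ndet_of_real)
qed

end

section \<open>The normalized form of a totally real tangent space\<close>

context hermitian
begin

lemma coord_cnj: "coord v u = cnj (coord u v)"
  using J_left[of u v] by (simp add: coord_def complex_eq_iff commute[of v u] commute[of "J v"])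

lemma coord_cmul_left: "coord (c *s u) v = cnj c * coord u v"
  using coord_cmul[of v c u] coord_cnj by (metis complex_cnj_mult)

lemma unitary_frame_iff:
  "unitary_frame G u \<longleftrightarrow> (\<forall>i<4. \<forall>j<4. coord (u i) (u j) = (if i = j then 1 else 0))"
  unfolding unitary_frame_def coord_def kform_def by (auto simp: complex_eq_iff)

text \<open>Being normalized makes no reference to a frame, so a form that has modulus 1 on one
  unitary frame has it on all of them.\<close>

lemma unitary_cmod:
  assumes "unitary_frame G u" "unitary_frame G u'"
  shows "cmod (cdet u) = cmod (cdet u')"
proof -
  have f: "form40 (\<lambda>v. (1 / cdet u) * cdet v)" by (rule form40_mult_cdet)
  have "normalized G (\<lambda>v. (1 / cdet u) * cdet v)"
    unfolding normalized_iff[OF assms(1) f] using unitary_cdet[OF assms(1)] by simp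
  then have "cmod ((1 / cdet u) * cdet u') = 1"
    using normalized_iff[OF assms(2) f] by simp
  then show ?thesis using unitary_cdet[OF assms(1)] by (simp add: norm_divide field_simps)
qed

text \<open>The modulus that the coefficient of a normalized form must have relative to
  \<open>cdet\<close>.\<close>

definition kappa :: real where "kappa = 1 / cmod (cdet (SOME u. unitary_frame G u))"

lemma kappa_eq: "unitary_frame G u \<Longrightarrow> kappa = 1 / cmod (cdet u)"
  unfolding kappa_def by (metis someI unitary_cmod)

lemma kappa_pos: "kappa > 0"
  using kappa_eq unitary_cdet unitary_exists by (metis zero_less_divide_1_iff zero_less_norm_iff)

text \<open>The Gram matrix is the coordinate matrix times its conjugate transpose. This gives
  access to \<open>kappa\<close> through the metric, without the choice of a unitary frame in its
  definition.\<close>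

lemma gram_det:
  "ndet 4 (\<lambda>i j. coord (v j) (v i)) = complex_of_real ((kappa * cmod (cdet v))\<^sup>2)"
proof -
  obtain u where u: "unitary_frame G u" by (rule unitary_exists)
  let ?z = "\<lambda>i k. coord (u k) (v i)"
  have "coord (v j) (v i) = (\<Sum>k<4. ?z i k * cnj (?z j k))" for i j
  proof -
    have "coord (v j) (v i) = coord (v j) (\<Sum>k<4. ?z i k *s u k)"
      using unitary_expand[OF u, of "v i"] by simp
    then show ?thesis unfolding coord_sum by (simp add: coord_cnj[of "v j"])
  qed
  then have "ndet 4 (\<lambda>i j. coord (v j) (v i)) = ndet 4 ?z * ndet 4 (\<lambda>k j. cnj (?z j k))"
    by (simp add: ndet_mult[symmetric])
  also have "ndet 4 (\<lambda>k j. cnj (?z j k)) = cnj (ndet 4 ?z)"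
    unfolding ndet_transpose[of 4 "\<lambda>j k. cnj (?z j k)"] by (rule ndet_cnj)
  also have "ndet 4 ?z * cnj (ndet 4 ?z) = complex_of_real ((cmod (ndet 4 ?z))\<^sup>2)"
    by (rule complex_norm_square[symmetric])
  also have "cdet v = ndet 4 ?z * cdet u"
    by (rule cdet_expand) (rule unitary_expand[OF u])
  then have "cmod (ndet 4 ?z) = kappa * cmod (cdet v)"
    using unitary_cdet[OF u] by (simp add: kappa_eq[OF u] norm_mult)
  finally show ?thesis .
qed

end

text \<open>Jacobi's formula at the identity matrix: the derivative in row \<open>i\<close>
  contributes only its diagonal entry, as any other entry would duplicate a row.\<close>

lemma has_derivative_ndet_one:
  fixes a :: "'x::real_normed_vector \<Rightarrow> nat \<Rightarrow> nat \<Rightarrow> 'c::real_normed_field"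
  assumes a: "\<And>i j. ((\<lambda>x. a x i j) has_derivative a' i j) (at p)"
    and p: "\<And>i j. i < n \<Longrightarrow> j < n \<Longrightarrow> a p i j = (if i = j then 1 else 0)"
  shows "((\<lambda>x. ndet n (a x)) has_derivative (\<lambda>h. \<Sum>i<n. a' i i h)) (at p)"
proof -
  have "((\<lambda>x. ndet n (a x)) has_derivative (\<lambda>h. \<Sum>\<sigma> | \<sigma> permutes {..<n}. of_int (sign \<sigma>) *
      (\<Sum>i<n. a' i (\<sigma> i) h * (\<Prod>j\<in>{..<n}-{i}. a p j (\<sigma> j))))) (at p)"
    unfolding ndet_def
    by (intro has_derivative_sum has_derivative_mult_right has_derivative_prod a)
  also have "(\<lambda>h. \<Sum>\<sigma> | \<sigma> permutes {..<n}. of_int (sign \<sigma>) *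
      (\<Sum>i<n. a' i (\<sigma> i) h * (\<Prod>j\<in>{..<n}-{i}. a p j (\<sigma> j)))) =
    (\<lambda>h. \<Sum>i<n. ndet n ((a p)(i := (\<lambda>k. a' i k h))))"
    unfolding sum_distrib_left by (subst sum.swap) (simp add: ndet_row)
  also have "\<dots> = (\<lambda>h. \<Sum>i<n. a' i i h)"
  proof (intro ext sum.cong refl)
    fix h i assume i: "i \<in> {..<n}"
    let ?I = "\<lambda>i j. if i = j then 1 else 0 :: 'c"
    have "ndet n ((a p)(i := (\<lambda>k. a' i k h))) =
        ndet n (?I(i := (\<lambda>k. \<Sum>j<n. a' i j h * ?I j k)))"
      by (rule ndet_cong) (auto simp: p if_distrib cong: if_cong)
    also have "\<dots> = (\<Sum>j<n. a' i j h * ndet n (?I(i := ?I j)))"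
      using i by (intro ndet_row_sum) auto
    also have "\<dots> = (\<Sum>j<n. if j = i then a' i i h else 0)"
    proof (rule sum.cong[OF refl])
      fix j assume j: "j \<in> {..<n}"
      have "ndet n (?I(i := ?I j)) = 0" if "j \<noteq> i"
        using i j that by (intro skew_eq_zero[OF skew_ndet, of i _ j]) auto
      moreover have "?I(i := ?I i) = ?I" by auto
      then have "ndet n (?I(i := ?I i)) = 1" by (simp only: ndet_one)
      ultimately show "a' i j h * ndet n (?I(i := ?I j)) = (if j = i then a' i i h else 0)" by auto
    qed
    finally show "ndet n ((a p)(i := (\<lambda>k. a' i k h))) = a' i i h" using i by simp
  qed
  finally show ?thesis .
qed

context kaehler_chart
begin

text \<open>At a unitary frame the Gram matrix is the identity, so its determinant has the trace of
  the differentiated entries as derivative. Metric compatibility turns this into twice Re tr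
  \<Gamma>, and the square root halves it.\<close>

lemma kappa_der:
  assumes y: "y \<in> V"
  shows "((\<lambda>z. hermitian.kappa (G z)) has_derivative
    (\<lambda>h. hermitian.kappa (G y) * Re (ctrace (\<Gamma> y h)))) (at y)"
proof -
  interpret hermitian "G y" by (rule H[OF y])
  obtain u where u: "unitary_frame (G y) u" by (rule unitary_exists)
  let ?a = "\<lambda>z i j. Complex (G z (u j) (u i)) (G z (J (u j)) (u i))"
  let ?a' = "\<lambda>i j h. Complex (M y h (u j) (u i)) (M y h (J (u j)) (u i))"
  have C: "((\<lambda>z. Complex (f z) (g z)) has_derivative (\<lambda>h. Complex (f' h) (g' h))) (at y)"
    if "(f has_derivative f') (at y)" "(g has_derivative g') (at y)"
    for f g :: "complex^4 \<Rightarrow> real" and f' g'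
    unfolding Complex_eq using that by (intro derivative_intros)
  have "((\<lambda>z. ndet 4 (?a z)) has_derivative (\<lambda>h. \<Sum>i<4. ?a' i i h)) (at y)"
  proof (rule has_derivative_ndet_one[where a = ?a and a' = ?a' and n = 4])
    show "((\<lambda>z. ?a z i j) has_derivative ?a' i j) (at y)" for i j
      by (intro C G_der[OF y])
    show "?a y i j = (if i = j then 1 else 0)" if "i < 4" "j < 4" for i j
      using coord_unitary[OF u that(2,1)] by (simp add: coord_def)
  qed
  then have "((\<lambda>z. Re (ndet 4 (?a z))) has_derivative (\<lambda>h. Re (\<Sum>i<4. ?a' i i h))) (at y)"
    by (rule has_derivative_Re)
  moreover have "Re (\<Sum>i<4. ?a' i i h) = 2 * Re (ctrace (\<Gamma> y h))" for h
  proof -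
    have "ctrace (\<Gamma> y h) = (\<Sum>i<4. coord (u i) (\<Gamma> y h (u i)))"
      by (rule ctrace_replace[OF \<Gamma>_linear(1)[OF y] \<Gamma>_J[OF y] unitary_cdet[OF u]])
        (rule unitary_expand[OF u])
    then show ?thesis
      by (simp add: compat[OF y] coord_def commute[of "\<Gamma> y h _"] sum_distrib_left)
  qed
  \<comment> \<open>The frame \<open>u\<close> is chosen unitary at \<open>y\<close> and kept fixed,
    so its Gram determinant at \<open>z\<close> compares \<open>kappa\<close> there with the value
    at \<open>y\<close>.\<close>
  moreover have "hermitian.kappa (G z) = sqrt (Re (ndet 4 (?a z))) * kappa" if z: "z \<in> V" for z
  proof -
    have "ndet 4 (?a z) = complex_of_real ((hermitian.kappa (G z) * cmod (cdet u))\<^sup>2)"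
      using hermitian.gram_det[OF H[OF z], of u] by (simp add: hermitian.coord_def[OF H[OF z]])
    then have "sqrt (Re (ndet 4 (?a z))) = hermitian.kappa (G z) * cmod (cdet u)"
      using hermitian.kappa_pos[OF H[OF z]] by simp
    then show ?thesis using unitary_cdet[OF u] by (simp add: kappa_eq[OF u])
  qed
  note kz = this
  have one: "Re (ndet 4 (?a y)) = 1"
  proof -
    have "sqrt (Re (ndet 4 (?a y))) * kappa = 1 * kappa" using kz[OF y] by simp
    then show ?thesis using kappa_pos by simp
  qed
  ultimately have d: "((\<lambda>z. Re (ndet 4 (?a z))) has_derivative (\<lambda>h. 2 * Re (ctrace (\<Gamma> y h)))) (at y)"
    by simp
  have "((\<lambda>z. sqrt (Re (ndet 4 (?a z))) * kappa) has_derivative (\<lambda>h. kappa * Re (ctrace (\<Gamma> y h)))) (at y)"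
    by (rule has_derivative_eq_rhs[OF has_derivative_mult_left[OF has_derivative_real_sqrt[OF _ d]]])
      (simp_all add: one mult.commute)
  then show ?thesis
    by (rule has_derivative_transform_within_open[OF _ open_V y]) (simp add: kz)
qed

end

context tangent
begin

text \<open>A (4,0)-form is a multiple of \<open>cdet\<close>; normalization fixes the modulus of
  the factor and positivity on the oriented tangent space fixes its phase.\<close>

lemma Omega_unique:
  assumes \<Delta>: "cdet (\<lambda>i. L (rstd i)) \<noteq> 0" (is "?\<Delta> \<noteq> 0")
  shows "(THE \<Omega>. form40 \<Omega> \<and> normalized G \<Omega> \<and>
      (\<forall>a. pos_frame G L a \<longrightarrow> (\<exists>r>0. \<Omega> (\<lambda>i. L (a i)) = complex_of_real r))) =
    (\<lambda>v. complex_of_real (kappa / cmod ?\<Delta>) * cnj ?\<Delta> * cdet v)"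
proof (rule the_equality)
  let ?c = "complex_of_real (kappa / cmod ?\<Delta>) * cnj ?\<Delta>"
  have sq: "?c * ?\<Delta> = complex_of_real (kappa * cmod ?\<Delta>)"
  proof -
    have "cnj ?\<Delta> * ?\<Delta> = complex_of_real ((cmod ?\<Delta>)\<^sup>2)"
      using complex_norm_square[of ?\<Delta>] by (simp add: mult.commute)
    then have "?c * ?\<Delta> = complex_of_real (kappa / cmod ?\<Delta> * (cmod ?\<Delta>)\<^sup>2)"
      by (simp only: mult.assoc of_real_mult)
    then show ?thesis using \<Delta> by (simp add: power2_eq_square)
  qed
  obtain u where u: "unitary_frame G u" by (rule unitary_exists)
  have f: "form40 (\<lambda>v. ?c * cdet v)" by (rule form40_mult_cdet)
  have cu: "cmod ?c = kappa" using kappa_pos \<Delta> by (simp add: norm_mult norm_divide)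
  show "form40 (\<lambda>v. ?c * cdet v) \<and> normalized G (\<lambda>v. ?c * cdet v) \<and>
    (\<forall>a. pos_frame G L a \<longrightarrow> (\<exists>r>0. ?c * cdet (\<lambda>i. L (a i)) = complex_of_real r))"
  proof (intro conjI allI impI f)
    show "normalized G (\<lambda>v. ?c * cdet v)"
      unfolding normalized_iff[OF u f] norm_mult[of ?c] cu using unitary_cdet[OF u] by (simp add: kappa_eq[OF u])
    fix a assume a: "pos_frame G L a"
    have "?c * cdet (\<lambda>i. L (a i)) = complex_of_real (rdet a * (kappa * cmod ?\<Delta>))"
      unfolding cdet_L[of a] of_real_mult[of "rdet a"] sq[symmetric] by (simp only: mult_ac)
    moreover have "rdet a * (kappa * cmod ?\<Delta>) > 0"
      using a kappa_pos \<Delta> by (simp add: pos_frame_orthonormal)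
    ultimately show "\<exists>r>0. ?c * cdet (\<lambda>i. L (a i)) = complex_of_real r" by blast
  qed
  fix \<Omega> assume \<Omega>: "form40 \<Omega> \<and> normalized G \<Omega> \<and>
      (\<forall>a. pos_frame G L a \<longrightarrow> (\<exists>r>0. \<Omega> (\<lambda>i. L (a i)) = complex_of_real r))"
  obtain a where a: "pos_frame G L a" by (rule pos_frame_exists)
  then have a0: "rdet a > 0" by (simp add: pos_frame_orthonormal)
  define d where "d = \<Omega> std"
  have \<Omega>_eq: "\<Omega> v = d * cdet v" for v unfolding d_def using \<Omega> by (intro form40_eq_cdet) simp
  obtain r where r: "r > 0" "d * cdet (\<lambda>i. L (a i)) = complex_of_real r" using \<Omega> a \<Omega>_eq by metis
  define s where "s = r / rdet a"
  have s: "s > 0" "d * ?\<Delta> = complex_of_real s"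
    using r a0 cdet_L[of a] by (auto simp: s_def field_simps)
  have "cmod (\<Omega> u) = 1" using \<Omega> normalized_iff[OF u] by blast
  then have "cmod d = kappa"
    unfolding \<Omega>_eq norm_mult kappa_eq[OF u] using unitary_cdet[OF u] by (simp add: field_simps)
  then have "kappa * cmod ?\<Delta> = s" using arg_cong[OF s(2), of cmod] s(1) by (simp add: norm_mult)
  then have "d * ?\<Delta> = ?c * ?\<Delta>" using s sq by simp
  then have "d = ?c" by (rule mult_right_cancel[OF \<Delta>, THEN iffD1])
  then show "\<Omega> = (\<lambda>v. ?c * cdet v)" using \<Omega>_eq by auto
qed

end

section \<open>The connection form along an immersion\<close>

lemma ctrace_comm:
  assumes "linear S" "\<And>x. S (J x) = J (S x)" "linear T" "\<And>x. T (J x) = J (T x)"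
  shows "ctrace (\<lambda>x. S (T x)) = ctrace (\<lambda>x. T (S x))"
proof -
  have *: "(A (B (std i))) $ xi i = (\<Sum>k<4. B (std i) $ xi k * A (std k) $ xi i)"
    if A: "linear A" "\<And>x. A (J x) = J (A x)" for A B :: "complex^4 \<Rightarrow> complex^4" and i
  proof -
    have "A (B (std i)) = A (\<Sum>k<4. B (std i) $ xi k *s std k)" by (simp only: std_expand[symmetric])
    also have "\<dots> = (\<Sum>k<4. B (std i) $ xi k *s A (std k))"
      by (simp only: linear_sum[OF A(1)] complex_linear_cmul[OF A])
    finally show ?thesis by (simp add: sum_component)
  qed
  show ?thesis
    unfolding ctrace_def *[OF assms(1,2)] *[OF assms(3,4)]
    by (subst sum.swap) (simp add: mult.commute)
qed

lemma ctrace_add: "ctrace (\<lambda>x. S x + T x) = ctrace S + ctrace T"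
  and ctrace_diff: "ctrace (\<lambda>x. S x - T x) = ctrace S - ctrace T"
  unfolding ctrace_def by (simp_all add: sum.distrib sum_subtractf)

locale immersion = kaehler_chart V G for V G +
  fixes D :: "(real^4) set" and f :: "real^4 \<Rightarrow> complex^4"
  assumes open_D: "open D" and smooth_f: "smooth_on D f"
    and f_V: "q \<in> D \<Longrightarrow> f q \<in> V" and f_inj: "q \<in> D \<Longrightarrow> inj (frechet_derivative f (at q))"
begin

abbreviation L :: "real^4 \<Rightarrow> real^4 \<Rightarrow> complex^4" where
  "L q \<equiv> frechet_derivative f (at q)"

definition DL :: "real^4 \<Rightarrow> real^4 \<Rightarrow> real^4 \<Rightarrow> complex^4" where
  "DL q a b = frechet_derivative (\<lambda>z. L z b) (at q) a"

lemma f_der: "q \<in> D \<Longrightarrow> (f has_derivative L q) (at q)"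
  by (rule smooth_on_has_derivative[OF smooth_f])

lemma L_linear: "q \<in> D \<Longrightarrow> linear (L q)"
  by (rule has_derivative_linear[OF f_der])

lemma L_der: "q \<in> D \<Longrightarrow> ((\<lambda>z. L z b) has_derivative (\<lambda>a. DL q a b)) (at q)"
  unfolding DL_def
  by (rule has_derivative_eq_rhs[OF smooth_on_has_derivative[OF smooth_on_derivative[OF smooth_f]]]) auto

lemma DL_sym: "q \<in> D \<Longrightarrow> DL q a b = DL q b a"
  unfolding DL_def by (rule smooth_on_symmetric[OF open_D smooth_f])

lemma DL_linear: "q \<in> D \<Longrightarrow> linear (DL q a)"
  by (rule derivative_of_linear_family[OF open_D, of q L "DL q"]) (use L_linear L_der in auto)

lemma DL_differentiable: "q \<in> D \<Longrightarrow> (\<lambda>z. DL z a b) differentiable (at q)"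
  unfolding DL_def differentiable_def
  using smooth_on_has_derivative[OF smooth_on_derivative[OF smooth_on_derivative[OF smooth_f]]] by blast

lemma tangent_at: "q \<in> D \<Longrightarrow> tangent (G (f q)) (L q)"
  unfolding tangent_def tangent_axioms_def using H f_V L_linear f_inj by blast

definition \<Delta> :: "real^4 \<Rightarrow> complex" where "\<Delta> q = cdet (\<lambda>i. L q (rstd i))"

definition d\<Delta> :: "real^4 \<Rightarrow> real^4 \<Rightarrow> complex" where
  "d\<Delta> q a = (\<Sum>i<4. cdet ((\<lambda>i. L q (rstd i))(i := DL q a (rstd i))))"

lemma \<Delta>_der: "q \<in> D \<Longrightarrow> (\<Delta> has_derivative d\<Delta> q) (at q)"
  unfolding \<Delta>_def[abs_def] d\<Delta>_def[abs_def] by (rule has_derivative_cdet) (rule L_der)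

lemma d\<Delta>_differentiable: "q \<in> D \<Longrightarrow> (\<lambda>z. d\<Delta> z a) differentiable (at q)"
proof -
  assume q: "q \<in> D"
  have L: "(\<lambda>z. L z b) differentiable (at q)" for b
    using L_der[OF q] unfolding differentiable_def by blast
  have "(\<lambda>z. ((\<lambda>i. L z (rstd i))(i := DL z a (rstd i))) j) differentiable (at q)" for i j
    by (cases "i = j") (auto intro: L DL_differentiable[OF q])
  then show ?thesis
    unfolding d\<Delta>_def by (intro differentiable_sum ballI differentiable_cdet) auto
qed

text \<open>An open set, so that formulas valid on it may be differentiated; totally real parameters
  lie in it by \<open>totally_real_cdet\<close>.\<close>

definition U :: "(real^4) set" where "U = {q \<in> D. \<Delta> q \<noteq> 0}"

lemma U_D: "q \<in> U \<Longrightarrow> q \<in> D" by (simp add: U_def)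

lemma open_U: "open U"
proof -
  have "continuous_on D \<Delta>"
    using \<Delta>_der has_derivative_continuous continuous_at_imp_continuous_on by blast
  then have "open (D \<inter> \<Delta> -` (- {0}))"
    by (rule continuous_open_preimage[OF _ open_D]) auto
  also have "D \<inter> \<Delta> -` (- {0}) = U" by (auto simp: U_def)
  finally show ?thesis .
qed

definition con :: "real^4 \<Rightarrow> complex" where
  "con q = complex_of_real (hermitian.kappa (G (f q)) / cmod (\<Delta> q)) * cnj (\<Delta> q)"

lemma Omega_N_eq:
  assumes "q \<in> U"
  shows "Omega_N G f q = (\<lambda>v. con q * cdet v)"
  using tangent.Omega_unique[OF tangent_at[OF U_D[OF assms]]] assms
  unfolding Omega_N_def Let_def con_def \<Delta>_def U_def by simp

text \<open>A logarithmic derivative. The factor \<open>kappa\<close> contributes Re tr \<Gamma>;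
  with w = d\<Delta> / \<Delta>, the phase contributes cnj w from the conjugate and - Re w from the
  modulus, together - i Im w.\<close>

lemma con_der:
  assumes q: "q \<in> U"
  shows "(con has_derivative (\<lambda>a. con q *
    (complex_of_real (Re (ctrace (\<Gamma> (f q) (L q a)))) - \<i> * complex_of_real (Im (d\<Delta> q a / \<Delta> q))))) (at q)"
proof -
  have qD: "q \<in> D" and nz: "\<Delta> q \<noteq> 0" using q by (auto simp: U_def)
  let ?k = "\<lambda>q. hermitian.kappa (G (f q))"
  define \<tau> where "\<tau> a = Re (ctrace (\<Gamma> (f q) (L q a)))" for a
  have k: "(?k has_derivative (\<lambda>a. ?k q * \<tau> a)) (at q)"
    using has_derivative_compose[OF f_der[OF qD] kappa_der[OF f_V[OF qD]]] by (simp add: \<tau>_def)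
  have n: "((\<lambda>q. cmod (\<Delta> q)) has_derivative (\<lambda>a. d\<Delta> q a \<bullet> sgn (\<Delta> q))) (at q)"
    using has_derivative_compose[OF \<Delta>_der[OF qD] has_derivative_norm[OF nz]] by (simp add: inner_commute)
  have c: "((\<lambda>q. cnj (\<Delta> q)) has_derivative (\<lambda>a. cnj (d\<Delta> q a))) (at q)"
    by (rule has_derivative_cnj[OF \<Delta>_der[OF qD]])
  have "(con has_derivative (\<lambda>a. complex_of_real (?k q / cmod (\<Delta> q)) * cnj (d\<Delta> q a) +
      complex_of_real ((?k q * \<tau> a * cmod (\<Delta> q) - ?k q * (d\<Delta> q a \<bullet> sgn (\<Delta> q))) / (cmod (\<Delta> q) * cmod (\<Delta> q)))
        * cnj (\<Delta> q))) (at q)"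
    unfolding con_def[abs_def] using nz
    by (intro has_derivative_mult has_derivative_of_real has_derivative_divide' k n c) auto
  moreover have "complex_of_real (?k q / cmod (\<Delta> q)) * cnj (d\<Delta> q a) +
      complex_of_real ((?k q * \<tau> a * cmod (\<Delta> q) - ?k q * (d\<Delta> q a \<bullet> sgn (\<Delta> q))) / (cmod (\<Delta> q) * cmod (\<Delta> q)))
        * cnj (\<Delta> q) =
    con q * (complex_of_real (\<tau> a) - \<i> * complex_of_real (Im (d\<Delta> q a / \<Delta> q)))" for a
  proof -
    let ?n = "complex_of_real (cmod (\<Delta> q))" and ?w = "d\<Delta> q a / \<Delta> q"
    have w: "d\<Delta> q a = ?w * \<Delta> q" using nz by simp
    have "d\<Delta> q a \<bullet> \<Delta> q = Re ?w * (cmod (\<Delta> q))\<^sup>2"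
    proof -
      have "(?w * \<Delta> q) \<bullet> \<Delta> q = Re ?w * (cmod (\<Delta> q))\<^sup>2"
        unfolding inner_complex_def cmod_power2 times_complex.sel
        by (simp add: algebra_simps power2_eq_square)
      then show ?thesis by (simp only: w[symmetric])
    qed
    then have i: "d\<Delta> q a \<bullet> sgn (\<Delta> q) = Re ?w * cmod (\<Delta> q)"
      using nz by (simp add: sgn_div_norm power2_eq_square)
    have cw: "cnj w = complex_of_real (Re w) - \<i> * complex_of_real (Im w)" for w
      by (simp add: complex_eq_iff)
    have cd: "cnj (d\<Delta> q a) = cnj ?w * cnj (\<Delta> q)" using nz by simp
    have r: "(?k q * \<tau> a * cmod (\<Delta> q) - ?k q * (Re ?w * cmod (\<Delta> q))) / (cmod (\<Delta> q) * cmod (\<Delta> q)) =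
      ?k q / cmod (\<Delta> q) * (\<tau> a - Re ?w)"
      using nz by (simp add: field_simps)
    have alg: "K * ((R - \<i> * I) * C) + K * (T - R) * C = K * C * (T - \<i> * I)"
      for K R I C T :: complex by (simp add: algebra_simps)
    show ?thesis
      unfolding i r cd cw[of ?w] con_def of_real_mult of_real_diff by (rule alg)
  qed
  ultimately show ?thesis by (simp add: \<tau>_def)
qed

text \<open>On any unitary frame \<Omega> has modulus 1; rotating the first vector by the conjugate
  phase makes the value 1.\<close>

lemma adapted_unitary:
  assumes q: "q \<in> U"
  shows "\<exists>u. unitary_frame (G (f q)) u \<and> Omega_N G f q u = 1"
proof -
  interpret tangent "G (f q)" "L q" by (rule tangent_at[OF U_D[OF q]])
  obtain u where u: "unitary_frame (G (f q)) u" by (rule unitary_exists)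
  define \<theta> where "\<theta> = con q * cdet u"
  have \<theta>: "cmod \<theta> = 1"
    using q unitary_cdet[OF u] by (simp add: \<theta>_def con_def norm_mult norm_divide kappa_eq[OF u] U_def)
  have \<theta>2: "cnj \<theta> * \<theta> = 1"
    using complex_norm_square[of \<theta>] \<theta> by (simp add: mult.commute)
  define u' where "u' = u(0 := cnj \<theta> *s u 0)"
  have "unitary_frame (G (f q)) u'"
    unfolding unitary_frame_iff
  proof (intro allI impI)
    fix i j :: nat assume "i < 4" "j < 4"
    then show "coord (u' i) (u' j) = (if i = j then 1 else 0)"
      using coord_unitary[OF u] \<theta>2 by (auto simp: u'_def coord_cmul coord_cmul_left mult.commute)
  qed
  moreover have "Omega_N G f q u' = 1"
  proof -
    have "cdet u' = cnj \<theta> * cdet u"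
      unfolding u'_def by (subst form40_cmul[OF form40_cdet]) auto
    then show ?thesis using \<theta>2 by (simp add: Omega_N_eq[OF q] \<theta>_def mult_ac)
  qed
  ultimately show ?thesis by blast
qed

text \<open>The chosen frame is a fixed argument of the moving form, so only the coefficient
  \<open>con\<close> is differentiated, while the connection terms sum to tr \<Gamma> by
  \<open>ctrace_cdet\<close>. The real parts of the two traces cancel, which leaves a real value
  whatever frame was chosen.\<close>

lemma gamma_eq:
  assumes q: "q \<in> U"
  shows "gamma_form G f q a =
    complex_of_real (Im (d\<Delta> q a / \<Delta> q) + Im (ctrace (\<Gamma> (f q) (L q a))))"
proof -
  have qD: "q \<in> D" by (rule U_D[OF q])
  define u where "u = (SOME u. unitary_frame (G (f q)) u \<and> Omega_N G f q u = 1)"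
  have "Omega_N G f q u = 1"
    using someI_ex[OF adapted_unitary[OF q]] unfolding u_def by blast
  then have u: "con q * cdet u = 1" by (simp add: Omega_N_eq[OF q])
  define \<tau> where "\<tau> = ctrace (\<Gamma> (f q) (L q a))"
  define w where "w = d\<Delta> q a / \<Delta> q"
  have "((\<lambda>z. con z * cdet u) has_derivative (\<lambda>a. con q *
    (complex_of_real (Re (ctrace (\<Gamma> (f q) (L q a)))) - \<i> * complex_of_real (Im (d\<Delta> q a / \<Delta> q))) * cdet u)) (at q)"
    by (rule has_derivative_mult_left[OF con_der[OF q]])
  then have "((\<lambda>z. Omega_N G f z u) has_derivative (\<lambda>a. con q *
    (complex_of_real (Re (ctrace (\<Gamma> (f q) (L q a)))) - \<i> * complex_of_real (Im (d\<Delta> q a / \<Delta> q))) * cdet u)) (at q)"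
    by (rule has_derivative_transform_within_open[OF _ open_U q]) (simp add: Omega_N_eq)
  then have "frechet_derivative (\<lambda>z. Omega_N G f z u) (at q) a =
    con q * (complex_of_real (Re \<tau>) - \<i> * complex_of_real (Im w)) * cdet u"
    by (simp add: frechet_derivative_eq \<tau>_def w_def)
  also have "\<dots> = (con q * cdet u) * (complex_of_real (Re \<tau>) - \<i> * complex_of_real (Im w))"
    by (simp only: mult_ac)
  finally have 1: "frechet_derivative (\<lambda>z. Omega_N G f z u) (at q) a =
    complex_of_real (Re \<tau>) - \<i> * complex_of_real (Im w)" by (simp add: u)
  have "(\<Sum>i<4. Omega_N G f q (u(i := \<Gamma> (f q) (L q a) (u i)))) =
    con q * (\<Sum>i<4. cdet (u(i := \<Gamma> (f q) (L q a) (u i))))"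
    by (simp add: Omega_N_eq[OF q] sum_distrib_left)
  also have "\<dots> = con q * (\<tau> * cdet u)"
    unfolding \<tau>_def
    by (subst ctrace_cdet[OF \<Gamma>_linear(1)[OF f_V[OF qD]] \<Gamma>_J[OF f_V[OF qD]]]) simp
  also have "\<dots> = \<tau>" using u by (simp add: mult_ac)
  finally have 2: "(\<Sum>i<4. Omega_N G f q (u(i := \<Gamma> (f q) (L q a) (u i)))) = \<tau>" .
  have "gamma_form G f q a = \<i> * (complex_of_real (Re \<tau>) - \<i> * complex_of_real (Im w) - \<tau>)"
    unfolding gamma_form_def nabla_form_def u_def[symmetric] 1 2 ..
  also have "\<dots> = complex_of_real (Im w + Im \<tau>)"
    by (simp add: complex_eq_iff)
  finally show ?thesis by (simp add: w_def \<tau>_def)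
qed

section \<open>The exterior derivative of the connection form\<close>

lemma ctrace_\<Gamma>_der:
  assumes q: "q \<in> D"
  shows "((\<lambda>z. ctrace (\<Gamma> (f z) (L z b))) has_derivative
    (\<lambda>a. ctrace (d\<Gamma> (f q) (L q a) (L q b)) + ctrace (\<Gamma> (f q) (DL q a b)))) (at q)"
proof -
  have "((\<lambda>z. \<Gamma> (f z) (L z b) x) has_derivative
      (\<lambda>a. d\<Gamma> (f q) (L q a) (L q b) x + \<Gamma> (f q) (DL q a b) x)) (at q)" for x
  proof (rule has_derivative_linear_family[OF open_D q, of "\<lambda>z w. \<Gamma> (f z) w x" "\<lambda>a w. d\<Gamma> (f q) (L q a) w x"])
    show "linear (\<lambda>w. \<Gamma> (f z) w x)" if "z \<in> D" for z by (rule \<Gamma>_linear(2)[OF f_V[OF that]])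
    show "((\<lambda>z. \<Gamma> (f z) w x) has_derivative (\<lambda>a. d\<Gamma> (f q) (L q a) w x)) (at q)" for w
      by (rule has_derivative_compose[OF f_der[OF q] \<Gamma>_der[OF f_V[OF q]]])
  qed (rule L_der[OF q])
  then have "((\<lambda>z. \<Sum>i<4. \<Gamma> (f z) (L z b) (std i) $ xi i) has_derivative
      (\<lambda>a. \<Sum>i<4. (d\<Gamma> (f q) (L q a) (L q b) (std i) + \<Gamma> (f q) (DL q a b) (std i)) $ xi i)) (at q)"
    by (intro has_derivative_sum bounded_linear.has_derivative[OF bounded_linear_vec_nth])
  then show ?thesis unfolding ctrace_def by (simp add: sum.distrib)
qed

text \<open>The quadratic part of the curvature is a commutator, so it has no trace.\<close>

lemma ctrace_R:
  assumes y: "y \<in> V"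
  shows "ctrace (R y u v) = ctrace (d\<Gamma> y u v) - ctrace (d\<Gamma> y v u)"
proof -
  have "ctrace (R y u v) = ctrace (\<lambda>w. d\<Gamma> y u v w - d\<Gamma> y v u w) +
    ctrace (\<lambda>w. \<Gamma> y u (\<Gamma> y v w)) - ctrace (\<lambda>w. \<Gamma> y v (\<Gamma> y u w))"
    unfolding ctrace_add[symmetric] ctrace_diff[symmetric] R_eq[abs_def] by (rule refl)
  also have "ctrace (\<lambda>w. \<Gamma> y u (\<Gamma> y v w)) = ctrace (\<lambda>w. \<Gamma> y v (\<Gamma> y u w))"
    by (rule ctrace_comm) (rule \<Gamma>_linear(1)[OF y] \<Gamma>_J[OF y])+
  finally show ?thesis by (simp add: ctrace_diff)
qed

text \<open>Antisymmetrizing removes the second derivatives of \<Delta> and of \<open>f\<close> and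
  the product of two derivatives of \<Delta>; the differentiated Christoffel symbols remain and give
  the trace of the curvature.\<close>

lemma gamma_ext_deriv:
  assumes p: "p \<in> U"
  shows "(\<lambda>q. gamma_form G f q b) differentiable (at p)"
    and "ext_deriv1 (gamma_form G f) p a b = complex_of_real (ricci_form G (f p) (L p a) (L p b))"
proof -
  have pD: "p \<in> D" and nz: "\<Delta> p \<noteq> 0" using p by (auto simp: U_def)
  define E where "E b = frechet_derivative (\<lambda>z. d\<Delta> z b) (at p)" for b
  have E: "((\<lambda>z. d\<Delta> z b) has_derivative E b) (at p)" for b
    using d\<Delta>_differentiable[OF pD] unfolding E_def frechet_derivative_works .
  have E_sym: "E a b = E b a" for a b
    by (rule symmetric_derivative[OF open_D pD \<Delta>_der E E])
  define X where "X a b = Im ((E b a * \<Delta> p - d\<Delta> p b * d\<Delta> p a) / (\<Delta> p * \<Delta> p)) +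
    Im (ctrace (d\<Gamma> (f p) (L p a) (L p b)) + ctrace (\<Gamma> (f p) (DL p a b)))" for a b
  have "((\<lambda>q. complex_of_real (Im (d\<Delta> q b / \<Delta> q) + Im (ctrace (\<Gamma> (f q) (L q b)))))
    has_derivative (\<lambda>a. complex_of_real (X a b))) (at p)" for b
    unfolding X_def
    by (intro has_derivative_of_real has_derivative_add has_derivative_Im has_derivative_divide' E
        \<Delta>_der[OF pD] nz ctrace_\<Gamma>_der[OF pD])
  then have der: "((\<lambda>q. gamma_form G f q b) has_derivative (\<lambda>a. complex_of_real (X a b))) (at p)" for b
    by (rule has_derivative_transform_within_open[OF _ open_U p]) (simp add: gamma_eq)
  then show "(\<lambda>q. gamma_form G f q b) differentiable (at p)"
    unfolding differentiable_def by blast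
  have "ext_deriv1 (gamma_form G f) p a b = complex_of_real (X a b - X b a)"
    unfolding ext_deriv1_def frechet_derivative_eq[OF der] by simp
  also have "X a b - X b a = Im (ctrace (R (f p) (L p a) (L p b)))"
    unfolding X_def ctrace_R[OF f_V[OF pD]] E_sym[of a b] DL_sym[OF pD, of a b]
    by (simp add: mult.commute)
  finally show "ext_deriv1 (gamma_form G f) p a b = complex_of_real (ricci_form G (f p) (L p a) (L p b))"
    by (simp add: ricci_form_ctrace[OF f_V[OF pD]])
qed

end

section \<open>Tangent spaces of Cayley submanifolds\<close>

lemma lessThan_small: "{..<1::nat} = {0}" "{..<Suc 0} = {0}" "{..<2::nat} = {0, 1}" "{..<3::nat} = {0, 1, 2}"
  by auto

lemma sum_permutes_4:
  fixes F :: "nat \<Rightarrow> nat \<Rightarrow> nat \<Rightarrow> nat \<Rightarrow> real"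
  shows "(\<Sum>\<sigma> | \<sigma> permutes {..<4::nat}. of_int (sign \<sigma>) * F (\<sigma> 0) (\<sigma> 1) (\<sigma> 2) (\<sigma> 3)) =
    F 0 1 2 3 - F 0 1 3 2 - F 0 2 1 3 + F 0 2 3 1 + F 0 3 1 2 - F 0 3 2 1 -
    F 1 0 2 3 + F 1 0 3 2 + F 1 2 0 3 - F 1 2 3 0 - F 1 3 0 2 + F 1 3 2 0 +
    F 2 0 1 3 - F 2 0 3 1 - F 2 1 0 3 + F 2 1 3 0 + F 2 3 0 1 - F 2 3 1 0 -
    F 3 0 1 2 + F 3 0 2 1 + F 3 1 0 2 - F 3 1 2 0 - F 3 2 0 1 + F 3 2 1 0"
  unfolding lessThan_4
  by (simp add: sum_over_permutations_insert permutes_sing sign_compose sign_swap_id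
      permutation_swap_id permutation_compose Transposition.transpose_def)

lemma volume_form_ndet: "volume_form G e v = ndet 4 (\<lambda>i j. G (e i) (v j))"
  by (simp add: volume_form_def ndet_def)

lemma (in hermitian) kform_skew: "kform G v w = - kform G w v"
  using J_left[of v w] commute[of v "J w"] by (simp add: kform_def)

context tangent
begin

text \<open>The product of two determinants of coordinates in the orthonormal frame
  \<open>a\<close>; the sum over \<open>a\<close> recombines to inner products because
  \<open>L (b s)\<close> is tangent.\<close>

lemma gram_volume:
  assumes a: "orthonormal 4 a"
  shows "volume_form G (\<lambda>i. L (a i)) (\<lambda>i. L (b i)) * volume_form G (\<lambda>i. L (a i)) v =
    ndet 4 (\<lambda>j s. G (v j) (L (b s)))"
proof -
  have "volume_form G (\<lambda>i. L (a i)) (\<lambda>i. L (b i)) * volume_form G (\<lambda>i. L (a i)) v =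
    ndet 4 (\<lambda>j i. G (L (a i)) (v j)) * ndet 4 (\<lambda>i s. G (L (a i)) (L (b s)))"
    unfolding volume_form_ndet using ndet_transpose[of 4 "\<lambda>i j. G (L (a i)) (v j)"] by simp
  also have "\<dots> = ndet 4 (\<lambda>j s. \<Sum>i<4. G (L (a i)) (v j) * G (L (a i)) (L (b s)))"
    by (rule ndet_mult[symmetric])
  also have "(\<lambda>j s. \<Sum>i<4. G (L (a i)) (v j) * G (L (a i)) (L (b s))) = (\<lambda>j s. G (v j) (L (b s)))"
  proof (intro ext)
    fix j s
    have "G (v j) (L (b s)) = G (v j) (\<Sum>i<4. G (L (a i)) (L (b s)) *\<^sub>R L (a i))"
      by (simp only: range_expand[OF a, symmetric])
    then show "(\<Sum>i<4. G (L (a i)) (v j) * G (L (a i)) (L (b s))) = G (v j) (L (b s))"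
      by (simp add: sum_right lin_simps commute[of "v j"] mult.commute)
  qed
  finally show ?thesis .
qed

text \<open>\<open>gram_volume\<close> determines the volume up to sign, and the positive
  orientation of \<open>b\<close> relative to \<open>a\<close> selects the sign.\<close>

lemma volume_pos:
  assumes a: "pos_frame G L a" and b: "rdet b > 0"
  shows "volume_form G (\<lambda>i. L (a i)) (\<lambda>i. L (b i)) = sqrt (ndet 4 (\<lambda>s t. G (L (b s)) (L (b t))))"
proof -
  let ?W = "volume_form G (\<lambda>i. L (a i)) (\<lambda>i. L (b i))"
  have a': "orthonormal 4 a" "rdet a > 0" using a by (auto simp: pos_frame_orthonormal)
  have "b s $ xi j = (\<Sum>k<4. m (a k) (b s) * a k $ xi j)" for s j
    using arg_cong[OF orthonormal_expand[OF a'(1), of "b s"], of "\<lambda>v. v $ xi j"]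
    by (simp only: sum_component vector_scaleR_component real_scaleR_def)
  then have "rdet b = ndet 4 (\<lambda>s k. m (a k) (b s)) * rdet a"
    unfolding rdet_def ndet_mult[symmetric] by simp
  also have "ndet 4 (\<lambda>s k. m (a k) (b s)) = ?W"
    unfolding volume_form_ndet m_def by (rule ndet_transpose)
  finally have "?W > 0" using a' b by (simp add: zero_less_mult_iff)
  moreover have "?W * ?W = ndet 4 (\<lambda>s t. G (L (b s)) (L (b t)))"
    by (rule gram_volume[OF a'(1)])
  ultimately show ?thesis by (metis abs_of_pos real_sqrt_mult_self real_sqrt_mult)
qed

lemma bilinear_expand:
  assumes a: "orthonormal 4 a" and B: "bilinear B"
  shows "(\<Sum>i<4. \<Sum>j<4. B (L (a i)) (L (a j)) * (G (L (a i)) (L x) * G (L (a j)) (L y))) =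
    (B (L x) (L y) :: real)"
proof -
  have lin: "linear (\<lambda>v. B v w)" "linear (B w)" for w using B unfolding bilinear_def by auto
  have "B (L x) (L y) = B (\<Sum>i<4. G (L (a i)) (L x) *\<^sub>R L (a i)) (\<Sum>j<4. G (L (a j)) (L y) *\<^sub>R L (a j))"
    by (simp only: range_expand[OF a, symmetric])
  also have "\<dots> = (\<Sum>i<4. G (L (a i)) (L x) * (\<Sum>j<4. G (L (a j)) (L y) * B (L (a i)) (L (a j))))"
    unfolding linear_sum[OF lin(1)] linear_scale[OF lin(1)]
    unfolding linear_sum[OF lin(2)] linear_scale[OF lin(2)] real_scaleR_def ..
  also have "\<dots> = (\<Sum>i<4. \<Sum>j<4. B (L (a i)) (L (a j)) * (G (L (a i)) (L x) * G (L (a j)) (L y)))"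
    by (simp add: sum_distrib_left mult_ac)
  finally show ?thesis by simp
qed

lemma bilinear_kform: "bilinear (kform G)"
  unfolding bilinear_def kform_def
  by (auto intro!: linearI simp: lin_simps J_add J_scaleR)

text \<open>
  Self-duality in an arbitrary positive frame, multiplied by the volume of the frame: all terms are
  polynomial in the Gram matrix and the Kaehler form, except for the square root of the Gram
  determinant.
\<close>

lemma cayley_frame:
  assumes cay: "cayley_at G L" and b: "rdet b > 0"
  shows "2 * sqrt (ndet 4 (\<lambda>s t. G (L (b s)) (L (b t)))) * kform G (L (b k)) (L (b l)) =
    (\<Sum>\<sigma> | \<sigma> permutes {..<4}. of_int (sign \<sigma>) * (kform G (L (b (\<sigma> 0))) (L (b (\<sigma> 1))) *
      G (L (b k)) (L (b (\<sigma> 2))) * G (L (b l)) (L (b (\<sigma> 3)))))"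
proof -
  define a where "a = the_frame"
  have a: "pos_frame G L a" unfolding a_def by (rule the_frame)
  then have o: "orthonormal 4 a" by (simp add: pos_frame_orthonormal)
  let ?e = "\<lambda>i. L (a i)"
  let ?W = "volume_form G ?e"
  let ?X = "\<lambda>i. L (b i)"
  let ?t = "\<lambda>\<sigma> i j. of_int (sign \<sigma>) *
      (kform G (?e i) (?e j) * (G (?e i) (?X (\<sigma> 0)) * G (?e j) (?X (\<sigma> 1))) *
        G (?X k) (?X (\<sigma> 2)) * G (?X l) (?X (\<sigma> 3)))"
  \<comment> \<open>A summand of the Hodge operator times the volume of \<open>b\<close>. The
    product of the two volumes is a polynomial in inner products by \<open>gram_volume\<close>,
    whereas a single volume would keep the frame \<open>a\<close> visible.\<close>
  define F where "F i j = kform G (?e i) (?e j) * (?W ?X * ?W ((!) [?e i, ?e j, ?X k, ?X l]))" for i j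
  have W: "?W ?X * ?W ((!) [?e i, ?e j, ?X k, ?X l]) = (\<Sum>\<sigma> | \<sigma> permutes {..<4}. of_int (sign \<sigma>) *
      (G (?e i) (?X (\<sigma> 0)) * G (?e j) (?X (\<sigma> 1)) * G (?X k) (?X (\<sigma> 2)) * G (?X l) (?X (\<sigma> 3))))" for i j
    unfolding gram_volume[OF o] ndet_def by (simp add: lessThan_4 mult.assoc)
  have F_sym: "F i j = F j i" for i j
  proof -
    have "?W ((!) [?e j, ?e i, ?X k, ?X l]) = - ?W ((!) [?e i, ?e j, ?X k, ?X l])"
    proof -
      let ?l = "(!) [?e i, ?e j, ?X k, ?X l]"
      have "?W ((!) [?e j, ?e i, ?X k, ?X l]) = ndet 4 (\<lambda>t s. G (?e s) ((!) [?e j, ?e i, ?X k, ?X l] t))"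
        unfolding volume_form_ndet by (rule ndet_transpose[symmetric])
      also have "\<dots> = ndet 4 ((\<lambda>t s. G (?e s) (?l t)) \<circ> Transposition.transpose 0 1)"
      proof (rule ndet_cong)
        fix t s :: nat assume "t < 4"
        then have "t \<in> {0, 1, 2, 3}" by auto
        then show "G (?e s) ((!) [?e j, ?e i, ?X k, ?X l] t) =
            ((\<lambda>t s. G (?e s) (?l t)) \<circ> Transposition.transpose 0 1) t s"
          by (auto simp: Transposition.transpose_def)
      qed
      also have "\<dots> = - ndet 4 (\<lambda>t s. G (?e s) (?l t))"
        by (rule skew_transpose[OF skew_ndet]) auto
      also have "ndet 4 (\<lambda>t s. G (?e s) (?l t)) = ?W ?l"
        unfolding volume_form_ndet by (rule ndet_transpose)
      finally show ?thesis .
    qed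
    then show ?thesis unfolding F_def by (subst kform_skew) simp
  qed
  have F_diag: "F i i = 0" for i
    unfolding F_def using kform_skew[of "?e i" "?e i"] by simp
  have "kform G (?X k) (?X l) = (\<Sum>j<4. \<Sum>i<j. kform G (?e i) (?e j) * ?W ((!) [?e i, ?e j, ?X k, ?X l]))"
  proof -
    have "kform G (?X k) (?X l) = hodge2 G L (kform G) (?X k) (?X l)"
      using cay unfolding cayley_at_def by blast
    then show ?thesis
      unfolding hodge2_def the_frame_def[symmetric] a_def[symmetric] Let_def comp_def .
  qed
  then have "?W ?X * kform G (?X k) (?X l) = (\<Sum>j<4. \<Sum>i<j. F i j)"
    unfolding F_def by (simp add: sum_distrib_left mult_ac)
  \<comment> \<open>Both \<open>kform\<close> and the volume change sign when \<open>i\<close> and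
    \<open>j\<close> are exchanged, so the sum over pairs is half of the full sum: this is the
    origin of the factor 2.\<close>
  moreover have "2 * (\<Sum>j<4. \<Sum>i<j. F i j) = (\<Sum>i<4. \<Sum>j<4. F i j)"
    using F_sym[of 0 1] F_sym[of 0 2] F_sym[of 0 3] F_sym[of 1 2] F_sym[of 1 3] F_sym[of 2 3]
    by (simp add: sum_lessThan_4 F_diag lessThan_small)
  ultimately have "2 * ?W ?X * kform G (?X k) (?X l) = (\<Sum>i<4. \<Sum>j<4. F i j)" by simp
  also have "\<dots> = (\<Sum>i<4. \<Sum>j<4. \<Sum>\<sigma> | \<sigma> permutes {..<4}. ?t \<sigma> i j)"
    unfolding F_def W by (simp add: sum_distrib_left mult_ac)
  also have "\<dots> = (\<Sum>i<4. \<Sum>\<sigma> | \<sigma> permutes {..<4}. \<Sum>j<4. ?t \<sigma> i j)"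
    by (rule sum.cong[OF refl], rule sum.swap)
  also have "\<dots> = (\<Sum>\<sigma> | \<sigma> permutes {..<4}. \<Sum>i<4. \<Sum>j<4. ?t \<sigma> i j)"
    by (rule sum.swap)
  also have "\<dots> = (\<Sum>\<sigma> | \<sigma> permutes {..<4}. of_int (sign \<sigma>) * (kform G (?X (\<sigma> 0)) (?X (\<sigma> 1)) *
      G (?X k) (?X (\<sigma> 2)) * G (?X l) (?X (\<sigma> 3))))"
  proof (rule sum.cong[OF refl])
    fix \<sigma> :: "nat \<Rightarrow> nat"
    \<comment> \<open>Summing over \<open>i\<close> and \<open>j\<close> restores
      \<open>kform\<close> on the vectors of \<open>b\<close>; with this the frame \<open>a\<close>
      disappears.\<close>
    have B: "kform G (?X (\<sigma> 0)) (?X (\<sigma> 1)) =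
        (\<Sum>i<4. \<Sum>j<4. kform G (?e i) (?e j) * (G (?e i) (?X (\<sigma> 0)) * G (?e j) (?X (\<sigma> 1))))"
      by (rule bilinear_expand[OF o bilinear_kform, symmetric])
    show "(\<Sum>i<4. \<Sum>j<4. ?t \<sigma> i j) =
      of_int (sign \<sigma>) * (kform G (?X (\<sigma> 0)) (?X (\<sigma> 1)) *
        G (?X k) (?X (\<sigma> 2)) * G (?X l) (?X (\<sigma> 3)))"
      unfolding B sum_distrib_left sum_distrib_right ..
  qed
  finally show ?thesis unfolding volume_pos[OF a b] .
qed

text \<open>\<open>cayley_frame\<close> in an orthonormal frame: only the two permutations ending in
  \<open>k\<close>, \<open>l\<close> survive, and they agree. The index pairs are ordered so that
  each pair and its complement form an even permutation.\<close>

lemma self_dual: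
  assumes cay: "cayley_at G L" and a: "pos_frame G L a"
  shows "kform G (L (a 2)) (L (a 3)) = kform G (L (a 0)) (L (a 1))"
    and "kform G (L (a 3)) (L (a 1)) = kform G (L (a 0)) (L (a 2))"
    and "kform G (L (a 1)) (L (a 2)) = kform G (L (a 0)) (L (a 3))"
proof -
  have o: "\<And>i j. i < 4 \<Longrightarrow> j < 4 \<Longrightarrow> G (L (a i)) (L (a j)) = (if i = j then 1 else 0)"
    and r: "rdet a > 0" using a by (auto simp: pos_frame_orthonormal orthonormal_def m_def)
  have "ndet 4 (\<lambda>s t. G (L (a s)) (L (a t))) = ndet 4 (\<lambda>s t. if s = t then 1 else 0)"
    by (rule ndet_cong) (rule o)
  then have one: "ndet 4 (\<lambda>s t. G (L (a s)) (L (a t))) = 1" by (simp add: ndet_one)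
  note id = cayley_frame[OF cay r, unfolded one]
  note ex = sum_permutes_4[of "\<lambda>s t u v. kform G (L (a s)) (L (a t)) * G (L (a k)) (L (a u)) * G (L (a l)) (L (a v))" for k l]
  show "kform G (L (a 2)) (L (a 3)) = kform G (L (a 0)) (L (a 1))"
    using id[of 2 3] unfolding ex using kform_skew[of "L (a 1)" "L (a 0)"] by (simp add: o)
  show "kform G (L (a 3)) (L (a 1)) = kform G (L (a 0)) (L (a 2))"
    using id[of 3 1] unfolding ex using kform_skew[of "L (a 2)" "L (a 0)"] by (simp add: o)
  show "kform G (L (a 1)) (L (a 2)) = kform G (L (a 0)) (L (a 3))"
    using id[of 1 2] unfolding ex using kform_skew[of "L (a 3)" "L (a 0)"] by (simp add: o)
qed

section \<open>The tangential part of \<open>J\<close> and the function \<lambda>\<close>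

definition P :: "complex^4 \<Rightarrow> complex^4" where "P = proj G (range L)"

lemma P_eq: "orthonormal 4 a \<Longrightarrow> P w = (\<Sum>k<4. G (L (a k)) w *\<^sub>R L (a k))"
  unfolding P_def by (rule proj_eq)

lemma frame_orthonormal: "orthonormal 4 the_frame"
  using the_frame pos_frame_orthonormal by blast

lemma P_linear: "linear P"
  unfolding P_eq[OF frame_orthonormal, abs_def]
  by (rule linearI) (simp_all add: lin_simps scaleR_add_left sum.distrib scaleR_sum_right)

lemma P_range: "P w \<in> range L"
proof -
  have "P w = L (\<Sum>k<4. G (L (the_frame k)) w *\<^sub>R the_frame k)"
    unfolding P_eq[OF frame_orthonormal] by (simp add: L_simps(4,6))
  then show ?thesis by simp
qed

lemma P_L: "P (L v) = L v"
  unfolding P_eq[OF frame_orthonormal] by (rule range_expand[OF frame_orthonormal, symmetric])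

lemma P_G: "G (P w) (L v) = G w (L v)"
proof -
  have "G w (L v) = G w (\<Sum>k<4. G (L (the_frame k)) (L v) *\<^sub>R L (the_frame k))"
    by (simp only: range_expand[OF frame_orthonormal, symmetric])
  also have "\<dots> = G (P w) (L v)"
    unfolding P_eq[OF frame_orthonormal]
    by (simp add: sum_right sum_left lin_simps commute[of w] mult.commute)
  finally show ?thesis by simp
qed

text \<open>This is \<lambda>^2. By self-duality the first row of the matrix of \<open>kform\<close>
  determines the whole matrix.\<close>

definition lam2 :: real where
  "lam2 = (kform G (L (the_frame 0)) (L (the_frame 1)))\<^sup>2 + (kform G (L (the_frame 0)) (L (the_frame 2)))\<^sup>2 +
    (kform G (L (the_frame 0)) (L (the_frame 3)))\<^sup>2"

text \<open>In a positive orthonormal frame, the matrix of a self-dual form is that of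
  multiplication by an imaginary quaternion, whose square is minus its squared norm.\<close>

lemma P_J_sq:
  assumes cay: "cayley_at G L"
  shows "P (J (P (J (L v)))) = - (lam2 *\<^sub>R L v)"
proof -
  let ?X = "\<lambda>i. L (the_frame i)"
  define \<alpha> where "\<alpha> i j = kform G (?X i) (?X j)" for i j
  have skew: "\<alpha> i j = - \<alpha> j i" for i j unfolding \<alpha>_def by (rule kform_skew)
  have diag: "\<alpha> i i = 0" for i using skew[of i i] by simp
  note sd = self_dual[OF cay the_frame, folded \<alpha>_def]
  have PJ: "P (J (?X i)) = (\<Sum>k<4. \<alpha> i k *\<^sub>R ?X k)" for i
    unfolding P_eq[OF frame_orthonormal] \<alpha>_def kform_def by (simp add: commute)
  have "P (J (P (J (?X i)))) = - (lam2 *\<^sub>R ?X i)" if i: "i < 4" for i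
  proof -
    have "P (J (P (J (?X i)))) = (\<Sum>k<4. \<alpha> i k *\<^sub>R (\<Sum>l<4. \<alpha> k l *\<^sub>R ?X l))"
      unfolding PJ[of i] J_sum J_scaleR linear_sum[OF P_linear] linear_scale[OF P_linear] PJ ..
    also have "\<dots> = (\<Sum>l<4. (\<Sum>k<4. \<alpha> i k * \<alpha> k l) *\<^sub>R ?X l)"
      by (simp only: scaleR_sum_right scaleR_scaleR scaleR_sum_left) (rule sum.swap)
    also have "\<dots> = (\<Sum>l<4. (if l = i then - lam2 else 0) *\<^sub>R ?X l)"
    proof (intro sum.cong refl arg_cong2[of _ _ _ _ scaleR])
      fix l :: nat assume "l \<in> {..<4}"
      then have "l \<in> {0, 1, 2, 3}" "i \<in> {0, 1, 2, 3}" using i by auto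
      then show "(\<Sum>k<4. \<alpha> i k * \<alpha> k l) = (if l = i then - lam2 else 0)"
        using sd skew[of 1 0] skew[of 2 0] skew[of 3 0] skew[of 2 1] skew[of 3 2] skew[of 1 3]
        by (auto simp: sum_lessThan_4 diag lam2_def \<alpha>_def[symmetric] power2_eq_square algebra_simps)
    qed
    also have "\<dots> = (\<Sum>l<4. if l = i then - (lam2 *\<^sub>R ?X i) else 0)"
      by (rule sum.cong) auto
    finally show ?thesis using i by simp
  qed
  then have fr: "(\<Sum>k<4. c k *\<^sub>R P (J (P (J (?X k))))) = (\<Sum>k<4. c k *\<^sub>R - (lam2 *\<^sub>R ?X k))" for c
    by (intro sum.cong) auto
  have "P (J (P (J (L v)))) = P (J (P (J (\<Sum>k<4. G (?X k) (L v) *\<^sub>R ?X k))))"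
    by (simp only: range_expand[OF frame_orthonormal, symmetric])
  also have "\<dots> = (\<Sum>k<4. G (?X k) (L v) *\<^sub>R P (J (P (J (?X k)))))"
    by (simp only: J_sum J_scaleR linear_sum[OF P_linear] linear_scale[OF P_linear])
  also have "\<dots> = - (lam2 *\<^sub>R (\<Sum>k<4. G (?X k) (L v) *\<^sub>R ?X k))"
    unfolding fr by (simp add: sum_negf scaleR_sum_right mult.commute)
  also have "(\<Sum>k<4. G (?X k) (L v) *\<^sub>R ?X k) = L v"
    by (rule range_expand[OF frame_orthonormal, symmetric])
  finally show ?thesis .
qed

text \<open>Justifies the definite description \<open>cayley_lambda\<close>; uniqueness is tested on
  one nonzero tangent vector.\<close>

lemma cayley_lambda_sq:
  assumes cay: "cayley_at G L"
  shows "(cayley_lambda G L)\<^sup>2 = lam2"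
proof -
  have nn: "lam2 \<ge> 0" by (simp add: lam2_def)
  have "cayley_lambda G L = (THE l. l \<ge> 0 \<and> (\<forall>v\<in>range L. P (J (P (J v))) = - (l\<^sup>2 *\<^sub>R v)))"
    unfolding cayley_lambda_def Let_def P_def ..
  also have "\<dots> = sqrt lam2"
  proof (rule the_equality)
    show "sqrt lam2 \<ge> 0 \<and> (\<forall>v\<in>range L. P (J (P (J v))) = - ((sqrt lam2)\<^sup>2 *\<^sub>R v))"
      using P_J_sq[OF cay] nn by auto
    fix l assume l: "l \<ge> 0 \<and> (\<forall>v\<in>range L. P (J (P (J v))) = - (l\<^sup>2 *\<^sub>R v))"
    have "l\<^sup>2 *\<^sub>R L (rstd 0) = lam2 *\<^sub>R L (rstd 0)"
      using l P_J_sq[OF cay, of "rstd 0"] by simp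
    moreover have "L (rstd 0) \<noteq> 0"
    proof
      assume "L (rstd 0) = 0"
      then have "rstd 0 = 0" using L_inj linear_0[OF L_lin] by (metis injD)
      then show False using rstd_nth[of 0 0] by simp
    qed
    ultimately have "l\<^sup>2 = lam2" by simp
    then show "l = sqrt lam2" using l by (metis real_sqrt_unique)
  qed
  finally show ?thesis using nn by simp
qed

text \<open>The tangential part of \<open>J\<close> is skew with square - \<lambda>^2, so it
  accounts for the share \<lambda>^2 of the metric and the normal part for the rest. This is the
  source of the denominator in the mean curvature formula.\<close>

lemma normal_part_J:
  assumes cay: "cayley_at G L"
  shows "G (J (L y) - P (J (L y))) (J (L x)) = (1 - lam2) * G (L y) (L x)"
proof -
  obtain w where w: "P (J (L y)) = L w" using P_range by blast
  have "G (L w) (J (L x)) = - G (P (J (L w))) (L x)" by (simp add: P_G J_right)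
  also have "P (J (L w)) = - (lam2 *\<^sub>R L y)" using P_J_sq[OF cay, of y] w by simp
  finally show ?thesis by (simp add: lin_simps J_inv w algebra_simps)
qed

text \<open>If \<lambda> were 1, the normal part of \<open>J\<close> would vanish and
  \<open>J\<close> of a tangent vector would be tangent.\<close>

lemma totally_real_lam2:
  assumes cay: "cayley_at G L" and tr: "range L \<inter> J ` range L = {0}"
  shows "lam2 \<noteq> 1"
proof
  assume one: "lam2 = 1"
  let ?x = "L (rstd 0)" and ?n = "J (L (rstd 0)) - P (J (L (rstd 0)))"
  obtain w where w: "P (J ?x) = L w" using P_range by blast
  have "G ?n (L w) = 0" using P_G[of "J ?x" w] by (simp add: lin_simps)
  then have "G ?n ?n = 0"
    using normal_part_J[OF cay, of "rstd 0" "rstd 0"] one by (simp add: diff_right w)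
  then have "?n = 0" using pos[of ?n] by force
  then have "J ?x \<in> range L" using w by simp
  then have "J ?x \<in> range L \<inter> J ` range L" by blast
  then have "J ?x = 0" unfolding tr by simp
  then have "?x = 0" using J_J[of ?x] by simp
  then have "rstd 0 = 0" using L_inj linear_0[OF L_lin] by (metis injD)
  then show False using rstd_nth[of 0 0] by simp
qed

text \<open>A complex relation between the tangent vectors splits into x + J y = 0 with x and y
  tangent, which puts J y into the intersection.\<close>

lemma totally_real_cdet:
  assumes tr: "range L \<inter> J ` range L = {0}"
  shows "cdet (\<lambda>i. L (rstd i)) \<noteq> 0"
proof
  assume "cdet (\<lambda>i. L (rstd i)) = 0"
  then obtain z where z: "(\<Sum>k<4. z k *s L (rstd k)) = 0" "\<exists>k<4. z k \<noteq> 0" by (rule cdet_eq_zeroD)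
  define x where "x = (\<Sum>k<4. Re (z k) *\<^sub>R rstd k)"
  define y where "y = (\<Sum>k<4. Im (z k) *\<^sub>R rstd k)"
  have xy: "L x + J (L y) = 0"
    using z(1) by (simp add: x_def y_def L_simps(4,6) J_sum J_scaleR vec_cmul_eq sum.distrib)
  have "J (L y) = - L x" using xy by (simp add: eq_neg_iff_add_eq_0 add.commute)
  then have "J (L y) = L (- x)" by (simp add: L_simps(3))
  then have "J (L y) \<in> range L \<inter> J ` range L" by blast
  then have Jy: "J (L y) = 0" unfolding tr by simp
  then have "L y = 0" using J_J[of "L y"] by simp
  moreover have "L x = 0" using xy Jy by simp
  ultimately have "x = 0" "y = 0" using L_inj linear_0[OF L_lin] by (metis injD)+
  then have "z k = 0" if "k < 4" for k
    using sum_rstd_nth[OF that, of 4 "\<lambda>k. Re (z k)"] sum_rstd_nth[OF that, of 4 "\<lambda>k. Im (z k)"] that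
    unfolding x_def y_def by (simp add: complex_eq_iff)
  then show False using z(2) by blast
qed

text \<open>The frame spans over the complex numbers, so s = x + J y with x and y tangent. The
  imaginary parts of the Cramer coefficients are the coordinates of y, and the normal part of s only
  sees J y.\<close>

lemma Im_cramer:
  assumes cay: "cayley_at G L" and a: "orthonormal 4 a" and nz: "cdet (\<lambda>i. L (a i)) \<noteq> 0" and k: "k < 4"
  shows "(1 - lam2) * Im (cdet ((\<lambda>i. L (a i))(k := s)) / cdet (\<lambda>i. L (a i))) = G (s - P s) (J (L (a k)))"
proof -
  define z where "z k = cdet ((\<lambda>i. L (a i))(k := s)) / cdet (\<lambda>i. L (a i))" for k
  define x where "x = (\<Sum>k<4. Re (z k) *\<^sub>R a k)"
  define y where "y = (\<Sum>k<4. Im (z k) *\<^sub>R a k)"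
  have "s = (\<Sum>k<4. z k *s L (a k))" unfolding z_def by (rule cramer[OF nz])
  then have s: "s = L x + J (L y)"
    by (simp add: x_def y_def L_simps(4,6) J_sum J_scaleR vec_cmul_eq sum.distrib)
  have "s - P s = J (L y) - P (J (L y))"
    by (simp add: s linear_add[OF P_linear] P_L)
  then have "G (s - P s) (J (L (a k))) = (1 - lam2) * G (L y) (L (a k))"
    by (simp only: normal_part_J[OF cay])
  also have "G (L y) (L (a k)) = (\<Sum>j<4. if j = k then Im (z j) else 0)"
    unfolding y_def L_simps(6) sum_left
    using a k by (intro sum.cong) (auto simp: L_simps(4) lin_simps orthonormal_def m_def)
  also have "\<dots> = Im (z k)" using k by simp
  finally show ?thesis by (simp add: z_def)
qed

end

section \<open>The mean curvature of a Cayley submanifold\<close>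

context immersion
begin

text \<open>The product rule for the metric along \<open>f\<close>, arranged so that both arguments
  carry their covariant derivatives.\<close>

lemma metric_der:
  assumes q: "q \<in> D" and Y: "(Y has_derivative Y') (at q)" and Z: "(Z has_derivative Z') (at q)"
  shows "((\<lambda>z. G (f z) (Y z) (Z z)) has_derivative
    (\<lambda>x. G (f q) (\<Gamma> (f q) (L q x) (Y q) + Y' x) (Z q) + G (f q) (Y q) (\<Gamma> (f q) (L q x) (Z q) + Z' x))) (at q)"
proof -
  interpret hermitian "G (f q)" by (rule H[OF f_V[OF q]])
  have 1: "((\<lambda>z. G (f z) (Y z) w) has_derivative
      (\<lambda>x. M (f q) (L q x) (Y q) w + G (f q) (Y' x) w)) (at q)" for w
  proof (rule has_derivative_linear_family[OF open_D q, of "\<lambda>z v. G (f z) v w" "\<lambda>x v. M (f q) (L q x) v w"])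
    show "linear (\<lambda>v. G (f z) v w)" if "z \<in> D" for z by (rule hermitian.lin_left[OF H[OF f_V[OF that]]])
    show "((\<lambda>z. G (f z) v w) has_derivative (\<lambda>x. M (f q) (L q x) v w)) (at q)" for v
      by (rule has_derivative_compose[OF f_der[OF q] G_der[OF f_V[OF q]]])
  qed (rule Y)
  have "((\<lambda>z. G (f z) (Y z) (Z z)) has_derivative
      (\<lambda>x. (M (f q) (L q x) (Y q) (Z q) + G (f q) (Y' x) (Z q)) + G (f q) (Y q) (Z' x))) (at q)"
  proof (rule has_derivative_linear_family[OF open_D q, of "\<lambda>z w. G (f z) (Y z) w"
        "\<lambda>x w. M (f q) (L q x) (Y q) w + G (f q) (Y' x) w"])
    show "linear (\<lambda>w. G (f z) (Y z) w)" if "z \<in> D" for z by (rule hermitian.lin_right[OF H[OF f_V[OF that]]])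
  qed (rule 1 Z)+
  then show ?thesis
    by (rule has_derivative_eq_rhs) (simp add: fun_eq_iff compat[OF f_V[OF q]] lin_simps)
qed

text \<open>The ambient covariant derivative, in direction \<open>x\<close>, of the image under
  \<open>L\<close> of the constant field \<open>b\<close>; its normal part is the second fundamental
  form.\<close>

definition S :: "real^4 \<Rightarrow> real^4 \<Rightarrow> real^4 \<Rightarrow> complex^4" where
  "S q x b = DL q x b + \<Gamma> (f q) (L q x) (L q b)"

lemma S_sym: "q \<in> D \<Longrightarrow> S q x b = S q b x"
  unfolding S_def using DL_sym \<Gamma>_sym f_V by metis

lemma S_linear: "q \<in> D \<Longrightarrow> linear (S q x)" "q \<in> D \<Longrightarrow> linear (\<lambda>x. S q x b)"
proof -
  show 1: "linear (S q x)" if "q \<in> D" for x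
    unfolding S_def[abs_def]
    by (intro linear_compose_add DL_linear that
        linear_compose[OF L_linear[OF that] \<Gamma>_linear(1)[OF f_V[OF that]], unfolded comp_def])
  show "linear (\<lambda>x. S q x b)" if "q \<in> D"
    using 1[OF that, of b] S_sym[OF that, of _ b] by simp
qed

lemma second_ff_eq: "second_ff G f q x b = S q x b - proj (G (f q)) (range (L q)) (S q x b)"
  unfolding second_ff_def Let_def S_def DL_def ..

text \<open>
  The trace of the connection is computed by the complex linear extension to the ambient space of the
  map \<open>L b \<mapsto> S c b\<close>, whose trace can be taken in any real frame of the submanifold.
\<close>

lemma gamma_frame:
  assumes q: "q \<in> U" and nz: "cdet (\<lambda>i. L q (a i)) \<noteq> 0"
  shows "gamma_form G f q c = complex_of_real
    (\<Sum>i<4. Im (cdet ((\<lambda>i. L q (a i))(i := S q c (a i))) / cdet (\<lambda>i. L q (a i))))"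
proof -
  have qD: "q \<in> D" and \<Delta>: "\<Delta> q \<noteq> 0" using q by (auto simp: U_def)
  let ?v = "\<lambda>i. L q (rstd i)"
  have \<Delta>v: "cdet ?v = \<Delta> q" by (simp add: \<Delta>_def)
  define T where "T x = (\<Sum>k<4. (cdet (?v(k := x)) / \<Delta> q) *s S q c (rstd k))" for x
  have T_lin: "linear T"
  proof (rule linearI)
    fix x y :: "complex^4" and r :: real
    show "T (x + y) = T x + T y"
      unfolding T_def sum.distrib[symmetric]
    proof (rule sum.cong[OF refl])
      fix k assume "k \<in> {..<4::nat}"
      then show "(cdet (?v(k := x + y)) / \<Delta> q) *s S q c (rstd k) =
        (cdet (?v(k := x)) / \<Delta> q) *s S q c (rstd k) + (cdet (?v(k := y)) / \<Delta> q) *s S q c (rstd k)"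
        by (simp add: form40_add[OF form40_cdet] add_divide_distrib vec_eq_iff algebra_simps)
    qed
    show "T (r *\<^sub>R x) = r *\<^sub>R T x"
      unfolding T_def scaleR_sum_right
    proof (rule sum.cong[OF refl])
      fix k assume "k \<in> {..<4::nat}"
      then have "cdet (?v(k := r *\<^sub>R x)) = r *\<^sub>R cdet (?v(k := x))"
        using linear_scale[OF form40_linear[OF form40_cdet]] by simp
      then show "(cdet (?v(k := r *\<^sub>R x)) / \<Delta> q) *s S q c (rstd k) =
        r *\<^sub>R ((cdet (?v(k := x)) / \<Delta> q) *s S q c (rstd k))"
        by (simp add: vec_eq_iff scaleR_conv_of_real[where 'a = complex])
    qed
  qed
  have T_J: "T (J x) = J (T x)" for x
    unfolding T_def J_sum
  proof (rule sum.cong[OF refl])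
    fix k assume "k \<in> {..<4::nat}"
    then have "cdet (?v(k := J x)) = \<i> * cdet (?v(k := x))"
      using form40_J[OF form40_cdet] by simp
    then show "(cdet (?v(k := J x)) / \<Delta> q) *s S q c (rstd k) =
        J ((cdet (?v(k := x)) / \<Delta> q) *s S q c (rstd k))"
      by (simp add: J_def[of "z *s w" for z w] vec_eq_iff)
  qed
  have T_L: "T (L q b) = S q c b" for b
  proof -
    have "L q b = (\<Sum>k<4. complex_of_real (b $ xi k) *s ?v k)"
      unfolding of_real_cmul using arg_cong[OF rstd_expand[of b], of "L q"]
      by (simp add: linear_sum[OF L_linear[OF qD]] linear_scale[OF L_linear[OF qD]])
    then have "cdet (?v(k := L q b)) = complex_of_real (b $ xi k) * \<Delta> q" if "k < 4" for k
      unfolding \<Delta>v[symmetric] by (rule cdet_replace[OF that])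
    then have "T (L q b) = (\<Sum>k<4. complex_of_real (b $ xi k) *s S q c (rstd k))"
      unfolding T_def using \<Delta> by (intro sum.cong) auto
    also have "\<dots> = S q c (\<Sum>k<4. (b $ xi k) *\<^sub>R rstd k)"
      unfolding of_real_cmul by (simp add: linear_sum[OF S_linear(1)[OF qD]] linear_scale[OF S_linear(1)[OF qD]])
    finally show ?thesis by (simp only: rstd_expand[symmetric])
  qed
  have tr: "(\<Sum>i<4. cdet ((\<lambda>i. L q (b i))(i := S q c (b i)))) = ctrace T * cdet (\<lambda>i. L q (b i))" for b
    using ctrace_cdet[OF T_lin T_J, of "\<lambda>i. L q (b i)"] by (simp add: T_L)
  \<comment> \<open>Adding the Christoffel term slot by slot turns the coordinate derivative
    \<open>DL\<close> into the covariant derivative \<open>S\<close>.\<close>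
  have "d\<Delta> q c + ctrace (\<Gamma> (f q) (L q c)) * \<Delta> q =
      (\<Sum>i<4. cdet (?v(i := DL q c (rstd i))) + cdet (?v(i := \<Gamma> (f q) (L q c) (?v i))))"
    unfolding d\<Delta>_def \<Delta>v[symmetric]
    by (subst ctrace_cdet[OF \<Gamma>_linear(1)[OF f_V[OF qD]] \<Gamma>_J[OF f_V[OF qD]], symmetric])
      (simp only: sum.distrib)
  also have "\<dots> = (\<Sum>i<4. cdet (?v(i := S q c (rstd i))))"
    by (rule sum.cong[OF refl]) (simp add: S_def form40_add[OF form40_cdet])
  also have "\<dots> = ctrace T * \<Delta> q" using tr[of rstd] by (simp add: \<Delta>v)
  finally have "ctrace T = d\<Delta> q c / \<Delta> q + ctrace (\<Gamma> (f q) (L q c))"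
    using \<Delta> by (simp add: field_simps)
  moreover have "ctrace T = (\<Sum>i<4. cdet ((\<lambda>i. L q (a i))(i := S q c (a i))) / cdet (\<lambda>i. L q (a i)))"
    using tr[of a] nz by (simp add: sum_divide_distrib[symmetric])
  ultimately show ?thesis
    unfolding gamma_eq[OF q] by (metis plus_complex.sel(2) Im_sum)
qed

end

section \<open>Differentiating self-duality\<close>

locale cayley_immersion = immersion +
  assumes cayley: "q \<in> D \<Longrightarrow> cayley_at (G (f q)) (L q)"
begin

abbreviation h :: "real^4 \<Rightarrow> real^4 \<Rightarrow> real^4 \<Rightarrow> complex^4" where
  "h \<equiv> second_ff G f"

text \<open>The derivative of the restricted Kaehler form on a frame field through \<open>a\<close>
  whose covariant derivatives at \<open>p\<close> are normal. As \<open>J\<close> is parallel, each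
  argument just contributes its second fundamental form.\<close>

definition dk :: "real^4 \<Rightarrow> (nat \<Rightarrow> real^4) \<Rightarrow> real^4 \<Rightarrow> nat \<Rightarrow> nat \<Rightarrow> real" where
  "dk p a x s t = G (f p) (J (h p x (a s))) (L p (a t)) + G (f p) (J (L p (a s))) (h p x (a t))"

text \<open>
  A frame field whose covariant derivative at \<open>p\<close> is normal to the submanifold has a Gram matrix that
  is constant to first order at \<open>p\<close>, so differentiating the self-duality of the Kaehler form in this
  frame shows that its covariant derivative is self-dual.
\<close>

lemma dk_self_dual:
  assumes p: "p \<in> D" and a: "pos_frame (G (f p)) (L p) a"
  shows "dk p a x 2 3 = dk p a x 0 1" and "dk p a x 3 1 = dk p a x 0 2" and "dk p a x 1 2 = dk p a x 0 3"
proof -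
  interpret tangent "G (f p)" "L p" by (rule tangent_at[OF p])
  have o: "orthonormal 4 a" and r: "rdet a > 0" using a by (auto simp: pos_frame_orthonormal)
  have m1: "G (f p) (L p (a s)) (L p (a t)) = (if s = t then 1 else 0)" if "s < 4" "t < 4" for s t
    using o that by (simp add: orthonormal_def m_def)
  let ?X = "\<lambda>i. L p (a i)"
  \<comment> \<open>The tangential part of the covariant derivative of the \<open>i\<close>-th
    vector, in parameter coordinates. Subtracting it linearly in \<open>q - p\<close> leaves a frame
    field through \<open>a\<close> with normal covariant derivative at \<open>p\<close>.\<close>
  define \<tau> where "\<tau> i x = (\<Sum>k<4. G (f p) (?X k) (S p x (a i)) *\<^sub>R a k)" for i x
  define b where "b q i = a i - \<tau> i (q - p)" for q i
  have \<tau>_lin: "linear (\<tau> i)" for i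
    unfolding \<tau>_def[abs_def]
    by (rule linearI) (simp_all add: linear_add[OF S_linear(2)[OF p]] linear_scale[OF S_linear(2)[OF p]]
        lin_simps scaleR_left_distrib sum.distrib scaleR_sum_right)
  have L\<tau>: "L p (\<tau> i x) = P (S p x (a i))" for i x
    unfolding \<tau>_def P_eq[OF o] by (simp add: L_simps(4,6))
  have h_eq: "h p x (a i) = S p x (a i) - P (S p x (a i))" for x i
    by (simp add: second_ff_eq P_def)
  have h_normal: "G (f p) (h p x (a i)) (L p v) = 0" "G (f p) (L p v) (h p x (a i)) = 0" for x i v
    unfolding commute[of "L p v"] h_eq using P_G[of "S p x (a i)" v] by (simp_all add: lin_simps)
  have b_der: "((\<lambda>q. b q i) has_derivative (\<lambda>x. - \<tau> i x)) (at p)" for i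
  proof -
    have "((\<lambda>q. \<tau> i (q - p)) has_derivative (\<lambda>x. \<tau> i (x - 0))) (at p)"
      by (intro bounded_linear.has_derivative[OF linear_conv_bounded_linear[THEN iffD1, OF \<tau>_lin]] derivative_intros)
    from has_derivative_diff[OF has_derivative_const[of "a i"] this]
    show ?thesis unfolding b_def by simp
  qed
  have bp: "b p i = a i" for i unfolding b_def by (simp add: linear_0[OF \<tau>_lin])
  have X_der: "((\<lambda>q. L q (b q i)) has_derivative (\<lambda>x. DL p x (a i) - P (S p x (a i)))) (at p)" for i
  proof -
    have "((\<lambda>q. L q (b q i)) has_derivative (\<lambda>x. DL p x (b p i) + L p (- \<tau> i x))) (at p)"
      by (rule has_derivative_linear_family[OF open_D p, of L "DL p"]) (rule L_linear L_der[OF p] b_der | assumption)+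
    then show ?thesis by (simp add: bp L\<tau> L_simps(3))
  qed
  have h_cov: "\<Gamma> (f p) (L p x) (?X i) + (DL p x (a i) - P (S p x (a i))) = h p x (a i)" for x i
    unfolding h_eq by (simp add: S_def)
  have m_der: "((\<lambda>q. G (f q) (L q (b q s)) (L q (b q t))) has_derivative (\<lambda>x. 0)) (at p)" for s t
    using metric_der[OF p X_der[of s] X_der[of t]] unfolding bp h_cov h_normal by simp
  have JX_der: "((\<lambda>q. J (L q (b q s))) has_derivative (\<lambda>x. J (DL p x (a s) - P (S p x (a s))))) (at p)" for s
    by (rule bounded_linear.has_derivative[OF linear_conv_bounded_linear[THEN iffD1, OF linear_J] X_der])
  have A_der: "((\<lambda>q. kform (G (f q)) (L q (b q s)) (L q (b q t))) has_derivative (\<lambda>x. dk p a x s t)) (at p)" for s t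
    using metric_der[OF p JX_der[of s] X_der[of t]]
    unfolding bp h_cov \<Gamma>_J[OF f_V[OF p]] J_add[symmetric] kform_def dk_def .
  \<comment> \<open>Near \<open>p\<close> the modified frame is still positively oriented, as
    \<open>cayley_frame\<close> demands.\<close>
  define W where "W = {q \<in> D. rdet (b q) > 0}"
  have "continuous_on D (\<lambda>q. rdet (b q))"
  proof -
    have "continuous_on D (\<lambda>q. \<tau> i (q - p))" for i
      by (rule linear_continuous_on_compose[OF _ \<tau>_lin]) (intro continuous_intros)
    then have "continuous_on D (\<lambda>q. b q i $ k)" for i k
      unfolding b_def by (intro continuous_intros)
    then show ?thesis unfolding rdet_def ndet_def
      by (intro continuous_on_sum continuous_on_mult continuous_on_prod continuous_on_const)
  qed
  then have "open (D \<inter> (\<lambda>q. rdet (b q)) -` {0<..})"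
    by (rule continuous_open_preimage[OF _ open_D]) auto
  also have "D \<inter> (\<lambda>q. rdet (b q)) -` {0<..} = W" by (auto simp: W_def)
  finally have W_open: "open W" .
  have "b p = a" using bp by auto
  then have W_p: "p \<in> W" using p r by (simp add: W_def)
  have one: "ndet 4 (\<lambda>s t. G (f p) (L p (b p s)) (L p (b p t))) = 1"
  proof -
    have "ndet 4 (\<lambda>s t. G (f p) (L p (b p s)) (L p (b p t))) = ndet 4 (\<lambda>s t. if s = t then 1 else 0)"
      by (rule ndet_cong) (simp add: bp m1)
    then show ?thesis by (simp add: ndet_one)
  qed
  \<comment> \<open>The Gram determinant is 1 at \<open>p\<close> and stationary there, so its
    square root can be differentiated and contributes nothing.\<close>
  have n_der: "((\<lambda>q. ndet 4 (\<lambda>s t. G (f q) (L q (b q s)) (L q (b q t)))) has_derivative (\<lambda>x. 0)) (at p)"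
    using has_derivative_ndet_one[of "\<lambda>q s t. G (f q) (L q (b q s)) (L q (b q t))" "\<lambda>s t x. 0" p 4] m_der m1
    by (simp add: bp)
  have key: "2 * dk p a x k l = (\<Sum>\<sigma> | \<sigma> permutes {..<4}. of_int (sign \<sigma>) *
      (dk p a x (\<sigma> 0) (\<sigma> 1) * G (f p) (?X k) (?X (\<sigma> 2)) * G (f p) (?X l) (?X (\<sigma> 3))))" for k l
  proof -
    let ?l = "\<lambda>q. 2 * sqrt (ndet 4 (\<lambda>s t. G (f q) (L q (b q s)) (L q (b q t)))) *
       kform (G (f q)) (L q (b q k)) (L q (b q l))"
    let ?r = "\<lambda>q. \<Sum>\<sigma> | \<sigma> permutes {..<4}. of_int (sign \<sigma>) *
      (kform (G (f q)) (L q (b q (\<sigma> 0))) (L q (b q (\<sigma> 1))) *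
      G (f q) (L q (b q k)) (L q (b q (\<sigma> 2))) * G (f q) (L q (b q l)) (L q (b q (\<sigma> 3))))"
    have l: "(?l has_derivative (\<lambda>x. 2 * dk p a x k l)) (at p)"
      by (rule has_derivative_eq_rhs[OF has_derivative_mult[OF has_derivative_mult_right[OF
              has_derivative_real_sqrt[OF _ n_der]] A_der]]) (simp_all add: one)
    have r: "(?r has_derivative
      (\<lambda>x. \<Sum>\<sigma> | \<sigma> permutes {..<4}. of_int (sign \<sigma>) *
      (dk p a x (\<sigma> 0) (\<sigma> 1) * G (f p) (?X k) (?X (\<sigma> 2)) * G (f p) (?X l) (?X (\<sigma> 3))))) (at p)"
      by (intro has_derivative_sum has_derivative_mult_right
          has_derivative_eq_rhs[OF has_derivative_mult[OF has_derivative_mult[OF A_der m_der] m_der]])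
        (simp add: bp)
    \<comment> \<open>Both sides of \<open>cayley_frame\<close> are the same function near
      \<open>p\<close>; on either side only the factor \<open>kform\<close> has a nonzero
      derivative.\<close>
    have "(?r has_derivative
      (\<lambda>x. 2 * dk p a x k l)) (at p)"
    proof (rule has_derivative_transform_within_open[OF l W_open W_p])
      fix q assume "q \<in> W"
      then have q: "q \<in> D" "rdet (b q) > 0" by (auto simp: W_def)
      show "?l q = ?r q"
        by (rule tangent.cayley_frame[OF tangent_at[OF q(1)] cayley[OF q(1)] q(2)])
    qed
    from has_derivative_unique[OF this r] show ?thesis by (rule fun_cong)
  qed
  note ex = sum_permutes_4[of "\<lambda>s t u v. dk p a x s t * G (f p) (?X k) (?X u) * G (f p) (?X l) (?X v)" for x k l]
  have skew: "dk p a x s t = - dk p a x t s" for s t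
    unfolding dk_def using J_left[of "h p x (a s)" "?X t"] J_left[of "?X s" "h p x (a t)"]
      commute[of "h p x (a s)" "J (?X t)"] commute[of "?X s" "J (h p x (a t))"] by linarith
  show "dk p a x 2 3 = dk p a x 0 1"
    using key[of 2 3] unfolding ex using skew[of 1 0] by (simp add: m1)
  show "dk p a x 3 1 = dk p a x 0 2"
    using key[of 3 1] unfolding ex using skew[of 2 0] by (simp add: m1)
  show "dk p a x 1 2 = dk p a x 0 3"
    using key[of 1 2] unfolding ex using skew[of 3 0] by (simp add: m1)
qed

text \<open>A closed self-dual form is coclosed: the resulting identity computes the mean curvature.\<close>

lemma mean_curvature_trace:
  assumes p: "p \<in> D"
  defines "a \<equiv> tangent.the_frame (G (f p)) (L p)"
  shows "(\<Sum>i<4. G (f p) (h p c (a i)) (J (L p (a i)))) = G (f p) (mean_curvature G f p) (J (L p c))"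
proof -
  interpret tangent "G (f p)" "L p" by (rule tangent_at[OF p])
  have a: "pos_frame (G (f p)) (L p) a" unfolding a_def by (rule the_frame)
  then have o: "orthonormal 4 a" by (simp add: pos_frame_orthonormal)
  have mc: "mean_curvature G f p = (\<Sum>i<4. h p (a i) (a i))"
    unfolding mean_curvature_def Let_def a_def the_frame_def ..
  define C where "C r s t = G (f p) (h p (a r) (a s)) (J (L p (a t)))" for r s t
  have C_sym: "C r s t = C s r t" for r s t
    unfolding C_def second_ff_eq S_sym[OF p, of "a r"] ..
  have dk: "dk p a (a r) s t = C r t s - C r s t" for r s t
    unfolding dk_def C_def
    using J_left[of "h p (a r) (a s)"] commute[of "J (L p (a s))"] by simp
  note sd = dk_self_dual[OF p a, of "a r" for r, unfolded dk]
  \<comment> \<open>The summands differ by \<open>dk\<close> in direction \<open>a i\<close> on the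
    pair \<open>i\<close>, \<open>k\<close>, so the difference of the sums is a divergence.
    Self-duality turns it into a cyclic sum of \<open>dk\<close>, and that vanishes by the symmetry
    of \<open>C\<close> in its first two indices.\<close>
  have frame: "(\<Sum>i<4. C k i i) = (\<Sum>i<4. C i i k)" if "k < 4" for k
  proof -
    have "k \<in> {0, 1, 2, 3}" using that by auto
    then show ?thesis
      using sd(1)[of 0] sd(2)[of 0] sd(3)[of 0] sd(1)[of 1] sd(2)[of 1] sd(3)[of 1]
        sd(1)[of 2] sd(2)[of 2] sd(3)[of 2] sd(1)[of 3] sd(2)[of 3] sd(3)[of 3]
        C_sym[of 1 0] C_sym[of 2 0] C_sym[of 3 0] C_sym[of 2 1] C_sym[of 3 1] C_sym[of 3 2]
      by (auto simp: sum_lessThan_4)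
  qed
  let ?l = "\<lambda>c. \<Sum>i<4. G (f p) (h p c (a i)) (J (L p (a i)))"
  let ?r = "\<lambda>c. G (f p) (mean_curvature G f p) (J (L p c))"
  have h_lin: "linear (\<lambda>c. h p c b)" for b
    unfolding second_ff_eq P_def[symmetric]
    by (intro linear_compose_sub S_linear(2)[OF p] linear_compose[OF S_linear(2)[OF p] P_linear, unfolded comp_def])
  have l_lin: "linear ?l"
    by (intro linear_compose_sum ballI linear_compose[OF h_lin lin_left, unfolded comp_def])
  have r_lin: "linear ?r"
    using linear_compose[OF linear_compose[OF L_lin linear_J] lin_right] by (simp add: comp_def)
  have "?l (a k) = ?r (a k)" if "k < 4" for k
    using frame[OF that] unfolding mc sum_left C_def .
  then have eq: "(\<Sum>k<4. m (a k) c *\<^sub>R ?l (a k)) = (\<Sum>k<4. m (a k) c *\<^sub>R ?r (a k))"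
    by (intro sum.cong) auto
  have "?l c = ?l (\<Sum>k<4. m (a k) c *\<^sub>R a k)" by (simp only: orthonormal_expand[OF o, symmetric])
  also have "\<dots> = (\<Sum>k<4. m (a k) c *\<^sub>R ?l (a k))"
    unfolding linear_sum[OF l_lin] linear_scale[OF l_lin] ..
  also have "\<dots> = ?r (\<Sum>k<4. m (a k) c *\<^sub>R a k)"
    unfolding linear_sum[OF r_lin] linear_scale[OF r_lin] eq ..
  also have "\<dots> = ?r c" by (simp only: orthonormal_expand[OF o, symmetric])
  finally show ?thesis .
qed

text \<open>In an orthonormal frame, \<open>Im_cramer\<close> turns each imaginary coefficient into
  an inner product with the second fundamental form, and \<open>mean_curvature_trace\<close> sums
  these. Dividing by the nonzero factor 1 - \<lambda>^2 finishes the computation.\<close>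

lemma gamma_mean_curvature:
  assumes p: "p \<in> D" and tr: "range (L p) \<inter> J ` range (L p) = {0}"
  shows "gamma_form G f p c = complex_of_real
    (kform (G (f p)) (mean_curvature G f p) (L p c) / ((cayley_lambda (G (f p)) (L p))\<^sup>2 - 1))"
proof -
  interpret tangent "G (f p)" "L p" by (rule tangent_at[OF p])
  define a where "a = the_frame"
  have o: "orthonormal 4 a" unfolding a_def by (rule frame_orthonormal)
  have nz: "cdet (\<lambda>i. L p (rstd i)) \<noteq> 0" by (rule totally_real_cdet[OF tr])
  then have pU: "p \<in> U" using p by (simp add: U_def \<Delta>_def)
  have nza: "cdet (\<lambda>i. L p (a i)) \<noteq> 0"
    unfolding cdet_L[of a] using nz orthonormal_rdet[OF o] by simp
  have l1: "lam2 \<noteq> 1" by (rule totally_real_lam2[OF cayley[OF p] tr])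
  let ?y = "\<lambda>i. Im (cdet ((\<lambda>i. L p (a i))(i := S p c (a i))) / cdet (\<lambda>i. L p (a i)))"
  have "(1 - lam2) * (\<Sum>i<4. ?y i) = (\<Sum>i<4. G (f p) (h p c (a i)) (J (L p (a i))))"
    unfolding sum_distrib_left second_ff_eq P_def[symmetric]
    by (rule sum.cong[OF refl]) (simp only: Im_cramer[OF cayley[OF p] o nza] lessThan_iff)
  \<comment> \<open>Moving \<open>J\<close> to the other side of the metric costs a sign; this is
    why the final denominator is \<lambda>^2 - 1 and not 1 - \<lambda>^2.\<close>
  also have "\<dots> = - kform (G (f p)) (mean_curvature G f p) (L p c)"
    using mean_curvature_trace[OF p, of c] unfolding a_def kform_def by (simp add: J_left)
  finally have "(\<Sum>i<4. ?y i) = kform (G (f p)) (mean_curvature G f p) (L p c) / (lam2 - 1)"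
    using l1 by (simp add: field_simps)
  then show ?thesis
    unfolding gamma_frame[OF pU nza] cayley_lambda_sq[OF cayley[OF p]] by simp
qed

end

section \<open>From a single chart and parametrization to the manifold\<close>

theorem theorem3:
  fixes A :: "'m::{t2_space,second_countable_topology} chart set"
    and g :: "'m chart \<Rightarrow> metric_field"
    and N :: "'m set" and P :: "'m param set"
  assumes "kaehler_manifold A g"
    and "cayley_submanifold A g N P"
  shows "\<forall>c\<in>A. \<forall>S\<in>P. \<forall>p\<in>totally_real_dom c S.
    (let G = g c; f = local_map c S; L = frechet_derivative f (at p); \<gamma> = gamma_form G f
     in (\<forall>a. \<gamma> p a = complex_of_real
              (kform (G (f p)) (mean_curvature G f p) (L a) /
               ((cayley_lambda (G (f p)) L)\<^sup>2 - 1))) \<and>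
        (\<forall>b. (\<lambda>q. \<gamma> q b) differentiable (at p)) \<and>
        (\<forall>a b. ext_deriv1 \<gamma> p a b = complex_of_real (ricci_form G (f p) (L a) (L b))))"
proof (intro ballI)
  fix c S p assume c: "c \<in> A" and S: "S \<in> P" and p: "p \<in> totally_real_dom c S"
  have at: "complex_atlas A" and met: "hermitian_metric A g"
    and cl: "\<forall>c\<in>A. \<forall>y\<in>snd c ` fst c. \<forall>u v w. d_kform (g c) y u v w = 0"
    using assms(1) unfolding kaehler_manifold_def by blast+
  have sub: "oriented_submanifold A N P"
    and cay: "\<forall>c\<in>A. \<forall>S\<in>P. \<forall>p\<in>local_dom c S.
        cayley_at (g c (local_map c S p)) (frechet_derivative (local_map c S) (at p))"
    using assms(2) unfolding cayley_submanifold_def by blast+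
  have op: "open (fst c)" "open (snd c ` fst c)"
    using at c unfolding complex_atlas_def by (cases c; auto)+
  have W: "open (fst S)" "continuous_on (fst S) (snd S)"
    using sub S unfolding oriented_submanifold_def by (cases S; auto)+
  have sm: "smooth_on (local_dom c S) (local_map c S)"
    "\<forall>q\<in>local_dom c S. inj (frechet_derivative (local_map c S) (at q))"
    using sub S c unfolding oriented_submanifold_def by blast+
  have dom: "local_dom c S = fst S \<inter> snd S -` fst c" by (auto simp: local_dom_def)
  \<comment> \<open>The parameter domain is the preimage of an open chart domain under a continuous
    map. It is therefore open for an immersed submanifold as well, and all local results apply to
    the coordinate expression.\<close>
  interpret cayley_immersion "snd c ` fst c" "g c" "local_dom c S" "local_map c S"
  proof unfold_locales
    show "open (local_dom c S)"
      unfolding dom using W op by (intro continuous_open_preimage)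
    show "local_map c S q \<in> snd c ` fst c" if "q \<in> local_dom c S" for q
      using that by (auto simp: local_dom_def local_map_def)
  qed (use op met cl sm cay c S in \<open>auto simp: hermitian_metric_def\<close>)
  have pD: "p \<in> local_dom c S" and tr: "range (L p) \<inter> J ` range (L p) = {0}"
    using p by (auto simp: totally_real_dom_def Let_def)
  have pU: "p \<in> U"
    using tangent.totally_real_cdet[OF tangent_at[OF pD] tr] pD by (simp add: U_def \<Delta>_def)
  show "let G = g c; f = local_map c S; L = frechet_derivative f (at p); \<gamma> = gamma_form G f
     in (\<forall>a. \<gamma> p a = complex_of_real
              (kform (G (f p)) (mean_curvature G f p) (L a) /
               ((cayley_lambda (G (f p)) L)\<^sup>2 - 1))) \<and>
        (\<forall>b. (\<lambda>q. \<gamma> q b) differentiable (at p)) \<and>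
        (\<forall>a b. ext_deriv1 \<gamma> p a b = complex_of_real (ricci_form G (f p) (L a) (L b)))"
    unfolding Let_def
    by (intro conjI allI gamma_mean_curvature[OF pD tr] gamma_ext_deriv[OF pU])
qed

end
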